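(* Let $\alpha>0$, $\beta>0$, and let $\mathbb{V}$ be a complex Hilbert space. The mapping $\mathcal{D}:H^2(\mathbb{C}_\alpha,\mathbb{V})\to H^2(\mathbb{D},\mathbb{V})$ defined on boundary values by $$\mathcal{D}(\widehat{f})(e^{i\theta})=\frac{2\sqrt{\beta\pi}}{1-e^{i\theta}}\;\widehat{f}\big(\mathcal{M}^{-1}(e^{i\theta})\big)\qquad\text{for almost every }\theta\in(0,2\pi)$$ is an isometric isomorphism.
   Context: $\mathbb{C}_\alpha=\{s\in\mathbb{C}:\operatorname{Re}(s)>\alpha\}$ and $\mathbb{D}=\{\omega\in\mathbb{C}:|\omega|<1\}$, with boundary $\mathbb{T}=\{\omega\in\mathbb{C}:|\omega|=1\}$. $\mathcal{M}(s)=\frac{s-\alpha-\beta}{s-\alpha+\beta}$ is the Möbius transformation of $\mathbb{C}_\alpha$ onto $\mathbb{D}$, with inverse $\mathcal{M}^{-1}(\omega)=\frac{2\beta}{1-\omega}+\alpha-\beta$; it sends the line $\operatorname{Re}(s)=\alpha$ onto $\mathbb{T}\setminus\{1\}$. $H^2(\mathbb{C}_\alpha,\mathbb{V})$ is the space of holomorphic $\widehat f:\mathbb{C}_\alpha\to\mathbb{V}$ with $$\|\widehat f\|_{H^2(\mathbb{C}_\alpha,\mathbb{V})}=\sup_{\sigma>\alpha}\left(\int_{-\infty}^{\infty}\|\widehat f(\sigma+i\tau)\|_{\mathbb{V}}^2\,d\tau\right)^{1/2}<\infty.$$ $H^2(\mathbb{D},\mathbb{V})$ is the space of holomorphic $\widehat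 g:\mathbb{D}\to\mathbb{V}$ with $$\|\widehat g\|_{H^2(\mathbb{D},\mathbb{V})}=\sup_{0\le r<1}\left(\frac{1}{2\pi}\int_0^{2\pi}\|\widehat g(re^{i\theta})\|_{\mathbb{V}}^2\,d\theta\right)^{1/2}<\infty.$$ Functions in these spaces are identified with their almost-everywhere boundary functions: $\widehat f(\alpha+i\tau)=\lim_{\sigma\to\alpha^+}\widehat f(\sigma+i\tau)$ and $\widehat g(e^{i\theta})=\lim_{r\to1^-}\widehat g(re^{i\theta})$. Thus the formula for $\mathcal{D}(\widehat f)$ on $\mathbb{T}$ involves the boundary function of $\widehat f$ on the line $\operatorname{Re}(s)=\alpha$, and $\mathcal{D}(\widehat f)$ is the element of $H^2(\mathbb{D},\mathbb{V})$ with this boundary function, i.e. the function $\omega\mapsto\frac{2\sqrt{\beta\pi}}{1-\omega}\,\widehat f(\mathcal{M}^{-1}(\omega))$ on $\mathbb{D}$. *)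

theory Defs
  imports "HOL-Complex_Analysis.Complex_Analysis"
begin

text \<open>Complex Hilbert spaces; the inner product is linear in its first argument. The real vector
  space structure and the metric are those inherited from \<^class>\<open>banach\<close>, so the last two axioms
  tie them to the complex scalar multiplication and to the inner product.\<close>

class complex_hilbert_space = banach +
  fixes scaleC :: "complex \<Rightarrow> 'a \<Rightarrow> 'a"  (infixr "*\<^sub>C" 75)
    and cinner :: "'a \<Rightarrow> 'a \<Rightarrow> complex"
  assumes scaleC_add_right: "a *\<^sub>C (x + y) = a *\<^sub>C x + a *\<^sub>C y"
    and scaleC_add_left: "(a + b) *\<^sub>C x = a *\<^sub>C x + b *\<^sub>C x"
    and scaleC_scaleC: "a *\<^sub>C (b *\<^sub>C x) = (a * b) *\<^sub>C x"
    and scaleC_one: "1 *\<^sub>C x = x"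
    and cinner_add_left: "cinner (x + y) z = cinner x z + cinner y z"
    and cinner_scaleC_left: "cinner (a *\<^sub>C x) y = a * cinner x y"
    and cinner_commute: "cinner x y = cnj (cinner y x)"
    and scaleR_scaleC: "r *\<^sub>R x = complex_of_real r *\<^sub>C x"
    and cinner_self: "cinner x x = complex_of_real ((norm x)\<^sup>2)"

instantiation complex :: complex_hilbert_space
begin

definition scaleC_complex :: "complex \<Rightarrow> complex \<Rightarrow> complex"
  where "scaleC_complex a x = a * x"

definition cinner_complex :: "complex \<Rightarrow> complex \<Rightarrow> complex"
  where "cinner_complex x y = x * cnj y"

instance
proof
  show "cinner x x = complex_of_real ((norm x)\<^sup>2)" for x :: complex
    unfolding cinner_complex_def by (rule complex_norm_square [symmetric])
qed (auto simp: scaleC_complex_def cinner_complex_def algebra_simps scaleR_conv_of_real)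

end

definition halfplane :: "real \<Rightarrow> complex set"
  where "halfplane \<alpha> = {s. Re s > \<alpha>}"

definition disc :: "complex set"
  where "disc = {\<omega>. cmod \<omega> < 1}"

definition mobius :: "real \<Rightarrow> real \<Rightarrow> complex \<Rightarrow> complex"
  where "mobius \<alpha> \<beta> s = (s - of_real \<alpha> - of_real \<beta>) / (s - of_real \<alpha> + of_real \<beta>)"

definition mobius_inv :: "real \<Rightarrow> real \<Rightarrow> complex \<Rightarrow> complex"
  where "mobius_inv \<alpha> \<beta> \<omega> = 2 * of_real \<beta> / (1 - \<omega>) + of_real \<alpha> - of_real \<beta>"

lemma mobius_mobius_inv:
  assumes "\<beta> \<noteq> 0" "\<omega> \<noteq> 1"
  shows "mobius \<alpha> \<beta> (mobius_inv \<alpha> \<beta> \<omega>) = \<omega>"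
  using assms by (simp add: mobius_def mobius_inv_def field_simps)

lemma mobius_inv_mobius:
  assumes "\<beta> \<noteq> 0" "s \<noteq> of_real \<alpha> - of_real \<beta>"
  shows "mobius_inv \<alpha> \<beta> (mobius \<alpha> \<beta> s) = s"
proof -
  have nz: "s - of_real \<alpha> + of_real \<beta> \<noteq> 0"
    using assms(2) by (auto simp: algebra_simps add_eq_0_iff)
  then have "1 - mobius \<alpha> \<beta> s = 2 * of_real \<beta> / (s - of_real \<alpha> + of_real \<beta>)"
    by (simp add: mobius_def field_simps)
  then show ?thesis
    using assms(1) nz by (simp add: mobius_inv_def)
qed

text \<open>Complex differentiability of vector-valued functions.\<close>

definition vholomorphic_on :: "(complex \<Rightarrow> 'v::complex_hilbert_space) \<Rightarrow> complex set \<Rightarrow> bool"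
  where "vholomorphic_on f S \<longleftrightarrow>
    (\<forall>s\<in>S. \<exists>d. (f has_derivative (\<lambda>h. h *\<^sub>C d)) (at s within S))"

text \<open>A function on the half-plane or the disc is represented by its extension by zero, so that
  equality of elements is equality of HOL functions and the vector space operations are pointwise.
  Since the Bochner integral of a non-integrable function is 0 and \<^const>\<open>Sup\<close> of an unbounded set
  of reals is unspecified, finiteness of the norm is spelled out as integrability and boundedness;
  on circles integrability is automatic by continuity.\<close>

definition H2_halfplane_norm :: "real \<Rightarrow> (complex \<Rightarrow> 'v::complex_hilbert_space) \<Rightarrow> real"
  where "H2_halfplane_norm \<alpha> f =
    (SUP \<sigma>\<in>{\<alpha><..}. sqrt (LINT \<tau>|lborel. (norm (f (Complex \<sigma> \<tau>)))\<^sup>2))"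

definition H2_halfplane :: "real \<Rightarrow> (complex \<Rightarrow> 'v::complex_hilbert_space) set"
  where "H2_halfplane \<alpha> = {f.
    (\<forall>s. s \<notin> halfplane \<alpha> \<longrightarrow> f s = 0) \<and>
    vholomorphic_on f (halfplane \<alpha>) \<and>
    (\<forall>\<sigma>>\<alpha>. integrable lborel (\<lambda>\<tau>. (norm (f (Complex \<sigma> \<tau>)))\<^sup>2)) \<and>
    bdd_above ((\<lambda>\<sigma>. sqrt (LINT \<tau>|lborel. (norm (f (Complex \<sigma> \<tau>)))\<^sup>2)) ` {\<alpha><..})}"

definition H2_disc_norm :: "(complex \<Rightarrow> 'v::complex_hilbert_space) \<Rightarrow> real"
  where "H2_disc_norm g =
    (SUP r\<in>{0..<1}. sqrt (1 / (2 * pi) *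
       (LINT \<theta>:{0..2*pi}|lborel. (norm (g (of_real r * cis \<theta>)))\<^sup>2)))"

definition H2_disc :: "(complex \<Rightarrow> 'v::complex_hilbert_space) set"
  where "H2_disc = {g.
    (\<forall>\<omega>. \<omega> \<notin> disc \<longrightarrow> g \<omega> = 0) \<and>
    vholomorphic_on g disc \<and>
    bdd_above ((\<lambda>r. sqrt (1 / (2 * pi) *
       (LINT \<theta>:{0..2*pi}|lborel. (norm (g (of_real r * cis \<theta>)))\<^sup>2))) ` {0..<1})}"

text \<open>Boundary values: \<open>l\<close> is the horizontal limit of \<open>f\<close> at the point \<open>s\<close> of the line
  \<open>Re s = \<alpha>\<close>, respectively the radial limit of \<open>g\<close> at the point \<open>\<zeta>\<close> of the unit circle.\<close>

definition halfplane_boundary_value ::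
    "real \<Rightarrow> (complex \<Rightarrow> 'v::complex_hilbert_space) \<Rightarrow> complex \<Rightarrow> 'v \<Rightarrow> bool"
  where "halfplane_boundary_value \<alpha> f s l \<longleftrightarrow>
    ((\<lambda>\<sigma>. f (Complex \<sigma> (Im s))) \<longlongrightarrow> l) (at_right \<alpha>)"

definition disc_boundary_value ::
    "(complex \<Rightarrow> 'v::complex_hilbert_space) \<Rightarrow> complex \<Rightarrow> 'v \<Rightarrow> bool"
  where "disc_boundary_value g \<zeta> l \<longleftrightarrow>
    ((\<lambda>r. g (of_real r * \<zeta>)) \<longlongrightarrow> l) (at_left 1)"

text \<open>The boundary functions of \<open>f\<close> and \<open>g\<close> exist almost everywhere and satisfy
  \<open>g(\<zeta>) = 2 sqrt (\<beta> \<pi>) / (1 - \<zeta>) f(M\<^sup>-\<^sup>1(\<zeta>))\<close> for almost every \<open>\<zeta>\<close> on the circle.\<close>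

definition D_boundary_relation ::
    "real \<Rightarrow> real \<Rightarrow> (complex \<Rightarrow> 'v::complex_hilbert_space) \<Rightarrow> (complex \<Rightarrow> 'v) \<Rightarrow> bool"
  where "D_boundary_relation \<alpha> \<beta> f g \<longleftrightarrow>
    (AE \<theta> in lborel. \<theta> \<in> {0<..<2*pi} \<longrightarrow>
      (\<exists>l. halfplane_boundary_value \<alpha> f (mobius_inv \<alpha> \<beta> (cis \<theta>)) l \<and>
           disc_boundary_value g (cis \<theta>)
             ((of_real (2 * sqrt (\<beta> * pi)) / (1 - cis \<theta>)) *\<^sub>C l)))"

definition D_map ::
    "real \<Rightarrow> real \<Rightarrow> (complex \<Rightarrow> 'v::complex_hilbert_space) \<Rightarrow> complex \<Rightarrow> 'v"
  where "D_map \<alpha> \<beta> f = (THE g. g \<in> H2_disc \<and> D_boundary_relation \<alpha> \<beta> f g)"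

definition isometric_isomorphism ::
    "(complex \<Rightarrow> 'v::complex_hilbert_space) set \<Rightarrow> ((complex \<Rightarrow> 'v) \<Rightarrow> real) \<Rightarrow>
     (complex \<Rightarrow> 'v) set \<Rightarrow> ((complex \<Rightarrow> 'v) \<Rightarrow> real) \<Rightarrow>
     ((complex \<Rightarrow> 'v) \<Rightarrow> (complex \<Rightarrow> 'v)) \<Rightarrow> bool"
  where "isometric_isomorphism X normX Y normY T \<longleftrightarrow>
    (\<forall>f\<in>X. \<forall>g\<in>X. T (\<lambda>s. f s + g s) = (\<lambda>\<omega>. T f \<omega> + T g \<omega>)) \<and>
    (\<forall>c. \<forall>f\<in>X. T (\<lambda>s. c *\<^sub>C f s) = (\<lambda>\<omega>. c *\<^sub>C T f \<omega>)) \<and>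
    bij_betw T X Y \<and>
    (\<forall>f\<in>X. normY (T f) = normX f)"

end

theory Submission
  imports Defs
begin

text \<open>On the boundary the theorem is a change of variables. If \<open>s = M\<^sup>-\<^sup>1(\<omega>)\<close>, then \<open>|ds| = 2 \<beta> |d\<omega>| / |1 - \<omega>|\<^sup>2\<close>,
and the factor \<open>2 sqrt(\<beta> \<pi>) / (1 - \<omega>)\<close> is chosen so that \<open>|f(s)|\<^sup>2 |ds| = |D f(\<omega>)|\<^sup>2 |d\<omega>| / (2 \<pi>)\<close>. The norms,
however, are suprema over lines and over concentric circles inside the domains, and \<open>M\<close> maps the lines
to circles that touch the unit circle at \<open>1\<close>. So each interior mean has to be compared with a
boundary mean.

The comparison rests on the Poisson inequality \<open>|q(z)|\<^sup>2 \<le> mean of P(z, \<cdot>) |q|\<^sup>2\<close> for bounded holomorphic \<open>q\<close>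
that are continuous up to the boundary except at the point \<open>1\<close>. It follows from Cauchy's formula for the scalar
functions \<open>\<langle>q, v\<rangle>\<close>. Integrated over \<open>z\<close>, it makes the means over concentric circles
(\<open>circle_mean_mono\<close>) and over vertical lines (\<open>line_mean_mono\<close>) at most the boundary mean. An arbitrary
element of \<open>H\<^sup>2\<close> is reduced to this case by translating it in the half-plane or dilating it in the disc;
a translate is bounded by \<open>halfplane_energy_bounded\<close>. Fatou's lemma removes the approximation. This gives
the bijection and the isometry for the pointwise formula \<open>disc_transform\<close>.

The boundary values need three more facts. Horizontal limits exist almost everywhere
(\<open>AE_horizontal_limit\<close>): the translates of \<open>f\<close> form a Cauchy net in \<open>L\<^sup>2\<close> of the boundary line, because their
norms increase to a limit and the parallelogram law applies; the weak-type maximal inequality turns this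
into almost everywhere convergence. At a point \<open>\<zeta>\<close> of the circle, the image of the radius and the
horizontal line are tangent, so that the growth bound \<open>|f'(s)| \<le> C (Re s - \<alpha>)\<^sup>-\<^sup>3\<^sup>/\<^sup>2\<close>
forces the radial limit to agree with the horizontal one (\<open>radial_limit_of_horizontal_limit\<close>).
Finally, a function with boundary values zero vanishes (\<open>zero_of_zero_boundary_values\<close>), which makes
the function with the prescribed boundary values unique.\<close>

section \<open>Complex Hilbert spaces and vector-valued holomorphic functions\<close>

lemma scaleC_zero [simp]:
  fixes x :: "'v::complex_hilbert_space"
  shows "0 *\<^sub>C x = 0" "a *\<^sub>C (0::'v) = 0"
proof -
  show "0 *\<^sub>C x = 0" using scaleC_add_left[of 0 0 x] by simp
  show "a *\<^sub>C (0::'v) = 0" using scaleC_add_right[of a 0 "0::'v"] by simp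
qed

lemma cinner_scaleC_right: "cinner x (a *\<^sub>C y) = cnj a * cinner x (y::'v::complex_hilbert_space)"
  by (metis cinner_commute cinner_scaleC_left complex_cnj_mult)

lemma cinner_add_right: "cinner x (y + z) = cinner x y + cinner x (z::'v::complex_hilbert_space)"
  by (metis cinner_add_left cinner_commute complex_cnj_add)

lemma cinner_diff_left: "cinner (x - y) z = cinner x z - cinner y (z::'v::complex_hilbert_space)"
  using cinner_add_left[of "x - y" y z] by simp

lemma cinner_diff_right: "cinner x (y - z) = cinner x y - cinner x (z::'v::complex_hilbert_space)"
  using cinner_add_right[of x "y - z" z] by simp

lemma norm_scaleC: "norm (a *\<^sub>C x) = cmod a * norm (x::'v::complex_hilbert_space)"
proof -
  have "complex_of_real ((norm (a *\<^sub>C x))\<^sup>2) = (a * cnj a) * of_real ((norm x)\<^sup>2)"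
    by (simp only: cinner_self[symmetric] cinner_scaleC_left cinner_scaleC_right mult.assoc mult.left_commute)
  also have "\<dots> = of_real ((cmod a * norm x)\<^sup>2)"
    by (simp add: complex_norm_square[symmetric] power_mult_distrib)
  finally have "(norm (a *\<^sub>C x))\<^sup>2 = (cmod a * norm x)\<^sup>2"
    using of_real_eq_iff by blast
  then show ?thesis by (simp add: power2_eq_iff_nonneg)
qed

lemma bounded_bilinear_scaleC:
  "bounded_bilinear (scaleC :: complex \<Rightarrow> 'v::complex_hilbert_space \<Rightarrow> 'v)"
proof
  fix r :: real and a b :: complex and x y :: 'v
  show "(a + b) *\<^sub>C x = a *\<^sub>C x + b *\<^sub>C x" by (rule scaleC_add_left)
  show "a *\<^sub>C (x + y) = a *\<^sub>C x + a *\<^sub>C y" by (rule scaleC_add_right)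
  show "(r *\<^sub>R a) *\<^sub>C x = r *\<^sub>R (a *\<^sub>C x)"
    by (simp add: scaleR_scaleC[of r "a *\<^sub>C x"] scaleC_scaleC scaleR_conv_of_real)
  show "a *\<^sub>C (r *\<^sub>R x) = r *\<^sub>R (a *\<^sub>C x)"
    by (simp add: scaleR_scaleC[of r x] scaleR_scaleC[of r "a *\<^sub>C x"] scaleC_scaleC mult.commute)
  show "\<exists>K. \<forall>a (x::'v). norm (a *\<^sub>C x) \<le> cmod a * norm x * K"
    by (rule exI[of _ 1]) (simp add: norm_scaleC)
qed

lemmas tendsto_scaleC = bounded_bilinear.tendsto[OF bounded_bilinear_scaleC]
lemmas continuous_on_scaleC = bounded_bilinear.continuous_on[OF bounded_bilinear_scaleC]

lemma cinner_Cauchy_Schwarz: "cmod (cinner x y) \<le> norm x * norm (y::'v::complex_hilbert_space)"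
proof (cases "y = 0")
  case True
  then show ?thesis using cinner_scaleC_right[of x 0 y] by simp
next
  case False
  define c where "c = cinner x y / of_real ((norm y)\<^sup>2)"
  have ny: "(norm y)\<^sup>2 > 0" using False by simp
  have yx: "cinner y x = cnj (cinner x y)" by (rule cinner_commute)
  have "complex_of_real ((norm (x - c *\<^sub>C y))\<^sup>2)
      = of_real ((norm x)\<^sup>2) - cnj c * cinner x y - (c * cinner y x - c * cnj c * of_real ((norm y)\<^sup>2))"
    by (simp only: cinner_self[symmetric] cinner_diff_left cinner_diff_right cinner_scaleC_left
        cinner_scaleC_right) (simp add: algebra_simps)
  also have "\<dots> = of_real ((norm x)\<^sup>2) - cinner x y * cnj (cinner x y) / of_real ((norm y)\<^sup>2)"
    using ny by (simp add: c_def yx field_simps)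
  also have "\<dots> = of_real ((norm x)\<^sup>2 - (cmod (cinner x y))\<^sup>2 / (norm y)\<^sup>2)"
    by (simp add: complex_norm_square[symmetric])
  finally have "(norm (x - c *\<^sub>C y))\<^sup>2 = (norm x)\<^sup>2 - (cmod (cinner x y))\<^sup>2 / (norm y)\<^sup>2"
    using of_real_eq_iff by blast
  then have "(cmod (cinner x y))\<^sup>2 / (norm y)\<^sup>2 \<le> (norm x)\<^sup>2"
    by (metis diff_ge_0_iff_ge zero_le_power2)
  then have "(cmod (cinner x y))\<^sup>2 \<le> (norm x * norm y)\<^sup>2"
    using ny by (simp add: field_simps power_mult_distrib)
  then show ?thesis by (rule power2_le_imp_le) simp
qed

lemma bounded_linear_cinner_left:
  "bounded_linear (\<lambda>x::'v::complex_hilbert_space. cinner x v)"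
proof (rule bounded_linear_intro[where K = "norm v"])
  show "cinner (r *\<^sub>R x) v = r *\<^sub>R cinner x v" for r and x :: 'v
    by (simp add: scaleR_scaleC[of r x] cinner_scaleC_left scaleR_conv_of_real)
qed (simp_all add: cinner_add_left cinner_Cauchy_Schwarz)

lemma parallelogram_law:
  "(norm (x + y))\<^sup>2 + (norm (x - y))\<^sup>2 = 2 * (norm x)\<^sup>2 + 2 * (norm (y::'v::complex_hilbert_space))\<^sup>2"
proof -
  have "complex_of_real ((norm (x + y))\<^sup>2 + (norm (x - y))\<^sup>2) = of_real (2 * (norm x)\<^sup>2 + 2 * (norm y)\<^sup>2)"
    by (simp only: of_real_add of_real_mult cinner_self[symmetric] cinner_diff_left cinner_diff_right
        cinner_add_left cinner_add_right) simp
  then show ?thesis using of_real_eq_iff by blast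
qed

text \<open>A vector inequality follows from its scalar versions \<open>|\<langle>x, v\<rangle>| \<le> c |v|\<close>, and the test vector
\<open>v = x\<close> suffices. In this way the classical one-variable theorems are applied to Hilbert-space-valued functions.\<close>

lemma norm_le_cinnerI:
  fixes x :: "'v::complex_hilbert_space"
  assumes "cmod (cinner x x) \<le> c * norm x" "0 \<le> c"
  shows "norm x \<le> c"
proof (cases "x = 0")
  case False
  have "cmod (cinner x x) = norm x * norm x"
    unfolding cinner_self norm_of_real by (simp add: power2_eq_square)
  then show ?thesis using assms False by simp
qed (use assms in simp)

lemma vholomorphic_on_imp_continuous_on: "vholomorphic_on f S \<Longrightarrow> continuous_on S f"
  unfolding vholomorphic_on_def continuous_on_eq_continuous_within
  using has_derivative_continuous by blast

lemma vholomorphic_on_cong: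
  fixes f g :: "complex \<Rightarrow> 'v::complex_hilbert_space"
  assumes "\<And>s. s \<in> S \<Longrightarrow> f s = g s"
  shows "vholomorphic_on f S \<longleftrightarrow> vholomorphic_on g S"
proof -
  have "vholomorphic_on g S" if f: "vholomorphic_on f S" and fg: "\<And>s. s \<in> S \<Longrightarrow> g s = f s" for f g :: "complex \<Rightarrow> 'v"
    unfolding vholomorphic_on_def
  proof
    fix s assume s: "s \<in> S"
    then obtain d where "(f has_derivative (\<lambda>h. h *\<^sub>C d)) (at s within S)"
      using f unfolding vholomorphic_on_def by blast
    then show "\<exists>d. (g has_derivative (\<lambda>h. h *\<^sub>C d)) (at s within S)"
      using has_derivative_transform[OF s, of g f] fg by blast
  qed
  from this[of f g] this[of g f] assms show ?thesis by auto
qed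

lemma vholomorphic_on_cinner:
  assumes "vholomorphic_on f S"
  shows "(\<lambda>s. cinner (f s) v) holomorphic_on S"
  unfolding holomorphic_on_def
proof
  fix s assume "s \<in> S"
  then obtain d where "(f has_derivative (\<lambda>h. h *\<^sub>C d)) (at s within S)"
    using assms unfolding vholomorphic_on_def by blast
  from bounded_linear.has_derivative[OF bounded_linear_cinner_left this, of v]
  show "(\<lambda>s. cinner (f s) v) field_differentiable at s within S"
    unfolding field_differentiable_def has_field_derivative_def
    by (intro exI[of _ "cinner d v"]) (simp add: cinner_scaleC_left mult.commute[of _ "cinner d v"])
qed

lemma vholomorphic_on_add:
  assumes "vholomorphic_on f S" "vholomorphic_on g S"
  shows "vholomorphic_on (\<lambda>s. f s + g s) S"
  unfolding vholomorphic_on_def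
proof
  fix s assume "s \<in> S"
  then obtain d e where "(f has_derivative (\<lambda>h. h *\<^sub>C d)) (at s within S)"
      "(g has_derivative (\<lambda>h. h *\<^sub>C e)) (at s within S)"
    using assms unfolding vholomorphic_on_def by blast
  then have "((\<lambda>s. f s + g s) has_derivative (\<lambda>h. h *\<^sub>C (d + e))) (at s within S)"
    unfolding scaleC_add_right by (rule has_derivative_add)
  then show "\<exists>d. ((\<lambda>s. f s + g s) has_derivative (\<lambda>h. h *\<^sub>C d)) (at s within S)" ..
qed

lemma vholomorphic_on_scaleC_compose:
  assumes f: "vholomorphic_on f T" and \<phi>: "\<phi> holomorphic_on S" and \<psi>: "\<psi> holomorphic_on S"
    and sub: "\<psi> ` S \<subseteq> T"
  shows "vholomorphic_on (\<lambda>s. \<phi> s *\<^sub>C f (\<psi> s)) S"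
  unfolding vholomorphic_on_def
proof
  fix s assume s: "s \<in> S"
  then obtain p q where p: "(\<phi> has_field_derivative p) (at s within S)"
      and q: "(\<psi> has_field_derivative q) (at s within S)"
    using \<phi> \<psi> unfolding holomorphic_on_def field_differentiable_def by blast
  obtain d where d: "(f has_derivative (\<lambda>h. h *\<^sub>C d)) (at (\<psi> s) within \<psi> ` S)"
    using f sub s has_derivative_subset unfolding vholomorphic_on_def by blast
  have "((\<lambda>s. f (\<psi> s)) has_derivative (\<lambda>h. (q * h) *\<^sub>C d)) (at s within S)"
    using has_derivative_in_compose[OF q[unfolded has_field_derivative_def] d] .
  from bounded_bilinear.FDERIV[OF bounded_bilinear_scaleC p[unfolded has_field_derivative_def] this]
  have "((\<lambda>s. \<phi> s *\<^sub>C f (\<psi> s)) has_derivative (\<lambda>h. h *\<^sub>C (\<phi> s *\<^sub>C q *\<^sub>C d + p *\<^sub>C f (\<psi> s)))) (at s within S)"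
    by (simp add: scaleC_add_right scaleC_scaleC mult_ac)
  then show "\<exists>d. ((\<lambda>s. \<phi> s *\<^sub>C f (\<psi> s)) has_derivative (\<lambda>h. h *\<^sub>C d)) (at s within S)" ..
qed

section \<open>The Poisson inequality in the disc\<close>

text \<open>Energies are nonnegative integrals with values in the extended reals, so that Tonelli's theorem
and Fatou's lemma apply without integrability conditions. The open interval of angles leaves out
the point \<open>1\<close> of the circle, which corresponds to infinity in the half-plane.\<close>

abbreviation energy_on_line :: "(complex \<Rightarrow> 'v::real_normed_vector) \<Rightarrow> real \<Rightarrow> ennreal"
  where "energy_on_line f \<sigma> \<equiv> \<integral>\<^sup>+t. ennreal ((norm (f (Complex \<sigma> t)))\<^sup>2) \<partial>lborel"

abbreviation energy_on_circle :: "(complex \<Rightarrow> 'v::real_normed_vector) \<Rightarrow> real \<Rightarrow> ennreal"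
  where "energy_on_circle g r \<equiv>
    \<integral>\<^sup>+\<theta>\<in>{0<..<2*pi}. ennreal ((norm (g (of_real r * cis \<theta>)))\<^sup>2) \<partial>lborel"

definition poisson_kernel :: "complex \<Rightarrow> complex \<Rightarrow> real"
  where "poisson_kernel z w = (1 - (cmod z)\<^sup>2) / (cmod (w - z))\<^sup>2"

lemma poisson_kernel_nonneg: "cmod z < 1 \<Longrightarrow> 0 \<le> poisson_kernel z w"
  by (simp add: poisson_kernel_def power_le_one)

lemma poisson_kernel_zero: "cmod w = 1 \<Longrightarrow> poisson_kernel 0 w = 1"
  by (simp add: poisson_kernel_def)

lemma continuous_on_poisson_kernel_cis:
  assumes "cmod z < 1"
  shows "continuous_on S (\<lambda>t. poisson_kernel z (cis t))"
proof -
  have "cis t - z \<noteq> 0" for t using assms norm_cis[of t] by auto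
  then show ?thesis unfolding poisson_kernel_def by (intro continuous_intros) auto
qed

text \<open>The distance of \<open>r e\<^sup>i\<^sup>\<theta>\<close> from \<open>e\<^sup>i\<^sup>t\<close> depends only on \<open>|\<theta> - t|\<close>. This symmetry lets the integral over \<open>\<theta>\<close> in
\<open>circle_mean_mono\<close> be evaluated by the total mass of the kernel.\<close>

lemma poisson_kernel_swap:
  "poisson_kernel (of_real r * cis \<theta>) (cis t) = poisson_kernel (of_real r * cis t) (cis \<theta>)"
proof -
  have "cis t * cis \<theta> * cnj (cis \<theta> - of_real r * cis t)
      = cis t * (cis \<theta> * cnj (cis \<theta>)) - of_real r * cis \<theta> * (cis t * cnj (cis t))"
    by (simp add: algebra_simps)
  then have "cis t - of_real r * cis \<theta> = cis t * cis \<theta> * cnj (cis \<theta> - of_real r * cis t)"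
    by (simp flip: complex_norm_square)
  then have "cmod (cis t - of_real r * cis \<theta>) = cmod (cis \<theta> - of_real r * cis t)"
    by (simp only: norm_mult complex_mod_cnj norm_cis)
  then show ?thesis by (simp add: poisson_kernel_def norm_mult)
qed

text \<open>Cauchy's formula is applied to \<open>k(w) = h(w) (1 - |z|\<^sup>2) / (1 - cnj z w)\<close>, which satisfies \<open>k(z) = h(z)\<close>. On the unit circle
\<open>w / ((w - z) (1 - cnj z w)) = 1 / |w - z|\<^sup>2\<close>, so Cauchy's kernel becomes Poisson's.\<close>

lemma poisson_integral_formula:
  fixes h :: "complex \<Rightarrow> complex"
  assumes conth: "continuous_on (cball 0 1) h" and holh: "h holomorphic_on ball 0 1" and z: "cmod z < 1"
  shows "((\<lambda>t. of_real (poisson_kernel z (cis t)) * h (cis t)) has_integral (2 * pi * h z)) {0..2*pi}"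
proof -
  define k where "k w = h w * ((1 - of_real ((cmod z)\<^sup>2)) / (1 - cnj z * w))" for w
  have nz: "1 - cnj z * w \<noteq> 0" if "cmod w \<le> 1" for w
  proof
    assume "1 - cnj z * w = 0"
    then have "cmod (cnj z * w) = 1" by simp
    moreover have "cmod (cnj z * w) \<le> cmod z" using that by (simp add: norm_mult mult_left_le)
    ultimately show False using z by simp
  qed
  have "continuous_on (cball 0 1) k" unfolding k_def
    by (intro continuous_intros conth) (use nz in \<open>auto simp: norm_minus_commute\<close>)
  moreover have "k holomorphic_on ball 0 1" unfolding k_def
    by (intro holomorphic_intros holh) (use nz in \<open>auto\<close>)
  ultimately have "((\<lambda>u. k u / (u - z)) has_contour_integral (2 * of_real pi * \<i> * k z)) (circlepath 0 1)"
    using z by (intro Cauchy_integral_circlepath) auto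
  then have *: "((\<lambda>t. k (cis t) / (cis t - z) * \<i> * cis t) has_integral (2 * of_real pi * \<i> * k z)) {0..2*pi}"
    unfolding circlepath_def by (subst (asm) has_contour_integral_part_circlepath_iff) auto
  have kz: "k z = h z"
    using nz[of z] z by (simp add: k_def complex_norm_square mult.commute del: of_real_power)
  have eq: "(- \<i>) * (k (cis t) / (cis t - z) * \<i> * cis t) = of_real (poisson_kernel z (cis t)) * h (cis t)" for t
  proof -
    have "cis t - z \<noteq> 0" using z norm_cis[of t] by auto
    moreover have "1 - cnj z * cis t \<noteq> 0" using nz[of "cis t"] by simp
    moreover have "(cis t - z) * (1 - cnj z * cis t) = of_real ((cmod (cis t - z))\<^sup>2) * cis t"
    proof -
      have "(cis t - z) * (cis t * cnj (cis t) - cnj z * cis t) = of_real ((cmod (cis t - z))\<^sup>2) * cis t"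
        unfolding complex_norm_square by (simp add: algebra_simps)
      then show ?thesis by (simp flip: complex_norm_square)
    qed
    ultimately have "cis t / ((cis t - z) * (1 - cnj z * cis t)) = 1 / of_real ((cmod (cis t - z))\<^sup>2)"
      by simp
    moreover have "(- \<i>) * (k (cis t) / (cis t - z) * \<i> * cis t)
        = h (cis t) * (1 - of_real ((cmod z)\<^sup>2)) * (cis t / ((cis t - z) * (1 - cnj z * cis t)))"
    proof -
      have "(- \<i>) * (a * (b / c) / d * \<i> * e) = a * b * (e / (d * c))" for a b c d e :: complex
        by (simp add: field_simps)
      then show ?thesis unfolding k_def .
    qed
    ultimately show ?thesis by (simp add: poisson_kernel_def)
  qed
  have "(- \<i>) * (2 * of_real pi * \<i> * k z) = 2 * pi * h z" using kz by simp
  with has_integral_mult_right[OF *, of "- \<i>"] show ?thesis by (simp only: eq)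
qed

lemma poisson_kernel_integral:
  assumes "cmod z < 1"
  shows "((\<lambda>t. poisson_kernel z (cis t)) has_integral 2 * pi) {0..2*pi}"
proof -
  have "((\<lambda>t. of_real (poisson_kernel z (cis t)) * 1) has_integral of_real (2 * pi) * (1::complex)) {0..2*pi}"
    using poisson_integral_formula[of "\<lambda>_. 1" z] assms by simp
  from has_integral_linear[OF this bounded_linear_Re] show ?thesis by (simp add: o_def)
qed

lemma nn_integral_poisson_kernel:
  assumes "cmod z < 1"
  shows "(\<integral>\<^sup>+t\<in>{0<..<2*pi}. ennreal (poisson_kernel z (cis t)) \<partial>lborel) = ennreal (2 * pi)"
  by (rule nn_integral_has_integral_lebesgue')
     (use assms poisson_kernel_integral in \<open>auto simp: poisson_kernel_nonneg has_integral_Icc_iff_Ioo\<close>)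

lemma cis_neq_1: "t \<in> {0<..<2*pi} \<Longrightarrow> cis t \<noteq> 1"
proof
  assume t: "t \<in> {0<..<2*pi}" and "cis t = 1"
  then have "cos t = 1" by (metis cis.sel(1) one_complex.sel(1))
  then obtain n :: int where "t = real_of_int n * 2 * pi" using cos_one_2pi_int[of t] by blast
  then show False using t by (auto simp: zero_less_mult_iff)
qed

text \<open>The exceptional point \<open>1\<close> is allowed because it corresponds to infinity in the half-plane, where
nothing is known about continuity. The formula is applied to the dilates \<open>w \<mapsto> q(\<rho> w)\<close>, which are
continuous on the closed disc, and the boundedness of \<open>q\<close> dominates the passage \<open>\<rho> \<rightarrow> 1\<close>.\<close>

lemma poisson_inequality_L1:
  fixes q :: "complex \<Rightarrow> 'v::complex_hilbert_space"
  assumes cont: "continuous_on (cball 0 1 - {1}) q" and hol: "vholomorphic_on q (ball 0 1)"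
    and B: "\<And>w. w \<in> cball 0 1 - {1} \<Longrightarrow> norm (q w) \<le> B" and z: "cmod z < 1"
  shows "ennreal (2 * pi * norm (q z)) \<le>
    (\<integral>\<^sup>+t\<in>{0<..<2*pi}. ennreal (poisson_kernel z (cis t) * norm (q (cis t))) \<partial>lborel)"
proof -
  define \<rho> where "\<rho> n = 1 - 1 / (real n + 2)" for n
  have \<rho>: "0 < \<rho> n" "\<rho> n < 1" for n by (auto simp: \<rho>_def field_simps)
  have \<rho>lim: "(\<lambda>n. complex_of_real (\<rho> n)) \<longlonglongrightarrow> of_real 1"
    unfolding \<rho>_def by (intro tendsto_of_real) real_asymp
  define P where "P t = poisson_kernel z (cis t)" for t
  have P: "continuous_on S P" "0 \<le> P t" for S t
    unfolding P_def using continuous_on_poisson_kernel_cis poisson_kernel_nonneg z by auto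
  have inb: "of_real (\<rho> n) * w \<in> ball 0 1" if "cmod w \<le> 1" for n w
  proof -
    have "cmod (of_real (\<rho> n) * w) \<le> \<rho> n" using \<rho>[of n] that by (simp add: norm_mult mult_left_le)
    then show ?thesis using \<rho>[of n] by simp
  qed
  have contb: "continuous_on (ball 0 1) q" using hol by (rule vholomorphic_on_imp_continuous_on)
  have contn: "continuous_on (cball 0 1) (\<lambda>w. q (of_real (\<rho> n) * w))" for n
    by (rule continuous_on_compose2[OF contb]) (use inb in \<open>auto intro!: continuous_intros\<close>)
  have cc: "continuous_on S (\<lambda>t. q (of_real (\<rho> n) * cis t))" for n S
    by (rule continuous_on_compose2[OF contn]) (auto intro!: continuous_intros)
  have step: "2 * pi * norm (q (of_real (\<rho> n) * z)) \<le> integral {0..2*pi} (\<lambda>t. P t * norm (q (of_real (\<rho> n) * cis t)))"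
    (is "_ \<le> ?I") for n
  proof -
    \<comment> \<open>the test vector that makes the scalar inequality recover the norm at \<open>\<rho> n z\<close>\<close>
    define v where "v = q (of_real (\<rho> n) * z)"
    define h where "h w = cinner (q (of_real (\<rho> n) * w)) v" for w
    have "vholomorphic_on (\<lambda>w. 1 *\<^sub>C q (of_real (\<rho> n) * w)) (ball 0 1)"
      by (rule vholomorphic_on_scaleC_compose[OF hol]) (use inb in \<open>auto intro!: holomorphic_intros\<close>)
    then have "h holomorphic_on ball 0 1"
      unfolding h_def scaleC_one by (rule vholomorphic_on_cinner)
    moreover have "continuous_on (cball 0 1) h" unfolding h_def
      by (rule bounded_linear.continuous_on[OF bounded_linear_cinner_left contn])
    ultimately have hi: "((\<lambda>t. of_real (P t) * h (cis t)) has_integral (2 * pi * h z)) {0..2*pi}"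
      unfolding P_def using poisson_integral_formula z by blast
    have "cmod (2 * pi * h z) \<le> integral {0..2*pi} (\<lambda>t. P t * norm (q (of_real (\<rho> n) * cis t)) * norm v)"
      unfolding integral_unique[OF hi, symmetric]
    proof (rule integral_norm_bound_integral)
      show "(\<lambda>t. P t * norm (q (of_real (\<rho> n) * cis t)) * norm v) integrable_on {0..2*pi}"
        by (intro integrable_continuous_interval continuous_intros P cc)
      show "cmod (of_real (P t) * h (cis t)) \<le> P t * norm (q (of_real (\<rho> n) * cis t)) * norm v" for t
        using P(2)[of t] cinner_Cauchy_Schwarz[of "q (of_real (\<rho> n) * cis t)" v]
        by (simp add: norm_mult h_def mult_left_mono mult.assoc)
    qed (use hi in blast)
    also have "\<dots> = ?I * norm v" by (rule integral_mult_left)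
    finally have "cmod (cinner v v) \<le> (?I / (2 * pi)) * norm v"
      by (simp add: norm_mult h_def v_def field_simps)
    then have "norm v \<le> ?I / (2 * pi)"
      by (rule norm_le_cinnerI) (auto intro!: divide_nonneg_pos integral_nonneg integrable_continuous_interval
        continuous_intros P cc mult_nonneg_nonneg)
    then show ?thesis by (simp add: v_def field_simps)
  qed
  let ?S = "{0<..<2*pi}"
  have d1: "(\<lambda>t. P t * norm (q (of_real (\<rho> n) * cis t))) integrable_on ?S" for n
    by (simp add: integrable_on_Icc_iff_Ioo[symmetric])
       (intro integrable_continuous_interval continuous_intros P cc)
  have d2: "(\<lambda>t. P t * B) integrable_on ?S"
    by (simp add: integrable_on_Icc_iff_Ioo[symmetric])
       (intro integrable_continuous_interval continuous_intros P)
  have circ: "of_real (\<rho> n) * cis t \<in> cball 0 1 - {1}" for n t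
    using inb[of "cis t" n] by auto
  have d3: "norm (P t * norm (q (of_real (\<rho> n) * cis t))) \<le> P t * B" if "t \<in> ?S" for n t
    using B[OF circ, of n t] P(2)[of t] by (simp add: mult_left_mono)
  have d4: "(\<lambda>n. P t * norm (q (of_real (\<rho> n) * cis t))) \<longlonglongrightarrow> P t * norm (q (cis t))" if t: "t \<in> ?S" for t
  proof (intro tendsto_intros continuous_on_tendsto_compose[OF cont])
    show "(\<lambda>n. of_real (\<rho> n) * cis t) \<longlonglongrightarrow> cis t"
      using tendsto_mult[OF \<rho>lim tendsto_const[of "cis t"]] by simp
    show "cis t \<in> cball 0 1 - {1}" using cis_neq_1[OF t] by simp
    show "\<forall>\<^sub>F n in sequentially. of_real (\<rho> n) * cis t \<in> cball 0 1 - {1}"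
      using circ by (rule always_eventually[OF allI])
  qed
  note dom = dominated_convergence[OF d1 d2 d3 d4]
  have "2 * pi * norm (q z) \<le> integral ?S (\<lambda>t. P t * norm (q (cis t)))"
  proof (rule LIMSEQ_le)
    show "(\<lambda>n. 2 * pi * norm (q (of_real (\<rho> n) * z))) \<longlonglongrightarrow> 2 * pi * norm (q z)"
    proof (intro tendsto_intros continuous_on_tendsto_compose[OF contb])
      show "(\<lambda>n. of_real (\<rho> n) * z) \<longlonglongrightarrow> z"
        using tendsto_mult[OF \<rho>lim tendsto_const[of z]] by simp
    qed (use z inb[of z] in auto)
    show "\<exists>N. \<forall>n\<ge>N. 2 * pi * norm (q (of_real (\<rho> n) * z)) \<le> integral ?S (\<lambda>t. P t * norm (q (of_real (\<rho> n) * cis t)))"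
      using step by (simp add: integral_open_interval_real)
  qed (rule dom(2))
  also have "ennreal \<dots> = (\<integral>\<^sup>+t\<in>?S. ennreal (P t * norm (q (cis t))) \<partial>lborel)"
    by (rule nn_integral_has_integral_lebesgue'[symmetric])
       (use dom(1) P in \<open>auto simp: has_integral_integral[symmetric]\<close>)
  finally show ?thesis by (simp add: P_def ennreal_leI)
qed

lemma borel_measurable_ennreal_continuous_on:
  assumes "continuous_on S f" "S \<in> sets borel"
  shows "(\<lambda>t. ennreal (f t) * indicator S t) \<in> borel_measurable borel"
proof -
  have "(\<lambda>t. indicator S t *\<^sub>R f t) \<in> borel_measurable borel"
    using assms by (rule borel_measurable_continuous_on_indicator[rotated])
  then have "(\<lambda>t. ennreal (indicator S t *\<^sub>R f t)) \<in> borel_measurable borel"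
    by measurable
  moreover have "(\<lambda>t. ennreal (indicator S t *\<^sub>R f t)) = (\<lambda>t. ennreal (f t) * indicator S t)"
    by (auto split: split_indicator)
  ultimately show ?thesis by simp
qed

text \<open>Jensen's inequality for the Poisson measure of mass \<open>2 \<pi>\<close>. With \<open>c = |q(z)|\<close>, the tangent \<open>2 c a \<le> a\<^sup>2 + c\<^sup>2\<close> of the
square is inserted into the \<open>L\<^sup>1\<close> inequality, and the term with \<open>c\<^sup>2\<close> is absorbed on the left.\<close>

lemma poisson_inequality_L2:
  fixes q :: "complex \<Rightarrow> 'v::complex_hilbert_space"
  assumes cont: "continuous_on (cball 0 1 - {1}) q" and hol: "vholomorphic_on q (ball 0 1)"
    and B: "\<And>w. w \<in> cball 0 1 - {1} \<Longrightarrow> norm (q w) \<le> B" and z: "cmod z < 1"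
  shows "ennreal (2 * pi * (norm (q z))\<^sup>2) \<le>
    (\<integral>\<^sup>+t\<in>{0<..<2*pi}. ennreal (poisson_kernel z (cis t) * (norm (q (cis t)))\<^sup>2) \<partial>lborel)"
    (is "_ \<le> ?R")
proof (cases "q z = 0 \<or> ?R = \<infinity>")
  case True
  then show ?thesis by auto
next
  case False
  define c where "c = norm (q z)"
  define P where "P t = poisson_kernel z (cis t)" for t
  have P0: "0 \<le> P t" for t using poisson_kernel_nonneg z by (simp add: P_def)
  have c: "c > 0" using False by (simp add: c_def)
  obtain R where R: "?R = ennreal R" "0 \<le> R" using False by (cases ?R) auto
  have PC: "continuous_on S P" for S
    unfolding P_def by (rule continuous_on_poisson_kernel_cis[OF z])
  have qC: "continuous_on {0<..<2*pi} (\<lambda>t. q (cis t))"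
    by (rule continuous_on_compose2[OF cont]) (auto intro!: continuous_intros simp: cis_neq_1)
  have m1: "(\<lambda>t. ennreal (P t) * indicator {0<..<2*pi} t) \<in> borel_measurable lborel"
    using borel_measurable_ennreal_continuous_on[OF PC, of "{0<..<2*pi}"] by simp
  have m2: "(\<lambda>t. ennreal (P t * (norm (q (cis t)))\<^sup>2) * indicator {0<..<2*pi} t) \<in> borel_measurable lborel"
  proof -
    have "continuous_on {0<..<2*pi} (\<lambda>t. P t * (norm (q (cis t)))\<^sup>2)"
      by (intro continuous_intros PC qC)
    from borel_measurable_ennreal_continuous_on[OF this] show ?thesis by simp
  qed
  have "ennreal (2 * pi * c) \<le> (\<integral>\<^sup>+t\<in>{0<..<2*pi}. ennreal (P t * norm (q (cis t))) \<partial>lborel)"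
    unfolding c_def P_def using poisson_inequality_L1[OF cont hol B z] by simp
  also have "\<dots> \<le> (\<integral>\<^sup>+t. ennreal (1 / (2 * c)) * (ennreal (P t * (norm (q (cis t)))\<^sup>2) * indicator {0<..<2*pi} t)
       + ennreal (c / 2) * (ennreal (P t) * indicator {0<..<2*pi} t) \<partial>lborel)"
  proof (rule nn_integral_mono)
    fix t
    have "2 * c * norm (q (cis t)) \<le> (norm (q (cis t)))\<^sup>2 + c\<^sup>2"
      using sum_squares_bound[of c "norm (q (cis t))"] by (simp add: power2_eq_square)
    then have "norm (q (cis t)) \<le> 1 / (2 * c) * (norm (q (cis t)))\<^sup>2 + c / 2"
      using c by (simp add: field_simps power2_eq_square)
    then have "P t * norm (q (cis t)) \<le> P t * (1 / (2 * c) * (norm (q (cis t)))\<^sup>2 + c / 2)"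
      by (intro mult_left_mono P0)
    then have "P t * norm (q (cis t)) \<le> 1 / (2 * c) * (P t * (norm (q (cis t)))\<^sup>2) + c / 2 * P t"
      by (simp add: algebra_simps)
    then have "ennreal (P t * norm (q (cis t))) \<le>
        ennreal (1 / (2 * c)) * ennreal (P t * (norm (q (cis t)))\<^sup>2) + ennreal (c / 2) * ennreal (P t)"
      using c P0[of t] by (subst (1 2) ennreal_mult[symmetric]) (auto simp flip: ennreal_plus intro!: ennreal_leI)
    then show "ennreal (P t * norm (q (cis t))) * indicator {0<..<2*pi} t \<le>
        ennreal (1 / (2 * c)) * (ennreal (P t * (norm (q (cis t)))\<^sup>2) * indicator {0<..<2*pi} t)
         + ennreal (c / 2) * (ennreal (P t) * indicator {0<..<2*pi} t)"
      by (auto split: split_indicator)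
  qed
  also have "\<dots> = ennreal (1 / (2 * c)) * ?R + ennreal (c / 2) * ennreal (2 * pi)"
    using m1 m2 nn_integral_poisson_kernel[OF z] by (subst nn_integral_add) (auto simp: nn_integral_cmult P_def)
  also have "\<dots> = ennreal (R / (2 * c) + c * pi)"
    unfolding R(1) using R(2) c by (simp flip: ennreal_mult ennreal_plus)
  finally have "2 * pi * c \<le> R / (2 * c) + c * pi"
    using R(2) c by (subst (asm) ennreal_le_iff) auto
  then have "2 * pi * c\<^sup>2 \<le> R" using c by (simp add: field_simps power2_eq_square)
  then show ?thesis unfolding R(1) c_def by (rule ennreal_leI)
qed

lemma borel_measurable_cis [measurable]: "cis \<in> borel_measurable borel"
  by (intro borel_measurable_continuous_onI continuous_intros)

text \<open>Integrate the Poisson inequality over the circle of radius \<open>r\<close> and exchange the integrals. By the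
symmetry of the kernel every boundary point receives the weight \<open>2 \<pi>\<close>.\<close>

lemma circle_mean_mono:
  fixes q :: "complex \<Rightarrow> 'v::complex_hilbert_space"
  assumes cont: "continuous_on (cball 0 1 - {1}) q" and hol: "vholomorphic_on q (ball 0 1)"
    and B: "\<And>w. w \<in> cball 0 1 - {1} \<Longrightarrow> norm (q w) \<le> B" and r: "0 \<le> r" "r < 1"
  shows "energy_on_circle q r
    \<le> (\<integral>\<^sup>+t\<in>{0<..<2*pi}. ennreal ((norm (q (cis t)))\<^sup>2) \<partial>lborel)"
proof -
  let ?S = "{0<..<2*pi}"
  define P where "P \<theta> t = poisson_kernel (of_real r * cis \<theta>) (cis t)" for \<theta> t
  have z: "cmod (of_real r * cis \<theta>) < 1" for \<theta> using r by (simp add: norm_mult)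
  have P0: "0 \<le> P \<theta> t" for \<theta> t unfolding P_def using z by (rule poisson_kernel_nonneg)
  have Psym: "P \<theta> t = P t \<theta>" for \<theta> t unfolding P_def by (rule poisson_kernel_swap)
  define u where "u t = ennreal ((norm (q (cis t)))\<^sup>2) * indicator ?S t" for t
  have qC: "continuous_on ?S (\<lambda>t. q (cis t))"
    by (rule continuous_on_compose2[OF cont]) (auto intro!: continuous_intros simp: cis_neq_1)
  have [measurable]: "u \<in> borel_measurable borel"
    unfolding u_def by (intro borel_measurable_ennreal_continuous_on continuous_intros qC) simp
  have [measurable]: "(\<lambda>x. P (fst x) (snd x)) \<in> borel_measurable (borel \<Otimes>\<^sub>M borel)"
    unfolding P_def poisson_kernel_def by measurable
  have qr: "continuous_on UNIV (\<lambda>\<theta>. q (of_real r * cis \<theta>))"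
    by (rule continuous_on_compose2[OF vholomorphic_on_imp_continuous_on[OF hol]])
       (use z in \<open>auto intro!: continuous_intros\<close>)
  have [measurable]: "(\<lambda>\<theta>. (norm (q (of_real r * cis \<theta>)))\<^sup>2) \<in> borel_measurable borel"
    by (intro borel_measurable_continuous_onI continuous_intros qr)
  have "ennreal (2 * pi) * (\<integral>\<^sup>+\<theta>\<in>?S. ennreal ((norm (q (of_real r * cis \<theta>)))\<^sup>2) \<partial>lborel)
      = (\<integral>\<^sup>+\<theta>\<in>?S. ennreal (2 * pi * (norm (q (of_real r * cis \<theta>)))\<^sup>2) \<partial>lborel)"
    by (subst nn_integral_cmult[symmetric]) (auto simp: ennreal_mult mult.assoc)
  also have "\<dots> \<le> (\<integral>\<^sup>+\<theta>\<in>?S. (\<integral>\<^sup>+t. ennreal (P \<theta> t) * u t \<partial>lborel) \<partial>lborel)"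
  proof (intro nn_integral_mono mult_right_mono)
    fix \<theta>
    have "ennreal (2 * pi * (norm (q (of_real r * cis \<theta>)))\<^sup>2) \<le>
        (\<integral>\<^sup>+t\<in>?S. ennreal (P \<theta> t * (norm (q (cis t)))\<^sup>2) \<partial>lborel)"
      unfolding P_def by (rule poisson_inequality_L2[OF cont hol B z])
    then show "ennreal (2 * pi * (norm (q (of_real r * cis \<theta>)))\<^sup>2) \<le> (\<integral>\<^sup>+t. ennreal (P \<theta> t) * u t \<partial>lborel)"
      using P0 by (simp add: u_def ennreal_mult mult.assoc)
  qed auto
  also have "\<dots> = (\<integral>\<^sup>+\<theta>. (\<integral>\<^sup>+t. ennreal (P \<theta> t) * u t * indicator ?S \<theta> \<partial>lborel) \<partial>lborel)"
    by (intro nn_integral_cong nn_integral_multc[symmetric]) (unfold P_def poisson_kernel_def, measurable)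
  also have "\<dots> = (\<integral>\<^sup>+t. (\<integral>\<^sup>+\<theta>. ennreal (P \<theta> t) * u t * indicator ?S \<theta> \<partial>lborel) \<partial>lborel)"
    by (rule lborel_pair.Fubini') (unfold P_def poisson_kernel_def, measurable)
  also have "\<dots> = (\<integral>\<^sup>+t. ennreal (2 * pi) * u t \<partial>lborel)"
  proof (rule nn_integral_cong)
    fix t
    have "(\<integral>\<^sup>+\<theta>. ennreal (P \<theta> t) * u t * indicator ?S \<theta> \<partial>lborel)
        = (\<integral>\<^sup>+\<theta>. u t * (ennreal (P t \<theta>) * indicator ?S \<theta>) \<partial>lborel)"
      by (simp add: Psym[of _ t] mult_ac)
    also have "\<dots> = u t * (\<integral>\<^sup>+\<theta>. (ennreal (P t \<theta>) * indicator ?S \<theta>) \<partial>lborel)"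
      by (rule nn_integral_cmult) (unfold P_def poisson_kernel_def, measurable)
    also have "\<dots> = ennreal (2 * pi) * u t"
      unfolding P_def by (subst nn_integral_poisson_kernel[OF z]) (simp add: mult.commute)
    finally show "(\<integral>\<^sup>+\<theta>. ennreal (P \<theta> t) * u t * indicator ?S \<theta> \<partial>lborel) = ennreal (2 * pi) * u t" .
  qed
  also have "\<dots> = ennreal (2 * pi) * (\<integral>\<^sup>+t. u t \<partial>lborel)"
    by (rule nn_integral_cmult) measurable
  finally show ?thesis
    by (subst (asm) ennreal_mult_le_mult_iff) (auto simp: u_def[abs_def])
qed

section \<open>The circle parametrized by the line\<close>

text \<open>The point \<open>e\<^sup>i\<^sup>\<theta>\<close> with \<open>\<theta> = \<pi> - 2 arctan (t / b)\<close> is the image of \<open>\<alpha> + i t\<close> under the Moebius transformation with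
parameter \<open>b\<close> (see \<open>cis_eq_mobius\<close>), and \<open>2 b / (b\<^sup>2 + t\<^sup>2)\<close> is the Jacobian. The substitution rule
on compact intervals requires an increasing map, so it is carried out for \<open>\<pi> + 2 arctan (t / b)\<close> and
followed by the reflection \<open>t \<mapsto> -t\<close>.\<close>

lemma nn_integral_circle_eq_line:
  fixes f :: "real \<Rightarrow> ennreal"
  assumes [measurable]: "f \<in> borel_measurable borel" and b: "b > 0"
  shows "(\<integral>\<^sup>+\<theta>\<in>{0<..<2*pi}. f \<theta> \<partial>lborel)
    = (\<integral>\<^sup>+t. f (pi - 2 * arctan (t / b)) * ennreal (2 * b / (b\<^sup>2 + t\<^sup>2)) \<partial>lborel)"
proof -
  define g where "g t = pi + 2 * arctan (t / b)" for t
  define g' where "g' t = 2 * b / (b\<^sup>2 + t\<^sup>2)" for t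
  define a where "a n = real n + 1" for n
  have pos: "b\<^sup>2 + t\<^sup>2 > 0" for t using b by (simp add: add_pos_nonneg)
  have [measurable]: "g \<in> borel_measurable borel" "g' \<in> borel_measurable borel"
    unfolding g_def g'_def using pos
    by (intro borel_measurable_continuous_onI continuous_intros; use b in \<open>auto simp: add_pos_nonneg less_imp_neq[symmetric]\<close>)+
  have der: "(g has_real_derivative g' t) (at t)" for t
  proof -
    have "2 * (inverse (1 + (t / b)\<^sup>2) * (1 / b)) = g' t"
      using b pos[of t] by (simp add: g'_def divide_simps power2_eq_square)
    moreover have "(g has_real_derivative 2 * (inverse (1 + (t / b)\<^sup>2) * (1 / b))) (at t)"
      unfolding g_def using b by (auto intro!: derivative_eq_intros)
    ultimately show ?thesis by simp
  qed
  have contg': "continuous_on S g'" for S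
    unfolding g'_def by (intro continuous_intros) (metis pos less_irrefl)
  have g0: "0 \<le> g' t" for t unfolding g'_def using b pos[of t] by simp
  have a: "- a n < a n" for n by (simp add: a_def)
  have mono: "g s \<le> g t \<longleftrightarrow> s \<le> t" for s t
    using b by (simp add: g_def divide_le_cancel arctan_le_iff)
  have rng: "0 < g t \<and> g t < 2 * pi" for t
    unfolding g_def using arctan_bounded[of "t / b"] by (auto simp: field_simps)
  have step: "(\<integral>\<^sup>+x. f x * indicator {g (- a n)..g (a n)} x \<partial>lborel)
      = (\<integral>\<^sup>+x. f (g x) * ennreal (g' x) * indicator {- a n..a n} x \<partial>lborel)" for n
    by (rule nn_integral_substitution_aux[OF _ _ der contg' g0 a]) auto
  have "(\<lambda>n. \<integral>\<^sup>+x. f x * indicator {g (- a n)..g (a n)} x \<partial>lborel) \<longlonglongrightarrow> (\<integral>\<^sup>+\<theta>\<in>{0<..<2*pi}. f \<theta> \<partial>lborel)"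
  proof (rule nn_integral_LIMSEQ)
    show "incseq (\<lambda>n x. f x * indicator {g (- a n)..g (a n)} x)"
    proof (intro incseq_SucI le_funI mult_left_mono)
      fix n x
      have "g (- a (Suc n)) \<le> g (- a n)" "g (a n) \<le> g (a (Suc n))"
        unfolding mono by (simp_all add: a_def)
      then show "indicator {g (- a n)..g (a n)} x \<le> (indicator {g (- a (Suc n))..g (a (Suc n))} x :: ennreal)"
        by (intro indicator_leI) auto
    qed simp
    fix x
    show "(\<lambda>n. f x * indicator {g (- a n)..g (a n)} x) \<longlonglongrightarrow> f x * indicator {0<..<2*pi} x"
    proof (rule tendsto_eventually, cases "x \<in> {0<..<2*pi}")
      case True
      define y where "y = b * tan ((x - pi) / 2)"
      have "arctan (y / b) = (x - pi) / 2" using b True by (simp add: y_def arctan_tan)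
      then have gy: "g y = x" by (simp add: g_def)
      have "\<forall>\<^sub>F n in sequentially. \<bar>y\<bar> \<le> a n"
        unfolding a_def by real_asymp
      then show "\<forall>\<^sub>F n in sequentially. f x * indicator {g (- a n)..g (a n)} x = f x * indicator {0<..<2*pi} x"
      proof eventually_elim
        case (elim n)
        then have "x \<in> {g (- a n)..g (a n)}" unfolding gy[symmetric] by (auto simp: mono)
        then show ?case using True by simp
      qed
    next
      case False
      then have "x \<notin> {g (- a n)..g (a n)}" for n using rng[of "- a n"] rng[of "a n"] by auto
      then show "\<forall>\<^sub>F n in sequentially. f x * indicator {g (- a n)..g (a n)} x = f x * indicator {0<..<2*pi} x"
        using False by simp
    qed
  qed measurable
  moreover have "(\<lambda>n. \<integral>\<^sup>+x. f (g x) * ennreal (g' x) * indicator {- a n..a n} x \<partial>lborel)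
      \<longlonglongrightarrow> (\<integral>\<^sup>+x. f (g x) * ennreal (g' x) \<partial>lborel)"
  proof (rule nn_integral_LIMSEQ)
    show "incseq (\<lambda>n x. f (g x) * ennreal (g' x) * indicator {- a n..a n} x)"
      by (intro incseq_SucI le_funI mult_left_mono indicator_leI) (auto simp: a_def)
    fix x
    have "\<forall>\<^sub>F n in sequentially. \<bar>x\<bar> \<le> a n"
      unfolding a_def by real_asymp
    then have "\<forall>\<^sub>F n in sequentially. f (g x) * ennreal (g' x) * indicator {- a n..a n} x = f (g x) * ennreal (g' x)"
    proof eventually_elim
      case (elim n)
      then have "x \<in> {- a n..a n}" by auto
      then show ?case by simp
    qed
    then show "(\<lambda>n. f (g x) * ennreal (g' x) * indicator {- a n..a n} x) \<longlonglongrightarrow> f (g x) * ennreal (g' x)"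
      by (rule tendsto_eventually)
  qed measurable
  ultimately have "(\<integral>\<^sup>+\<theta>\<in>{0<..<2*pi}. f \<theta> \<partial>lborel) = (\<integral>\<^sup>+x. f (g x) * ennreal (g' x) \<partial>lborel)"
    unfolding step by (rule LIMSEQ_unique)
  also have "\<dots> = (\<integral>\<^sup>+x. f (g (- x)) * ennreal (g' (- x)) \<partial>lborel)"
    by (subst nn_integral_real_affine[where c = "-1" and t = 0]) auto
  finally show ?thesis by (simp add: g_def g'_def arctan_minus)
qed

lemma cis_eq_mobius:
  assumes b: "b > 0"
  shows "cis (pi - 2 * arctan (t / b)) = mobius \<alpha> b (Complex \<alpha> t)"
proof -
  have pos: "b\<^sup>2 + t\<^sup>2 > 0" using b by (simp add: add_pos_nonneg)
  have nz: "Complex b t \<noteq> 0" using b by (auto simp: complex_eq_iff)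
  have c: "(cos (arctan (t / b)))\<^sup>2 = b\<^sup>2 / (b\<^sup>2 + t\<^sup>2)"
    using b pos by (simp add: cos_arctan power_divide) (simp add: field_simps)
  have s: "(sin (arctan (t / b)))\<^sup>2 = t\<^sup>2 / (b\<^sup>2 + t\<^sup>2)"
    using b pos by (simp add: sin_arctan power_divide) (simp add: field_simps)
  have sc: "sin (arctan (t / b)) * cos (arctan (t / b)) = b * t / (b\<^sup>2 + t\<^sup>2)"
  proof -
    have "1 + (t / b)\<^sup>2 = (b\<^sup>2 + t\<^sup>2) / b\<^sup>2" using b by (simp add: field_simps)
    then have "(t / b) / (1 + (t / b)\<^sup>2) = b * t / (b\<^sup>2 + t\<^sup>2)"
      using b by (simp add: power2_eq_square)
    then show ?thesis
      by (simp add: sin_arctan cos_arctan mult.assoc)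
  qed
  have 1: "cis (pi - 2 * arctan (t / b)) = Complex ((t\<^sup>2 - b\<^sup>2) / (b\<^sup>2 + t\<^sup>2)) (2 * (b * t / (b\<^sup>2 + t\<^sup>2)))"
    using c s sc by (simp add: complex_eq_iff cos_diff sin_diff cos_double sin_double diff_divide_distrib)
  have "\<dots> * Complex b t = Complex (- b) t"
  proof -
    define D where "D = b\<^sup>2 + t\<^sup>2"
    have D: "D \<noteq> 0" using pos by (metis D_def less_irrefl)
    have "(t\<^sup>2 - b\<^sup>2) * b - 2 * (b * t) * t = - b * D" "(t\<^sup>2 - b\<^sup>2) * t + 2 * (b * t) * b = t * D"
      by (simp_all add: D_def algebra_simps power2_eq_square)
    then show ?thesis
      using D unfolding D_def[symmetric] by (simp add: complex_eq_iff divide_simps mult_ac)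
  qed
  then have "Complex ((t\<^sup>2 - b\<^sup>2) / (b\<^sup>2 + t\<^sup>2)) (2 * (b * t / (b\<^sup>2 + t\<^sup>2))) = Complex (- b) t / Complex b t"
    using nz by (simp add: field_simps)
  moreover have "Complex \<alpha> t - of_real \<alpha> - of_real b = Complex (- b) t"
    "Complex \<alpha> t - of_real \<alpha> + of_real b = Complex b t" by (simp_all add: complex_eq_iff)
  ultimately show ?thesis using 1 by (simp add: mobius_def)
qed

lemma mobius_inv_cis:
  assumes b: "b > 0"
  shows "mobius_inv \<alpha> b (cis (pi - 2 * arctan (t / b))) = Complex \<alpha> t"
  unfolding cis_eq_mobius[OF b, of t \<alpha>]
  by (subst mobius_inv_mobius) (use b in \<open>auto simp: complex_eq_iff\<close>)

text \<open>A null set of the line has measure zero for the density \<open>2 b / (b\<^sup>2 + t\<^sup>2)\<close>, which is the image of the arc length.\<close>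

lemma AE_circle_of_AE_line:
  assumes b: "b > 0" and Q: "AE t in lborel. Q t"
  shows "AE \<theta> in lborel. \<theta> \<in> {0<..<2*pi} \<longrightarrow> Q (Im (mobius_inv \<alpha> b (cis \<theta>)))"
proof -
  obtain N where N: "{t. \<not> Q t} \<subseteq> N" "N \<in> null_sets lborel"
    using Q unfolding eventually_ae_filter by auto
  then have [measurable]: "N \<in> sets borel" by auto
  define f where "f \<theta> = (indicator N (Im (mobius_inv \<alpha> b (cis \<theta>))) :: ennreal)" for \<theta>
  have [measurable]: "(\<lambda>\<theta>. Im (mobius_inv \<alpha> b (cis \<theta>))) \<in> borel_measurable borel"
    unfolding mobius_inv_def by measurable
  have [measurable]: "f \<in> borel_measurable borel" unfolding f_def by measurable
  have "(\<integral>\<^sup>+\<theta>\<in>{0<..<2*pi}. f \<theta> \<partial>lborel)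
      = (\<integral>\<^sup>+t. indicator N t * ennreal (2 * b / (b\<^sup>2 + t\<^sup>2)) \<partial>lborel)"
    by (subst nn_integral_circle_eq_line[OF _ b]) (auto simp: f_def mobius_inv_cis[OF b])
  also have "\<dots> = (\<integral>\<^sup>+t. 0 \<partial>(lborel :: real measure))"
  proof (rule nn_integral_cong_AE)
    show "AE t in lborel. indicator N t * ennreal (2 * b / (b\<^sup>2 + t\<^sup>2)) = 0"
      using AE_not_in[OF N(2)] by eventually_elim simp
  qed
  also have "\<dots> = 0" by simp
  finally have "AE \<theta> in lborel. f \<theta> * indicator {0<..<2*pi} \<theta> = 0"
    by (subst (asm) nn_integral_0_iff_AE) auto
  then show ?thesis
    using N(1) by (auto simp: f_def indicator_def elim!: eventually_mono split: if_splits)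
qed

section \<open>The Poisson inequality in the half-plane\<close>

lemma Re_mobius_inv:
  assumes "\<omega> \<noteq> 1"
  shows "Re (mobius_inv \<alpha> b \<omega>) = \<alpha> + b * (1 - (cmod \<omega>)\<^sup>2) / (cmod (1 - \<omega>))\<^sup>2"
proof -
  have nz: "(cmod (1 - \<omega>))\<^sup>2 \<noteq> 0" using assms by simp
  have "Re (2 * of_real b / (1 - \<omega>)) = 2 * b * (1 - Re \<omega>) / (cmod (1 - \<omega>))\<^sup>2"
    by (simp add: Re_divide cmod_power2)
  moreover have "(cmod (1 - \<omega>))\<^sup>2 = 1 - 2 * Re \<omega> + (cmod \<omega>)\<^sup>2"
    unfolding cmod_power2 by (simp add: power2_eq_square algebra_simps)
  ultimately have "Re (mobius_inv \<alpha> b \<omega>) - \<alpha> = (2 * b * (1 - Re \<omega>) - b * (1 - 2 * Re \<omega> + (cmod \<omega>)\<^sup>2)) / (cmod (1 - \<omega>))\<^sup>2"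
    using nz by (simp add: mobius_inv_def diff_divide_distrib)
  also have "\<dots> = b * (1 - (cmod \<omega>)\<^sup>2) / (cmod (1 - \<omega>))\<^sup>2"
    by (simp add: algebra_simps)
  finally show ?thesis by simp
qed

lemma Re_mobius_inv_gt:
  assumes "cmod \<omega> < 1" "b > 0"
  shows "Re (mobius_inv \<alpha> b \<omega>) > \<alpha>"
proof -
  have "\<omega> \<noteq> 1" using assms by auto
  moreover have "(cmod \<omega>)\<^sup>2 < 1" using assms by (simp add: abs_square_less_1)
  ultimately show ?thesis using assms by (simp add: Re_mobius_inv)
qed

lemma Re_mobius_inv_ge:
  assumes "cmod \<omega> \<le> 1" "\<omega> \<noteq> 1" "b > 0"
  shows "Re (mobius_inv \<alpha> b \<omega>) \<ge> \<alpha>"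
  using assms by (simp add: Re_mobius_inv power_le_one)

lemma mobius_inv_holomorphic: "mobius_inv \<alpha> b holomorphic_on - {1}"
  unfolding mobius_inv_def by (intro holomorphic_intros) auto

lemma circle_angle_range: "pi - 2 * arctan (t / b) \<in> {0<..<2*pi}"
  using arctan_bounded[of "t / b"] by (auto simp: field_simps)

text \<open>Up to the factor \<open>2 \<pi>\<close>, this is the Poisson kernel of a half-plane for a point at distance \<open>x\<close> from the boundary.
It is also the Jacobian of the parametrization of the circle with parameter \<open>x\<close>.\<close>

definition line_kernel :: "real \<Rightarrow> real \<Rightarrow> real"
  where "line_kernel x t = 2 * x / (x\<^sup>2 + t\<^sup>2)"

lemma line_kernel_nonneg: "x > 0 \<Longrightarrow> 0 \<le> line_kernel x t"
  by (simp add: line_kernel_def)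

lemma borel_measurable_line_kernel [measurable]: "line_kernel x \<in> borel_measurable borel"
  unfolding line_kernel_def by measurable

lemma nn_integral_line_kernel:
  assumes "x > 0"
  shows "(\<integral>\<^sup>+t. ennreal (line_kernel x t) \<partial>lborel) = ennreal (2 * pi)"
  using nn_integral_circle_eq_line[of "\<lambda>_. 1" x] assms
  by (simp add: line_kernel_def)

lemma line_kernel_le:
  assumes "x > 0"
  shows "line_kernel x t \<le> 2 / x"
proof -
  have "line_kernel x t \<le> 2 * x / x\<^sup>2"
    unfolding line_kernel_def using assms by (intro divide_left_mono mult_pos_pos) (auto simp: add_pos_nonneg)
  then show ?thesis using assms by (simp add: power2_eq_square)
qed

lemma nn_integral_circle_eq_line_on:
  assumes b: "b > 0" and cont: "continuous_on {0<..<2*pi} f"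
  shows "(\<integral>\<^sup>+\<theta>\<in>{0<..<2*pi}. ennreal (f \<theta>) \<partial>lborel)
    = (\<integral>\<^sup>+t. ennreal (f (pi - 2 * arctan (t / b))) * ennreal (line_kernel b t) \<partial>lborel)"
proof -
  define u where "u \<theta> = ennreal (f \<theta>) * indicator {0<..<2*pi} \<theta>" for \<theta>
  have "u \<in> borel_measurable borel"
    unfolding u_def by (rule borel_measurable_ennreal_continuous_on[OF cont]) simp
  from nn_integral_circle_eq_line[OF this b] show ?thesis
    using circle_angle_range[of _ b] unfolding u_def line_kernel_def
    by (simp add: mult.assoc indicator_inter_arith[symmetric])
qed

text \<open>The Moebius parameter \<open>x\<close> and the shift \<open>y\<close> are free, so that the centre of the disc can be sent to an
arbitrary point \<open>\<alpha> + x + i y\<close> of the half-plane.\<close>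

lemma halfplane_to_disc:
  fixes F :: "complex \<Rightarrow> 'v::complex_hilbert_space"
  assumes cont: "continuous_on {s. Re s \<ge> \<alpha>} F" and hol: "vholomorphic_on F (halfplane \<alpha>)"
    and x: "x > 0"
  fixes y :: real
  defines "q \<equiv> \<lambda>\<omega>. F (mobius_inv \<alpha> x \<omega> + \<i> * of_real y)"
  shows "continuous_on (cball 0 1 - {1}) q" "vholomorphic_on q (ball 0 1)"
    "continuous_on {0<..<2*pi} (\<lambda>t. q (cis t))"
proof -
  have c: "continuous_on (- {1}) (mobius_inv \<alpha> x)"
    by (rule holomorphic_on_imp_continuous_on[OF mobius_inv_holomorphic])
  have img: "mobius_inv \<alpha> x \<omega> + \<i> * of_real y \<in> {s. Re s \<ge> \<alpha>}" if "\<omega> \<in> cball 0 1 - {1}" for \<omega>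
    using Re_mobius_inv_ge[of \<omega> x \<alpha>] that x by simp
  show cq: "continuous_on (cball 0 1 - {1}) q" unfolding q_def
    by (rule continuous_on_compose2[OF cont])
       (use img in \<open>auto intro!: continuous_intros continuous_on_subset[OF c]\<close>)
  have "vholomorphic_on (\<lambda>\<omega>. 1 *\<^sub>C F (mobius_inv \<alpha> x \<omega> + \<i> * of_real y)) (ball 0 1)"
  proof (rule vholomorphic_on_scaleC_compose[OF hol])
    show "(\<lambda>\<omega>. mobius_inv \<alpha> x \<omega> + \<i> * of_real y) holomorphic_on ball 0 1"
      by (intro holomorphic_intros holomorphic_on_subset[OF mobius_inv_holomorphic]) auto
  qed (use Re_mobius_inv_gt[of _ x \<alpha>] x in \<open>auto simp: halfplane_def\<close>)
  then show "vholomorphic_on q (ball 0 1)" by (simp add: scaleC_one q_def)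
  show "continuous_on {0<..<2*pi} (\<lambda>t. q (cis t))"
    by (rule continuous_on_compose2[OF cq]) (auto intro!: continuous_intros simp: cis_neq_1)
qed

text \<open>Since the Moebius transformation can be centred at the given point, only the value at the centre of the disc
is needed. There the Poisson kernel of the disc is \<open>1\<close> and the Jacobian alone produces the kernel of the line.\<close>

lemma halfplane_poisson_inequality:
  fixes F :: "complex \<Rightarrow> 'v::complex_hilbert_space"
  assumes cont: "continuous_on {s. Re s \<ge> \<alpha>} F" and hol: "vholomorphic_on F (halfplane \<alpha>)"
    and B: "\<And>s. Re s \<ge> \<alpha> \<Longrightarrow> norm (F s) \<le> B" and x: "x > 0"
  shows "ennreal (2 * pi * norm (F (Complex (\<alpha> + x) y)))
      \<le> (\<integral>\<^sup>+t. ennreal (norm (F (Complex \<alpha> (y + t)))) * ennreal (line_kernel x t) \<partial>lborel)" (is "?A \<le> ?B")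
    and "ennreal (2 * pi * (norm (F (Complex (\<alpha> + x) y)))\<^sup>2)
      \<le> (\<integral>\<^sup>+t. ennreal ((norm (F (Complex \<alpha> (y + t))))\<^sup>2) * ennreal (line_kernel x t) \<partial>lborel)" (is "?C \<le> ?D")
proof -
  define q where "q \<omega> = F (mobius_inv \<alpha> x \<omega> + \<i> * of_real y)" for \<omega>
  note q = halfplane_to_disc[OF cont hol x, of y, folded q_def]
  have qB: "norm (q \<omega>) \<le> B" if "\<omega> \<in> cball 0 1 - {1}" for \<omega>
    unfolding q_def using that Re_mobius_inv_ge[of \<omega> x \<alpha>] x by (intro B) auto
  have q0: "q 0 = F (Complex (\<alpha> + x) y)"
    unfolding q_def mobius_inv_def by (rule arg_cong[of _ _ F]) (simp add: complex_eq_iff)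
  have qt: "q (cis (pi - 2 * arctan (t / x))) = F (Complex \<alpha> (y + t))" for t
    unfolding q_def mobius_inv_cis[OF x] by (rule arg_cong[of _ _ F]) (simp add: complex_eq_iff)
  have "ennreal (2 * pi * norm (q 0)) \<le> (\<integral>\<^sup>+t\<in>{0<..<2*pi}. ennreal (norm (q (cis t))) \<partial>lborel)"
    using poisson_inequality_L1[OF q(1,2) qB, of 0] by (simp add: poisson_kernel_zero)
  also have "\<dots> = (\<integral>\<^sup>+t. ennreal (norm (q (cis (pi - 2 * arctan (t / x))))) * ennreal (line_kernel x t) \<partial>lborel)"
    by (rule nn_integral_circle_eq_line_on[OF x]) (intro continuous_intros q)
  finally show "?A \<le> ?B" unfolding qt q0 .
  have "ennreal (2 * pi * (norm (q 0))\<^sup>2) \<le> (\<integral>\<^sup>+t\<in>{0<..<2*pi}. ennreal ((norm (q (cis t)))\<^sup>2) \<partial>lborel)"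
    using poisson_inequality_L2[OF q(1,2) qB, of 0] by (simp add: poisson_kernel_zero)
  also have "\<dots> = (\<integral>\<^sup>+t. ennreal ((norm (q (cis (pi - 2 * arctan (t / x)))))\<^sup>2) * ennreal (line_kernel x t) \<partial>lborel)"
    by (rule nn_integral_circle_eq_line_on[OF x]) (intro continuous_intros q)
  finally show "?C \<le> ?D" unfolding qt q0 .
qed

lemma line_energy_measurable:
  fixes F :: "complex \<Rightarrow> 'v::complex_hilbert_space"
  assumes "continuous_on {s. Re s = \<sigma>} F"
  shows "(\<lambda>t. (norm (F (Complex \<sigma> t)))\<^sup>2) \<in> borel_measurable borel"
proof (intro borel_measurable_continuous_onI continuous_intros)
  have "continuous_on UNIV (Complex \<sigma>)"
    unfolding Complex_eq by (intro continuous_intros)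
  then show "continuous_on UNIV (\<lambda>t. F (Complex \<sigma> t))"
    by (rule continuous_on_compose2[OF assms]) auto
qed

text \<open>The half-plane counterpart of \<open>circle_mean_mono\<close>: the Poisson inequality is a convolution inequality on the
line, and convolution with a kernel of mass \<open>2 \<pi>\<close> multiplies integrals by \<open>2 \<pi>\<close>.\<close>

lemma line_mean_mono:
  fixes F :: "complex \<Rightarrow> 'v::complex_hilbert_space"
  assumes cont: "continuous_on {s. Re s \<ge> \<alpha>} F" and hol: "vholomorphic_on F (halfplane \<alpha>)"
    and B: "\<And>s. Re s \<ge> \<alpha> \<Longrightarrow> norm (F s) \<le> B" and \<sigma>: "\<sigma> > \<alpha>"
  shows "energy_on_line F \<sigma>
      \<le> energy_on_line F \<alpha>" (is "?E \<le> ?R")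
proof -
  define x where "x = \<sigma> - \<alpha>"
  have x: "x > 0" "\<sigma> = \<alpha> + x" using \<sigma> by (auto simp: x_def)
  define u where "u t = ennreal ((norm (F (Complex \<alpha> t)))\<^sup>2)" for t
  have [measurable]: "(\<lambda>t. (norm (F (Complex \<sigma> t)))\<^sup>2) \<in> borel_measurable borel"
      "(\<lambda>t. (norm (F (Complex \<alpha> t)))\<^sup>2) \<in> borel_measurable borel"
    using x by (auto intro!: line_energy_measurable continuous_on_subset[OF cont])
  have [measurable]: "u \<in> borel_measurable borel" unfolding u_def by measurable
  have "ennreal (2 * pi) * ?E = (\<integral>\<^sup>+y. ennreal (2 * pi * (norm (F (Complex \<sigma> y)))\<^sup>2) \<partial>lborel)"
    by (subst nn_integral_cmult[symmetric]) (auto simp: ennreal_mult)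
  also have "\<dots> \<le> (\<integral>\<^sup>+y. (\<integral>\<^sup>+t. u (y + t) * ennreal (line_kernel x t) \<partial>lborel) \<partial>lborel)"
    unfolding x(2) u_def by (intro nn_integral_mono halfplane_poisson_inequality(2)[OF cont hol B x(1)])
  also have "\<dots> = (\<integral>\<^sup>+t. (\<integral>\<^sup>+y. u (y + t) * ennreal (line_kernel x t) \<partial>lborel) \<partial>lborel)"
    by (rule lborel_pair.Fubini') measurable
  also have "\<dots> = (\<integral>\<^sup>+t. ?R * ennreal (line_kernel x t) \<partial>lborel)"
  proof (rule nn_integral_cong)
    fix t
    have "(\<integral>\<^sup>+y. u (y + t) * ennreal (line_kernel x t) \<partial>lborel) = (\<integral>\<^sup>+y. u (y + t) \<partial>lborel) * ennreal (line_kernel x t)"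
      by (rule nn_integral_multc) measurable
    also have "(\<integral>\<^sup>+y. u (y + t) \<partial>lborel) = (\<integral>\<^sup>+y. u y \<partial>lborel)"
      by (subst (2) nn_integral_real_affine[where c = 1 and t = t]) (auto simp: add.commute)
    finally show "(\<integral>\<^sup>+y. u (y + t) * ennreal (line_kernel x t) \<partial>lborel) = ?R * ennreal (line_kernel x t)"
      by (simp add: u_def)
  qed
  also have "\<dots> = ?R * ennreal (2 * pi)"
    using nn_integral_line_kernel[OF x(1)] by (simp add: nn_integral_cmult)
  finally show ?thesis
    by (subst (asm) mult.commute[of ?R], subst (asm) ennreal_mult_le_mult_iff) auto
qed

section \<open>Boundedness of functions of finite energy\<close>

lemma open_halfplane: "open (halfplane \<alpha>)" and convex_halfplane: "convex (halfplane \<alpha>)"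
  unfolding halfplane_def by (auto intro: open_halfspace_Re_gt convex_halfspace_Re_gt)

lemma continuous_on_Complex: "continuous_on S (Complex \<sigma>)"
  unfolding Complex_eq by (intro continuous_intros)

lemma nn_integral_shift:
  assumes [measurable]: "u \<in> borel_measurable borel"
  shows "(\<integral>\<^sup>+t. u (y + t) \<partial>lborel) = (\<integral>\<^sup>+t. u t \<partial>(lborel :: real measure))"
  by (subst (2) nn_integral_real_affine[where c = 1 and t = y]) auto

text \<open>The Poisson inequality presupposes boundedness, so it cannot be used here. Let \<open>F\<close> be a primitive of \<open>h\<close> and
\<open>0 \<le> l \<le> 1\<close>. The difference \<open>G(w) = F(w + i l) - F(w)\<close> is an integral of \<open>h\<close> over a vertical segment, hence bounded by the energy on
that line. Cauchy's estimate then bounds its derivative \<open>h(s + i l) - h(s)\<close>. Because the energy on the line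
through \<open>s\<close> is finite, some \<open>h(s + i l)\<close> is itself bounded.\<close>

lemma halfplane_energy_bounded_scalar:
  fixes h :: "complex \<Rightarrow> complex"
  assumes hol: "h holomorphic_on halfplane \<alpha>"
    and E: "\<And>\<sigma>. \<sigma> > \<alpha> \<Longrightarrow> energy_on_line h \<sigma> \<le> ennreal K"
    and K: "K \<ge> 0" and x: "x > 0" and s: "Re s \<ge> \<alpha> + x"
  shows "cmod (h s) \<le> sqrt (K + 1) + (K + 1) / x"
proof -
  obtain F where "\<And>w. w \<in> halfplane \<alpha> \<Longrightarrow> (F has_field_derivative h w) (at w within halfplane \<alpha>)"
    using holomorphic_convex_primitive'[OF convex_halfplane open_halfplane hol] by blast
  then have F: "(F has_field_derivative h w) (at w)" if "w \<in> halfplane \<alpha>" for w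
    using that by (metis at_within_open open_halfplane)
  have conth: "continuous_on (halfplane \<alpha>) h" using hol by (rule holomorphic_on_imp_continuous_on)
  have lc: "continuous_on S (\<lambda>u. h (w + \<i> * of_real u))" if "w \<in> halfplane \<alpha>" for w S
    by (rule continuous_on_compose2[OF conth]) (use that in \<open>auto intro!: continuous_intros simp: halfplane_def\<close>)
  have L: "(\<integral>\<^sup>+u. ennreal ((cmod (h (w + \<i> * of_real u)))\<^sup>2) \<partial>lborel) \<le> ennreal K" if w: "w \<in> halfplane \<alpha>" for w
  proof -
    define g where "g u = ennreal ((cmod (h (Complex (Re w) u)))\<^sup>2)" for u
    have "(\<lambda>u. (cmod (h (Complex (Re w) u)))\<^sup>2) \<in> borel_measurable borel"
      by (intro borel_measurable_continuous_onI continuous_intros continuous_on_compose2[OF conth continuous_on_Complex])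
         (use w in \<open>auto simp: halfplane_def\<close>)
    then have [measurable]: "g \<in> borel_measurable borel" unfolding g_def by measurable
    have "h (w + \<i> * of_real u) = h (Complex (Re w) (Im w + u))" for u
      by (rule arg_cong[of _ _ h]) (simp add: complex_eq_iff)
    then have "(\<integral>\<^sup>+u. ennreal ((cmod (h (w + \<i> * of_real u)))\<^sup>2) \<partial>lborel) = (\<integral>\<^sup>+u. g (Im w + u) \<partial>lborel)"
      by (simp add: g_def)
    also have "\<dots> = (\<integral>\<^sup>+u. g u \<partial>lborel)" by (rule nn_integral_shift) measurable
    finally show ?thesis using E[of "Re w"] w by (simp add: halfplane_def g_def)
  qed
  have I: "integral {0..l} (\<lambda>u. (cmod (h (w + \<i> * of_real u)))\<^sup>2) \<le> K" (is "?I \<le> K") if w: "w \<in> halfplane \<alpha>" for w l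
  proof -
    have "((\<lambda>u. (cmod (h (w + \<i> * of_real u)))\<^sup>2) has_integral ?I) {0..l}"
      by (intro integrable_integral integrable_continuous_interval continuous_intros lc w)
    then have "ennreal ?I = (\<integral>\<^sup>+u\<in>{0..l}. ennreal ((cmod (h (w + \<i> * of_real u)))\<^sup>2) \<partial>lborel)"
      by (intro nn_integral_has_integral_lebesgue'[symmetric]) auto
    also have "\<dots> \<le> (\<integral>\<^sup>+u. ennreal ((cmod (h (w + \<i> * of_real u)))\<^sup>2) \<partial>lborel)"
      by (intro nn_integral_mono) (auto split: split_indicator)
    finally have "ennreal ?I \<le> ennreal K" using L[OF w] by (rule order_trans)
    then show ?thesis using K by (simp add: ennreal_le_iff)
  qed
  have s': "s \<in> halfplane \<alpha>" using s x by (simp add: halfplane_def)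
  have shp: "w + \<i> * of_real l \<in> halfplane \<alpha>" if "w \<in> halfplane \<alpha>" for w l
    using that by (simp add: halfplane_def)
  obtain l where l: "0 \<le> l" "l \<le> 1" "(cmod (h (s + \<i> * of_real l)))\<^sup>2 \<le> K + 1"
  proof -
    have "\<exists>l\<in>{0..1}. (cmod (h (s + \<i> * of_real l)))\<^sup>2 \<le> K + 1"
    proof (rule ccontr)
      assume "\<not> ?thesis"
      then have *: "K + 1 \<le> (cmod (h (s + \<i> * of_real u)))\<^sup>2" if "u \<in> {0..1}" for u using that by force
      have "integral {0..1} (\<lambda>u::real. K + 1) \<le> integral {0..1} (\<lambda>u. (cmod (h (s + \<i> * of_real u)))\<^sup>2)"
        by (intro integral_le integrable_continuous_interval continuous_intros lc s' *)
      then show False using I[OF s', of 1] by simp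
    qed
    then show ?thesis using that by auto
  qed
  define G where "G w = F (w + \<i> * of_real l) - F w" for w
  have dG: "(G has_field_derivative (h (w + \<i> * of_real l) - h w)) (at w)" if w: "w \<in> halfplane \<alpha>" for w
    unfolding G_def
    using F[OF shp[OF w, of l]] F[OF w] by (intro DERIV_diff) (simp_all only: DERIV_shift)
  have Gb: "cmod (G w) \<le> (1 + K) / 2" if w: "w \<in> halfplane \<alpha>" for w
  proof -
    have "((\<lambda>u. \<i> * h (w + \<i> * of_real u)) has_integral (F (w + \<i> * of_real l) - F (w + \<i> * of_real 0))) {0..l}"
    proof (rule fundamental_theorem_of_calculus[OF l(1)])
      fix u
      have "((\<lambda>z. F (w + \<i> * z)) has_field_derivative h (w + \<i> * of_real u) * \<i>) (at (of_real u))"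
        by (rule DERIV_chain2[where f = F and g = "\<lambda>z. w + \<i> * z"])
           (use F[OF shp[OF w, of u]] in \<open>auto intro!: derivative_eq_intros\<close>)
      then have "((\<lambda>u. F (w + \<i> * of_real u)) has_vector_derivative h (w + \<i> * of_real u) * \<i>) (at u)"
        by (rule has_vector_derivative_real_field)
      then show "((\<lambda>u. F (w + \<i> * of_real u)) has_vector_derivative \<i> * h (w + \<i> * of_real u)) (at u within {0..l})"
        by (simp add: mult.commute has_vector_derivative_at_within)
    qed
    then have hi: "((\<lambda>u. \<i> * h (w + \<i> * of_real u)) has_integral G w) {0..l}" by (simp add: G_def)
    have "cmod (G w) \<le> integral {0..l} (\<lambda>u. (1 + (cmod (h (w + \<i> * of_real u)))\<^sup>2) / 2)"
      unfolding integral_unique[OF hi, symmetric]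
    proof (rule integral_norm_bound_integral)
      show "(\<lambda>u. (1 + (cmod (h (w + \<i> * of_real u)))\<^sup>2) / 2) integrable_on {0..l}"
        by (intro integrable_continuous_interval continuous_intros lc w) auto
      fix u
      show "cmod (\<i> * h (w + \<i> * of_real u)) \<le> (1 + (cmod (h (w + \<i> * of_real u)))\<^sup>2) / 2"
        using sum_squares_bound[of 1 "cmod (h (w + \<i> * of_real u))"] by (simp add: norm_mult)
    qed (use hi in blast)
    also have "\<dots> = (l + integral {0..l} (\<lambda>u. (cmod (h (w + \<i> * of_real u)))\<^sup>2)) / 2"
      using l by (subst integral_divide, subst Henstock_Kurzweil_Integration.integral_add)
        (auto intro!: integrable_continuous_interval continuous_intros lc w)
    also have "\<dots> \<le> (1 + K) / 2" using I[OF w, of l] l by simp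
    finally show ?thesis .
  qed
  have sub: "cball s (x / 2) \<subseteq> halfplane \<alpha>"
  proof
    fix w assume "w \<in> cball s (x / 2)"
    then have "cmod (s - w) \<le> x / 2" by (simp add: dist_norm)
    then have "Re s - Re w \<le> x / 2" using complex_Re_le_cmod[of "s - w"] by simp
    then show "w \<in> halfplane \<alpha>" using s x by (simp add: halfplane_def)
  qed
  have holG: "G holomorphic_on halfplane \<alpha>"
    using dG by (meson field_differentiable_def holomorphic_onI field_differentiable_at_within)
  have "cmod ((deriv ^^ 1) G s) \<le> fact 1 * ((1 + K) / 2) / (x / 2) ^ 1"
  proof (rule Cauchy_inequality)
    show "G holomorphic_on ball s (x / 2)" "continuous_on (cball s (x / 2)) G"
      using holG sub ball_subset_cball[of s "x / 2"]
      by (meson holomorphic_on_subset subset_trans, meson holomorphic_on_imp_continuous_on continuous_on_subset)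
    show "cmod (G w) \<le> (1 + K) / 2" if "cmod (s - w) = x / 2" for w
      using that sub by (intro Gb) (auto simp: dist_norm)
  qed (use x in auto)
  also have "fact 1 * ((1 + K) / 2) / (x / 2) ^ 1 = (K + 1) / x" using x by (simp add: field_simps)
  finally have "cmod (h (s + \<i> * of_real l) - h s) \<le> (K + 1) / x"
    using DERIV_imp_deriv[OF dG[OF s']] by (simp add: add.commute)
  moreover have "cmod (h (s + \<i> * of_real l)) \<le> sqrt (K + 1)"
    using l(3) by (rule real_le_rsqrt)
  ultimately show ?thesis
    using norm_triangle_ineq2[of "h s" "h (s + \<i> * of_real l)"] by (simp add: norm_minus_commute)
qed

lemma halfplane_energy_bounded:
  fixes f :: "complex \<Rightarrow> 'v::complex_hilbert_space"
  assumes hol: "vholomorphic_on f (halfplane \<alpha>)"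
    and E: "\<And>\<sigma>. \<sigma> > \<alpha> \<Longrightarrow> energy_on_line f \<sigma> \<le> ennreal K"
    and K: "K \<ge> 0" and x: "x > 0" and s: "Re s \<ge> \<alpha> + x"
  shows "norm (f s) \<le> sqrt (K + 1) + (K + 1) / x"
proof (cases "f s = 0")
  case True
  then show ?thesis using K x by simp
next
  case False
  define v where "v = of_real (1 / norm (f s)) *\<^sub>C f s"
  have nv: "norm v = 1" using False by (simp add: v_def norm_scaleC norm_divide)
  have "(\<integral>\<^sup>+t. ennreal ((cmod (cinner (f (Complex \<sigma> t)) v))\<^sup>2) \<partial>lborel) \<le> ennreal K" if "\<sigma> > \<alpha>" for \<sigma>
  proof -
    have "(\<integral>\<^sup>+t. ennreal ((cmod (cinner (f (Complex \<sigma> t)) v))\<^sup>2) \<partial>lborel)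
        \<le> energy_on_line f \<sigma>"
      using cinner_Cauchy_Schwarz[of _ v] nv by (intro nn_integral_mono ennreal_leI power_mono) auto
    then show ?thesis using E[OF that] by (rule order_trans)
  qed
  from halfplane_energy_bounded_scalar[OF vholomorphic_on_cinner[OF hol, of v] this K x s]
  have "cmod (cinner (f s) v) \<le> sqrt (K + 1) + (K + 1) / x" by simp
  moreover have "cmod (cinner (f s) v) = norm (f s)"
    using False by (simp add: v_def cinner_scaleC_right cinner_self norm_mult norm_divide power2_eq_square)
  ultimately show ?thesis by simp
qed

section \<open>The isometry between the Hardy spaces\<close>

lemma nn_integral_le_of_tendsto:
  fixes u :: "nat \<Rightarrow> 'a \<Rightarrow> ennreal"
  assumes [measurable]: "\<And>n. u n \<in> borel_measurable M"
    and lim: "\<And>x. (\<lambda>n. u n x) \<longlonglongrightarrow> v x" and le: "\<And>n. (\<integral>\<^sup>+x. u n x \<partial>M) \<le> c"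
  shows "(\<integral>\<^sup>+x. v x \<partial>M) \<le> c"
proof -
  have "(\<integral>\<^sup>+x. v x \<partial>M) = (\<integral>\<^sup>+x. liminf (\<lambda>n. u n x) \<partial>M)"
    using lim_imp_Liminf[OF sequentially_bot lim] by simp
  also have "\<dots> \<le> liminf (\<lambda>n. \<integral>\<^sup>+x. u n x \<partial>M)" by (rule nn_integral_liminf) measurable
  also have "\<dots> \<le> c" using le by (intro Liminf_le always_eventually allI) auto
  finally show ?thesis .
qed

text \<open>The pointwise formula for \<open>D f\<close>, extended by zero to match the representation of \<open>H2_disc\<close>; the next
definition is the inverse formula.\<close>

definition disc_transform ::
    "real \<Rightarrow> real \<Rightarrow> (complex \<Rightarrow> 'v::complex_hilbert_space) \<Rightarrow> complex \<Rightarrow> 'v"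
  where "disc_transform \<alpha> \<beta> f \<omega> = (if \<omega> \<in> disc then
    (of_real (2 * sqrt (\<beta> * pi)) / (1 - \<omega>)) *\<^sub>C f (mobius_inv \<alpha> \<beta> \<omega>) else 0)"

definition halfplane_transform ::
    "real \<Rightarrow> real \<Rightarrow> (complex \<Rightarrow> 'v::complex_hilbert_space) \<Rightarrow> complex \<Rightarrow> 'v"
  where "halfplane_transform \<alpha> \<beta> g s = (if s \<in> halfplane \<alpha> then
    ((1 - mobius \<alpha> \<beta> s) / of_real (2 * sqrt (\<beta> * pi))) *\<^sub>C g (mobius \<alpha> \<beta> s) else 0)"

lemma disc_eq_ball: "disc = ball 0 1"
  by (auto simp: disc_def)

lemma one_minus_mobius:
  assumes "s \<noteq> of_real \<alpha> - of_real b"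
  shows "1 - mobius \<alpha> b s = 2 * of_real b / (s - of_real \<alpha> + of_real b)"
proof -
  have "s - of_real \<alpha> + of_real b \<noteq> 0" using assms by (auto simp: algebra_simps add_eq_0_iff)
  then show ?thesis by (simp add: mobius_def field_simps)
qed

text \<open>This identity makes the weights match: \<open>4 \<beta> \<pi> / |1 - e\<^sup>i\<^sup>\<theta>|\<^sup>2\<close> times the Jacobian \<open>line_kernel \<beta> t\<close> equals \<open>2 \<pi>\<close>.\<close>

lemma cmod_one_minus_circle_point:
  assumes "b > 0"
  shows "(cmod (1 - cis (pi - 2 * arctan (t / b))))\<^sup>2 = 2 * b * line_kernel b t"
proof -
  have "1 - cis (pi - 2 * arctan (t / b)) = 2 * of_real b / Complex b t"
    unfolding cis_eq_mobius[OF assms, of t 0]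
    by (subst one_minus_mobius) (use assms in \<open>auto simp: complex_eq_iff Re_divide Im_divide\<close>)
  then show ?thesis
    using assms by (simp add: norm_divide power_divide cmod_power2 line_kernel_def)
       (simp add: power2_eq_square)
qed

lemma
  assumes "b > 0" 
  shows cmod_mobius_lt: "Re s > \<alpha> \<Longrightarrow> cmod (mobius \<alpha> b s) < 1"
    and cmod_mobius_le: "Re s \<ge> \<alpha> \<Longrightarrow> cmod (mobius \<alpha> b s) \<le> 1"
    and mobius_holomorphic: "mobius \<alpha> b holomorphic_on {s. Re s > \<alpha> - b}"
proof -
  have sq: "(cmod (s - of_real \<alpha> + of_real b))\<^sup>2 - (cmod (s - of_real \<alpha> - of_real b))\<^sup>2 = 4 * b * (Re s - \<alpha>)"
    unfolding cmod_power2 by (simp add: power2_eq_square algebra_simps)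
  have nz: "s - of_real \<alpha> + of_real b \<noteq> 0" if "Re s > \<alpha> - b" for s
    using that by (auto simp: complex_eq_iff)
  show "cmod (mobius \<alpha> b s) < 1" if "Re s > \<alpha>"
  proof -
    have "(cmod (s - of_real \<alpha> - of_real b))\<^sup>2 < (cmod (s - of_real \<alpha> + of_real b))\<^sup>2"
      using sq that assms by (smt (verit) mult_pos_pos)
    then have "cmod (s - of_real \<alpha> - of_real b) < cmod (s - of_real \<alpha> + of_real b)"
      by (rule power_less_imp_less_base) simp
    then show ?thesis using nz that assms by (simp add: mobius_def norm_divide)
  qed
  show "cmod (mobius \<alpha> b s) \<le> 1" if "Re s \<ge> \<alpha>"
  proof -
    have "(cmod (s - of_real \<alpha> - of_real b))\<^sup>2 \<le> (cmod (s - of_real \<alpha> + of_real b))\<^sup>2"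
      using sq that assms by (smt (verit) mult_nonneg_nonneg)
    then have "cmod (s - of_real \<alpha> - of_real b) \<le> cmod (s - of_real \<alpha> + of_real b)"
      by (rule power2_le_imp_le) simp
    then show ?thesis using nz that assms by (simp add: mobius_def norm_divide)
  qed
  show "mobius \<alpha> b holomorphic_on {s. Re s > \<alpha> - b}"
    unfolding mobius_def by (intro holomorphic_intros) (use nz in auto)
qed

lemma disc_transform_holomorphic:
  assumes f: "vholomorphic_on f (halfplane \<alpha>)" and b: "\<beta> > 0"
  shows "vholomorphic_on (disc_transform \<alpha> \<beta> f) disc"
proof -
  have "vholomorphic_on (\<lambda>\<omega>. (of_real (2 * sqrt (\<beta> * pi)) / (1 - \<omega>)) *\<^sub>C f (mobius_inv \<alpha> \<beta> \<omega>)) disc"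
    by (rule vholomorphic_on_scaleC_compose[OF f])
       (use Re_mobius_inv_gt[of _ \<beta> \<alpha>] b in \<open>auto simp: disc_def halfplane_def
         intro!: holomorphic_intros holomorphic_on_subset[OF mobius_inv_holomorphic]\<close>)
  then show ?thesis
    by (subst vholomorphic_on_cong) (auto simp: disc_transform_def)
qed

lemma halfplane_transform_holomorphic:
  assumes g: "vholomorphic_on g disc" and b: "\<beta> > 0"
  shows "vholomorphic_on (halfplane_transform \<alpha> \<beta> g) (halfplane \<alpha>)"
proof -
  have "vholomorphic_on (\<lambda>s. ((1 - mobius \<alpha> \<beta> s) / of_real (2 * sqrt (\<beta> * pi))) *\<^sub>C g (mobius \<alpha> \<beta> s)) (halfplane \<alpha>)"
    by (rule vholomorphic_on_scaleC_compose[OF g])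
       (use cmod_mobius_lt[of \<beta> \<alpha>] b in \<open>auto simp: disc_def halfplane_def
         intro!: holomorphic_intros holomorphic_on_subset[OF mobius_holomorphic]\<close>)
  then show ?thesis
    by (subst vholomorphic_on_cong) (auto simp: halfplane_transform_def)
qed

lemma halfplane_disc_inverse:
  assumes b: "\<beta> > 0" and f: "\<forall>s. s \<notin> halfplane \<alpha> \<longrightarrow> f s = 0"
  shows "halfplane_transform \<alpha> \<beta> (disc_transform \<alpha> \<beta> f) = f"
proof
  fix s
  show "halfplane_transform \<alpha> \<beta> (disc_transform \<alpha> \<beta> f) s = f s"
  proof (cases "s \<in> halfplane \<alpha>")
    case True
    then have s: "s \<noteq> of_real \<alpha> - of_real \<beta>" using b by (auto simp: halfplane_def)
    have m: "mobius \<alpha> \<beta> s \<in> disc" using True cmod_mobius_lt[OF b] by (auto simp: halfplane_def disc_def)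
    then have "mobius \<alpha> \<beta> s \<noteq> 1" by (auto simp: disc_def)
    then show ?thesis
      using True m b by (simp add: halfplane_transform_def disc_transform_def scaleC_scaleC
        mobius_inv_mobius s scaleC_one)
  qed (simp add: f halfplane_transform_def)
qed

lemma disc_halfplane_inverse:
  assumes b: "\<beta> > 0" and g: "\<forall>\<omega>. \<omega> \<notin> disc \<longrightarrow> g \<omega> = 0"
  shows "disc_transform \<alpha> \<beta> (halfplane_transform \<alpha> \<beta> g) = g"
proof
  fix \<omega>
  show "disc_transform \<alpha> \<beta> (halfplane_transform \<alpha> \<beta> g) \<omega> = g \<omega>"
  proof (cases "\<omega> \<in> disc")
    case True
    then have "\<omega> \<noteq> 1" by (auto simp: disc_def)
    moreover have "mobius_inv \<alpha> \<beta> \<omega> \<in> halfplane \<alpha>"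
      using True Re_mobius_inv_gt[OF _ b] by (auto simp: halfplane_def disc_def)
    ultimately show ?thesis
      using True b by (simp add: halfplane_transform_def disc_transform_def scaleC_scaleC
        mobius_mobius_inv scaleC_one)
  qed (simp add: g disc_transform_def)
qed

text \<open>Neither \<open>f\<close> nor the factor \<open>1 / (1 - \<omega>)\<close> is controlled on the unit circle. Translating \<open>f\<close> by \<open>x\<close> makes it bounded and
continuous up to the boundary, and moving the pole to \<open>1 + x\<close> makes the factor bounded; since
\<open>|1 + x - \<omega>| \<ge> |1 - \<omega>|\<close> on the closed disc, the latter only decreases the boundary mean. Fatou's lemma
gives the limit \<open>x \<rightarrow> 0\<close> on the fixed circle.\<close>

lemma disc_energy_le:
  fixes f :: "complex \<Rightarrow> 'v::complex_hilbert_space"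
  assumes b: "\<beta> > 0" and K: "K \<ge> 0" and hol: "vholomorphic_on f (halfplane \<alpha>)"
    and E: "\<And>\<sigma>. \<sigma> > \<alpha> \<Longrightarrow> energy_on_line f \<sigma> \<le> ennreal K"
    and r: "0 \<le> r" "r < 1"
  shows "energy_on_circle (disc_transform \<alpha> \<beta> f) r
    \<le> ennreal (2 * pi * K)"
proof -
  define C where "C = 2 * sqrt (\<beta> * pi)"
  have C: "C > 0" "C\<^sup>2 = 4 * (\<beta> * pi)" using b by (auto simp: C_def power_mult_distrib)
  define x where "x n = 1 / (real n + 1)" for n
  have x: "x n > 0" for n by (simp add: x_def)
  have xlim: "(\<lambda>n. complex_of_real (x n)) \<longlonglongrightarrow> of_real 0" unfolding x_def
    by (intro tendsto_of_real) real_asymp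
  define q where "q n \<omega> = (of_real C / (1 + of_real (x n) - \<omega>)) *\<^sub>C f (mobius_inv \<alpha> \<beta> \<omega> + of_real (x n))" for n \<omega>
  have contf: "continuous_on (halfplane \<alpha>) f" using hol by (rule vholomorphic_on_imp_continuous_on)
  have den: "cmod (1 + of_real (x n) - \<omega>) \<ge> cmod (1 - \<omega>)" "cmod (1 + of_real (x n) - \<omega>) \<ge> x n" if "cmod \<omega> \<le> 1" for n \<omega>
  proof -
    have "Re \<omega> \<le> 1" using that complex_Re_le_cmod[of \<omega>] by linarith
    then have "0 \<le> x n * (1 - Re \<omega>)" using x[of n] by simp
    moreover have "(cmod (1 + of_real (x n) - \<omega>))\<^sup>2 - (cmod (1 - \<omega>))\<^sup>2 = x n * x n + 2 * (x n * (1 - Re \<omega>))"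
      unfolding cmod_power2 by (simp add: power2_eq_square algebra_simps)
    ultimately have "(cmod (1 - \<omega>))\<^sup>2 \<le> (cmod (1 + of_real (x n) - \<omega>))\<^sup>2"
      using zero_le_square[of "x n"] by linarith
    then show "cmod (1 + of_real (x n) - \<omega>) \<ge> cmod (1 - \<omega>)" by (rule power2_le_imp_le) simp
    have "x n \<le> Re (1 + of_real (x n) - \<omega>)" using \<open>Re \<omega> \<le> 1\<close> by simp
    then show "cmod (1 + of_real (x n) - \<omega>) \<ge> x n" using complex_Re_le_cmod order_trans by blast
  qed
  have den0: "1 + of_real (x n) - \<omega> \<noteq> 0" if "cmod \<omega> \<le> 1" for n \<omega>
    using den(2)[OF that, of n] x[of n] by auto
  have img: "mobius_inv \<alpha> \<beta> \<omega> + of_real (x n) \<in> halfplane \<alpha>" if "cmod \<omega> \<le> 1" "\<omega> \<noteq> 1" for \<omega> n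
    using Re_mobius_inv_ge[OF that b, of \<alpha>] x[of n] by (simp add: halfplane_def)
  have c: "continuous_on (- {1}) (mobius_inv \<alpha> \<beta>)"
    by (rule holomorphic_on_imp_continuous_on[OF mobius_inv_holomorphic])
  have qc: "continuous_on (cball 0 1 - {1}) (q n)" for n
    unfolding q_def
    by (intro continuous_on_scaleC continuous_intros continuous_on_compose2[OF contf]
        continuous_on_subset[OF c]) (use den0 in \<open>auto intro: img\<close>)
  have qh: "vholomorphic_on (q n) (ball 0 1)" for n
    unfolding q_def
  proof (rule vholomorphic_on_scaleC_compose[OF hol])
    show "(\<lambda>\<omega>. of_real C / (1 + of_real (x n) - \<omega>)) holomorphic_on ball 0 1"
      by (intro holomorphic_intros) (use den0 in auto)
    show "(\<lambda>\<omega>. mobius_inv \<alpha> \<beta> \<omega> + of_real (x n)) holomorphic_on ball 0 1"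
      by (intro holomorphic_intros holomorphic_on_subset[OF mobius_inv_holomorphic]) auto
    have "mobius_inv \<alpha> \<beta> \<omega> + of_real (x n) \<in> halfplane \<alpha>" if "\<omega> \<in> ball 0 1" for \<omega>
      using that by (intro img) auto
    then show "(\<lambda>\<omega>. mobius_inv \<alpha> \<beta> \<omega> + of_real (x n)) ` ball 0 1 \<subseteq> halfplane \<alpha>" by blast
  qed
  have qB: "norm (q n \<omega>) \<le> C / x n * (sqrt (K + 1) + (K + 1) / x n)" if "\<omega> \<in> cball 0 1 - {1}" for n \<omega>
  proof -
    have "C / cmod (1 + of_real (x n) - \<omega>) \<le> C / x n"
      using den(2)[of \<omega> n] den0[of \<omega> n] that x[of n] C by (intro divide_left_mono mult_pos_pos) auto
    moreover have "norm (f (mobius_inv \<alpha> \<beta> \<omega> + of_real (x n))) \<le> sqrt (K + 1) + (K + 1) / x n"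
      using Re_mobius_inv_ge[of \<omega> \<beta> \<alpha>] that b
      by (intro halfplane_energy_bounded[OF hol E K x]) auto
    ultimately show ?thesis
      using C x[of n] unfolding q_def norm_scaleC norm_divide by (intro mult_mono) auto
  qed
  have qE: "energy_on_circle (q n) r \<le> ennreal (2 * pi * K)" for n
  proof -
    have "energy_on_circle (q n) r
        \<le> (\<integral>\<^sup>+\<theta>\<in>{0<..<2*pi}. ennreal ((norm (q n (cis \<theta>)))\<^sup>2) \<partial>lborel)"
      by (rule circle_mean_mono[OF qc qh qB r])
    also have "\<dots> = (\<integral>\<^sup>+t. ennreal ((norm (q n (cis (pi - 2 * arctan (t / \<beta>)))))\<^sup>2) * ennreal (line_kernel \<beta> t) \<partial>lborel)"
      by (rule nn_integral_circle_eq_line_on[OF b])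
         (intro continuous_intros continuous_on_compose2[OF qc], auto simp: cis_neq_1)
    also have "\<dots> \<le> (\<integral>\<^sup>+t. ennreal (2 * pi) * ennreal ((norm (f (Complex (\<alpha> + x n) t)))\<^sup>2) \<partial>lborel)"
    proof (rule nn_integral_mono)
      fix t
      define \<omega> where "\<omega> = cis (pi - 2 * arctan (t / \<beta>))"
      have \<omega>1: "\<omega> \<noteq> 1" unfolding \<omega>_def by (rule cis_neq_1[OF circle_angle_range])
      have "mobius_inv \<alpha> \<beta> \<omega> + of_real (x n) = Complex (\<alpha> + x n) t"
        unfolding \<omega>_def mobius_inv_cis[OF b] by (simp add: complex_eq_iff)
      then have "(norm (q n \<omega>))\<^sup>2 = C\<^sup>2 / (cmod (1 + of_real (x n) - \<omega>))\<^sup>2 * (norm (f (Complex (\<alpha> + x n) t)))\<^sup>2"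
        using C(1) by (simp add: q_def norm_scaleC norm_divide power_mult_distrib power_divide)
      also have "\<dots> \<le> C\<^sup>2 / (cmod (1 - \<omega>))\<^sup>2 * (norm (f (Complex (\<alpha> + x n) t)))\<^sup>2"
        using den(1)[of \<omega> n] \<omega>1 den0[of \<omega> n]
        by (intro mult_right_mono divide_left_mono power_mono mult_pos_pos) (auto simp: \<omega>_def)
      also have "C\<^sup>2 / (cmod (1 - \<omega>))\<^sup>2 = 2 * pi / line_kernel \<beta> t"
        using b unfolding C(2) \<omega>_def cmod_one_minus_circle_point[OF b] by simp
      finally have "(norm (q n \<omega>))\<^sup>2 * line_kernel \<beta> t \<le>
          2 * pi / line_kernel \<beta> t * (norm (f (Complex (\<alpha> + x n) t)))\<^sup>2 * line_kernel \<beta> t"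
        using line_kernel_nonneg[OF b] by (rule mult_right_mono)
      also have "\<dots> \<le> 2 * pi * (norm (f (Complex (\<alpha> + x n) t)))\<^sup>2"
        by simp
      finally show "ennreal ((norm (q n (cis (pi - 2 * arctan (t / \<beta>)))))\<^sup>2) * ennreal (line_kernel \<beta> t)
          \<le> ennreal (2 * pi) * ennreal ((norm (f (Complex (\<alpha> + x n) t)))\<^sup>2)"
        using line_kernel_nonneg[OF b, of t] unfolding \<omega>_def
        by (subst (1 2) ennreal_mult[symmetric]) (auto intro!: ennreal_leI)
    qed
    also have "\<dots> = ennreal (2 * pi) * energy_on_line f (\<alpha> + x n)"
    proof (rule nn_integral_cmult)
      have "(\<lambda>t. (norm (f (Complex (\<alpha> + x n) t)))\<^sup>2) \<in> borel_measurable borel"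
        using x[of n] by (intro line_energy_measurable continuous_on_subset[OF contf]) (auto simp: halfplane_def)
      then show "(\<lambda>t. ennreal ((norm (f (Complex (\<alpha> + x n) t)))\<^sup>2)) \<in> borel_measurable lborel"
        by measurable
    qed
    also have "\<dots> \<le> ennreal (2 * pi) * ennreal K"
      using x[of n] by (intro mult_left_mono E) auto
    also have "\<dots> = ennreal (2 * pi * K)" using K by (simp add: ennreal_mult)
    finally show ?thesis .
  qed
  have rb: "cmod (of_real r * cis \<theta>) < 1" for \<theta> using r by (simp add: norm_mult)
  show ?thesis
  proof (rule nn_integral_le_of_tendsto[OF _ _ qE])
    fix n
    have "continuous_on UNIV (\<lambda>\<theta>. q n (of_real r * cis \<theta>))"
      by (rule continuous_on_compose2[OF vholomorphic_on_imp_continuous_on[OF qh]])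
         (use rb in \<open>auto intro!: continuous_intros\<close>)
    then have [measurable]: "(\<lambda>\<theta>. (norm (q n (of_real r * cis \<theta>)))\<^sup>2) \<in> borel_measurable borel"
      by (intro borel_measurable_continuous_onI continuous_intros)
    show "(\<lambda>\<theta>. ennreal ((norm (q n (of_real r * cis \<theta>)))\<^sup>2) * indicator {0<..<2*pi} \<theta>) \<in> borel_measurable lborel"
      by measurable
  next
    fix \<theta>
    define \<omega> where "\<omega> = of_real r * cis \<theta>"
    have \<omega>: "cmod \<omega> < 1" "\<omega> \<noteq> 1" using rb[of \<theta>] by (auto simp: \<omega>_def)
    have "(\<lambda>n. q n \<omega>) \<longlonglongrightarrow> (of_real C / (1 + of_real 0 - \<omega>)) *\<^sub>C f (mobius_inv \<alpha> \<beta> \<omega> + of_real 0)"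
      unfolding q_def
      by (intro tendsto_scaleC tendsto_intros xlim continuous_on_tendsto_compose[OF contf])
         (use \<omega> img Re_mobius_inv_gt[OF \<omega>(1) b] in \<open>auto simp: halfplane_def intro!: always_eventually less_imp_le\<close>)
    also have "(of_real C / (1 + of_real 0 - \<omega>)) *\<^sub>C f (mobius_inv \<alpha> \<beta> \<omega> + of_real 0) = disc_transform \<alpha> \<beta> f \<omega>"
      using \<omega> by (simp add: disc_transform_def disc_def C_def)
    finally have l: "(\<lambda>n. q n \<omega>) \<longlonglongrightarrow> disc_transform \<alpha> \<beta> f \<omega>" .
    show "(\<lambda>n. ennreal ((norm (q n (of_real r * cis \<theta>)))\<^sup>2) * indicator {0<..<2*pi} \<theta>) \<longlonglongrightarrow>
        ennreal ((norm (disc_transform \<alpha> \<beta> f (of_real r * cis \<theta>)))\<^sup>2) * indicator {0<..<2*pi} \<theta>"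
      unfolding \<omega>_def[symmetric]
      by (cases "\<theta> \<in> {0<..<2*pi}") (auto intro!: tendsto_intros tendsto_ennrealI l)
  qed
qed

text \<open>The dilates \<open>\<omega> \<mapsto> g(\<rho> \<omega>)\<close> are bounded and continuous on the closed disc. The means of their transforms on the
lines are at most those on the boundary line, which are circle means of \<open>g\<close>. The limit \<open>\<rho> \<rightarrow> 1\<close> is taken by Fatou's lemma.\<close>

lemma halfplane_energy_le:
  fixes g :: "complex \<Rightarrow> 'v::complex_hilbert_space"
  assumes b: "\<beta> > 0" and K: "K \<ge> 0" and hol: "vholomorphic_on g disc"
    and E: "\<And>r. 0 \<le> r \<Longrightarrow> r < 1 \<Longrightarrow>
      energy_on_circle g r \<le> ennreal (2 * pi * K)"
    and \<sigma>: "\<sigma> > \<alpha>"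
  shows "energy_on_line (halfplane_transform \<alpha> \<beta> g) \<sigma> \<le> ennreal K"
proof -
  define C where "C = 2 * sqrt (\<beta> * pi)"
  have C: "C > 0" "C\<^sup>2 = 4 * (\<beta> * pi)" using b by (auto simp: C_def power_mult_distrib)
  define \<rho> where "\<rho> n = 1 - 1 / (real n + 2)" for n
  have \<rho>: "0 \<le> \<rho> n" "\<rho> n < 1" for n by (auto simp: \<rho>_def field_simps)
  have \<rho>lim: "(\<lambda>n. complex_of_real (\<rho> n)) \<longlonglongrightarrow> of_real 1"
    unfolding \<rho>_def by (intro tendsto_of_real) real_asymp
  define F where "F n s = ((1 - mobius \<alpha> \<beta> s) / of_real C) *\<^sub>C g (of_real (\<rho> n) * mobius \<alpha> \<beta> s)" for n s
  have contg: "continuous_on (ball 0 1) g"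
    using hol unfolding disc_eq_ball by (rule vholomorphic_on_imp_continuous_on)
  have inb: "of_real (\<rho> n) * \<omega> \<in> ball 0 1" if "cmod \<omega> \<le> 1" for n \<omega>
  proof -
    have "cmod (of_real (\<rho> n) * \<omega>) \<le> \<rho> n" using \<rho>[of n] that by (simp add: norm_mult mult_left_le)
    then show ?thesis using \<rho>[of n] by simp
  qed
  have mc: "continuous_on {s. Re s \<ge> \<alpha>} (mobius \<alpha> \<beta>)"
    by (rule continuous_on_subset[OF holomorphic_on_imp_continuous_on[OF mobius_holomorphic[OF b, of \<alpha>]]])
       (use b in auto)
  have mh: "mobius \<alpha> \<beta> holomorphic_on halfplane \<alpha>"
    by (rule holomorphic_on_subset[OF mobius_holomorphic[OF b, of \<alpha>]]) (use b in \<open>auto simp: halfplane_def\<close>)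
  have contn: "continuous_on (cball 0 1) (\<lambda>\<omega>. g (of_real (\<rho> n) * \<omega>))" for n
    by (rule continuous_on_compose2[OF contg]) (use inb in \<open>auto intro!: continuous_intros\<close>)
  have Fc: "continuous_on {s. Re s \<ge> \<alpha>} (F n)" for n
    unfolding F_def
    by (intro continuous_on_scaleC continuous_intros mc continuous_on_compose2[OF contn])
       (use C cmod_mobius_le[OF b, of \<alpha>] in auto)
  have Fh: "vholomorphic_on (F n) (halfplane \<alpha>)" for n
    unfolding F_def
  proof (rule vholomorphic_on_scaleC_compose[OF hol])
    have "of_real (\<rho> n) * mobius \<alpha> \<beta> s \<in> disc" if "s \<in> halfplane \<alpha>" for s
      using that inb cmod_mobius_le[OF b, of \<alpha> s] by (auto simp: disc_eq_ball halfplane_def)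
    then show "(\<lambda>s. of_real (\<rho> n) * mobius \<alpha> \<beta> s) ` halfplane \<alpha> \<subseteq> disc" by blast
  qed (use C in \<open>auto intro!: holomorphic_intros mh\<close>)
  have "\<exists>B. \<forall>\<omega>\<in>cball 0 1. norm (g (of_real (\<rho> n) * \<omega>)) \<le> B" for n
    using compact_imp_bounded[OF compact_continuous_image[OF contn compact_cball], of n]
    unfolding bounded_iff by blast
  then obtain B where B: "\<And>n \<omega>. \<omega> \<in> cball 0 1 \<Longrightarrow> norm (g (of_real (\<rho> n) * \<omega>)) \<le> B n"
    by metis
  have FB: "norm (F n s) \<le> 2 / C * B n" if s: "Re s \<ge> \<alpha>" for n s
  proof -
    have m: "cmod (mobius \<alpha> \<beta> s) \<le> 1" using cmod_mobius_le[OF b s] .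
    have "cmod (1 - mobius \<alpha> \<beta> s) \<le> 2"
      using norm_triangle_ineq4[of 1 "mobius \<alpha> \<beta> s"] m by simp
    then show ?thesis unfolding F_def norm_scaleC norm_divide
      using m C by (intro mult_mono divide_right_mono B) (auto intro: divide_right_mono)
  qed
  have FE: "energy_on_line (F n) \<sigma> \<le> ennreal K" for n
  proof -
    define q where "q \<omega> = g (of_real (\<rho> n) * \<omega>)" for \<omega>
    have "ennreal (2 * pi) * energy_on_line (F n) \<sigma>
        \<le> ennreal (2 * pi) * energy_on_line (F n) \<alpha>"
      by (intro mult_left_mono line_mean_mono[OF Fc Fh FB \<sigma>]) (simp_all only: zero_le)
    also have "\<dots> = (\<integral>\<^sup>+t. ennreal (2 * pi) * ennreal ((norm (F n (Complex \<alpha> t)))\<^sup>2) \<partial>lborel)"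
    proof (rule nn_integral_cmult[symmetric])
      have "(\<lambda>t. (norm (F n (Complex \<alpha> t)))\<^sup>2) \<in> borel_measurable borel"
        by (intro line_energy_measurable continuous_on_subset[OF Fc]) auto
      then show "(\<lambda>t. ennreal ((norm (F n (Complex \<alpha> t)))\<^sup>2)) \<in> borel_measurable lborel"
        by measurable
    qed
    also have "\<dots> = (\<integral>\<^sup>+t. ennreal ((norm (q (cis (pi - 2 * arctan (t / \<beta>)))))\<^sup>2) * ennreal (line_kernel \<beta> t) \<partial>lborel)"
    proof (rule nn_integral_cong)
      fix t
      define \<omega> where "\<omega> = cis (pi - 2 * arctan (t / \<beta>))"
      have "mobius \<alpha> \<beta> (Complex \<alpha> t) = \<omega>" unfolding \<omega>_def by (rule cis_eq_mobius[OF b, symmetric])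
      then have "(norm (F n (Complex \<alpha> t)))\<^sup>2 = (cmod (1 - \<omega>))\<^sup>2 / C\<^sup>2 * (norm (q \<omega>))\<^sup>2"
        using C(1) by (simp add: F_def q_def norm_scaleC norm_divide power_mult_distrib power_divide)
      then have "2 * pi * (norm (F n (Complex \<alpha> t)))\<^sup>2 = (norm (q \<omega>))\<^sup>2 * line_kernel \<beta> t"
        using b unfolding C(2) by (simp add: \<omega>_def cmod_one_minus_circle_point[OF b])
      then show "ennreal (2 * pi) * ennreal ((norm (F n (Complex \<alpha> t)))\<^sup>2)
          = ennreal ((norm (q (cis (pi - 2 * arctan (t / \<beta>)))))\<^sup>2) * ennreal (line_kernel \<beta> t)"
        using line_kernel_nonneg[OF b, of t] unfolding \<omega>_def
        by (subst (1 2) ennreal_mult[symmetric]) auto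
    qed
    also have "\<dots> = (\<integral>\<^sup>+\<theta>\<in>{0<..<2*pi}. ennreal ((norm (q (cis \<theta>)))\<^sup>2) \<partial>lborel)"
      unfolding q_def
      by (rule nn_integral_circle_eq_line_on[OF b, symmetric])
         (intro continuous_intros continuous_on_compose2[OF contn], auto)
    also have "\<dots> \<le> ennreal (2 * pi) * ennreal K"
      using E[OF \<rho>, of n] K by (simp add: q_def ennreal_mult)
    finally show ?thesis
      by (subst (asm) ennreal_mult_le_mult_iff) auto
  qed
  show ?thesis
  proof (rule nn_integral_le_of_tendsto[OF _ _ FE])
    fix n
    have [measurable]: "(\<lambda>t. (norm (F n (Complex \<sigma> t)))\<^sup>2) \<in> borel_measurable borel"
      using \<sigma> by (intro line_energy_measurable continuous_on_subset[OF Fc]) auto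
    show "(\<lambda>t. ennreal ((norm (F n (Complex \<sigma> t)))\<^sup>2)) \<in> borel_measurable lborel"
      by measurable
  next
    fix t
    define s where "s = Complex \<sigma> t"
    have s: "s \<in> halfplane \<alpha>" "Re s > \<alpha>" using \<sigma> by (auto simp: s_def halfplane_def)
    have m: "cmod (mobius \<alpha> \<beta> s) < 1" by (rule cmod_mobius_lt[OF b s(2)])
    have "of_real (\<rho> n) * mobius \<alpha> \<beta> s \<in> ball 0 1" for n using inb m by simp
    then have "(\<lambda>n. F n s) \<longlonglongrightarrow> ((1 - mobius \<alpha> \<beta> s) / of_real C) *\<^sub>C g (of_real 1 * mobius \<alpha> \<beta> s)"
      unfolding F_def
      by (intro tendsto_scaleC tendsto_const continuous_on_tendsto_compose[OF contg] tendsto_mult \<rho>lim)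
         (use m in \<open>auto intro!: always_eventually\<close>)
    also have "((1 - mobius \<alpha> \<beta> s) / of_real C) *\<^sub>C g (of_real 1 * mobius \<alpha> \<beta> s) = halfplane_transform \<alpha> \<beta> g s"
      using s by (simp add: halfplane_transform_def C_def)
    finally show "(\<lambda>n. ennreal ((norm (F n (Complex \<sigma> t)))\<^sup>2)) \<longlonglongrightarrow>
        ennreal ((norm (halfplane_transform \<alpha> \<beta> g (Complex \<sigma> t)))\<^sup>2)"
      unfolding s_def by (intro tendsto_ennrealI tendsto_intros)
  qed
qed

lemma nn_integral_circle_Icc:
  "(\<integral>\<^sup>+\<theta>\<in>{0<..<2*pi}. f \<theta> \<partial>lborel) = (\<integral>\<^sup>+\<theta>\<in>{0..2*pi}. f \<theta> \<partial>(lborel :: real measure))"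
proof (rule nn_integral_cong_AE)
  have "AE \<theta> in lborel. \<theta> \<noteq> (0::real)" "AE \<theta> in lborel. \<theta> \<noteq> 2 * pi"
    by (rule AE_lborel_singleton)+
  then show "AE \<theta> in lborel. f \<theta> * indicator {0<..<2*pi} \<theta> = f \<theta> * indicator {0..2*pi} \<theta>"
    by eventually_elim (auto split: split_indicator)
qed

lemma circle_energy:
  fixes g :: "complex \<Rightarrow> 'v::complex_hilbert_space"
  assumes hol: "vholomorphic_on g disc" and r: "0 \<le> r" "r < 1"
  defines "I \<equiv> LINT \<theta>:{0..2*pi}|lborel. (norm (g (of_real r * cis \<theta>)))\<^sup>2"
  shows "I \<ge> 0"
    "energy_on_circle g r = ennreal I"
proof -
  have c: "continuous_on UNIV (\<lambda>\<theta>. g (of_real r * cis \<theta>))"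
    by (rule continuous_on_compose2[OF vholomorphic_on_imp_continuous_on[OF hol]])
       (use r in \<open>auto intro!: continuous_intros simp: disc_def norm_mult\<close>)
  have si: "set_integrable lborel {0..2*pi} (\<lambda>\<theta>. (norm (g (of_real r * cis \<theta>)))\<^sup>2)"
    by (intro borel_integrable_atLeastAtMost' continuous_intros continuous_on_subset[OF c]) auto
  show "I \<ge> 0" unfolding I_def set_lebesgue_integral_def
    by (intro Bochner_Integration.integral_nonneg) simp
  have "ennreal I = (\<integral>\<^sup>+\<theta>. ennreal (indicator {0..2*pi} \<theta> *\<^sub>R (norm (g (of_real r * cis \<theta>)))\<^sup>2) \<partial>lborel)"
    unfolding I_def set_lebesgue_integral_def
    by (rule nn_integral_eq_integral[symmetric]) (use si in \<open>auto simp: set_integrable_def\<close>)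
  also have "\<dots> = (\<integral>\<^sup>+\<theta>\<in>{0..2*pi}. ennreal ((norm (g (of_real r * cis \<theta>)))\<^sup>2) \<partial>lborel)"
    by (intro nn_integral_cong) (auto split: split_indicator)
  finally show "energy_on_circle g r = ennreal I"
    by (simp add: nn_integral_circle_Icc)
qed

text \<open>Membership and norm are characterized together by bounds on nonnegative integrals. A norm is
determined by the bounds \<open>K\<close> it satisfies, so the isometry reduces to an equivalence of such bounds.\<close>

lemma H2_disc_norm_le_iff:
  fixes g :: "complex \<Rightarrow> 'v::complex_hilbert_space"
  assumes g0: "\<forall>\<omega>. \<omega> \<notin> disc \<longrightarrow> g \<omega> = 0" and hol: "vholomorphic_on g disc" and K: "K \<ge> 0"
  shows "(g \<in> H2_disc \<and> H2_disc_norm g \<le> K) \<longleftrightarrow> (\<forall>r. 0 \<le> r \<longrightarrow> r < 1 \<longrightarrow>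
      energy_on_circle g r \<le> ennreal (2 * pi * K\<^sup>2))"
    (is "_ \<longleftrightarrow> ?R")
proof -
  define m where "m r = sqrt (1 / (2 * pi) * (LINT \<theta>:{0..2*pi}|lborel. (norm (g (of_real r * cis \<theta>)))\<^sup>2))" for r
  have eq: "energy_on_circle g r \<le> ennreal (2 * pi * K\<^sup>2) \<longleftrightarrow> m r \<le> K"
    if r: "0 \<le> r" "r < 1" for r
  proof -
    have "m r \<le> K \<longleftrightarrow> 1 / (2 * pi) * (LINT \<theta>:{0..2*pi}|lborel. (norm (g (of_real r * cis \<theta>)))\<^sup>2) \<le> K\<^sup>2"
      unfolding m_def using K by (metis real_sqrt_le_iff real_sqrt_unique)
    also have "\<dots> \<longleftrightarrow> (LINT \<theta>:{0..2*pi}|lborel. (norm (g (of_real r * cis \<theta>)))\<^sup>2) \<le> 2 * pi * K\<^sup>2"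
      by (simp add: field_simps)
    finally show ?thesis
      unfolding circle_energy(2)[OF hol r] by (subst ennreal_le_iff) auto
  qed
  have "(g \<in> H2_disc \<and> H2_disc_norm g \<le> K) \<longleftrightarrow> bdd_above (m ` {0..<1}) \<and> (SUP r\<in>{0..<1}. m r) \<le> K"
    using g0 hol by (simp add: H2_disc_def H2_disc_norm_def m_def)
  also have "\<dots> \<longleftrightarrow> (\<forall>r\<in>{0..<1}. m r \<le> K)"
    by (auto simp: cSUP_le_iff intro: bdd_aboveI2 intro!: cSUP_least)
  also have "\<dots> \<longleftrightarrow> ?R" using eq by auto
  finally show ?thesis .
qed

lemma H2_halfplane_norm_le_iff:
  fixes f :: "complex \<Rightarrow> 'v::complex_hilbert_space"
  assumes f0: "\<forall>s. s \<notin> halfplane \<alpha> \<longrightarrow> f s = 0" and hol: "vholomorphic_on f (halfplane \<alpha>)" and K: "K \<ge> 0"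
  shows "(f \<in> H2_halfplane \<alpha> \<and> H2_halfplane_norm \<alpha> f \<le> K) \<longleftrightarrow> (\<forall>\<sigma>>\<alpha>.
      energy_on_line f \<sigma> \<le> ennreal (K\<^sup>2))"
    (is "_ \<longleftrightarrow> ?R")
proof -
  define m where "m \<sigma> = sqrt (LINT \<tau>|lborel. (norm (f (Complex \<sigma> \<tau>)))\<^sup>2)" for \<sigma>
  define int where "int \<sigma> \<longleftrightarrow> integrable lborel (\<lambda>\<tau>. (norm (f (Complex \<sigma> \<tau>)))\<^sup>2)" for \<sigma>
  have eq: "energy_on_line f \<sigma> \<le> ennreal (K\<^sup>2) \<longleftrightarrow> int \<sigma> \<and> m \<sigma> \<le> K"
    if \<sigma>: "\<sigma> > \<alpha>" for \<sigma>
  proof -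
    have meas: "(\<lambda>t. (norm (f (Complex \<sigma> t)))\<^sup>2) \<in> borel_measurable lborel"
      using \<sigma> line_energy_measurable[OF continuous_on_subset[OF vholomorphic_on_imp_continuous_on[OF hol]], of \<sigma>]
      by (auto simp: halfplane_def)
    have "m \<sigma> \<le> K \<longleftrightarrow> (LINT \<tau>|lborel. (norm (f (Complex \<sigma> \<tau>)))\<^sup>2) \<le> K\<^sup>2"
      unfolding m_def using K by (metis real_sqrt_le_iff real_sqrt_unique)
    moreover have "int \<sigma>" if "energy_on_line f \<sigma> \<le> ennreal (K\<^sup>2)"
      unfolding int_def integrable_iff_bounded using meas le_less_trans[OF that ennreal_less_top] by simp
    moreover have "energy_on_line f \<sigma> = ennreal (LINT \<tau>|lborel. (norm (f (Complex \<sigma> \<tau>)))\<^sup>2)"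
      if "int \<sigma>"
      using that unfolding int_def by (intro nn_integral_eq_integral) auto
    ultimately show ?thesis by (auto simp: ennreal_le_iff)
  qed
  have "(f \<in> H2_halfplane \<alpha> \<and> H2_halfplane_norm \<alpha> f \<le> K) \<longleftrightarrow>
      (\<forall>\<sigma>>\<alpha>. int \<sigma>) \<and> bdd_above (m ` {\<alpha><..}) \<and> (SUP \<sigma>\<in>{\<alpha><..}. m \<sigma>) \<le> K"
    using f0 hol by (simp add: H2_halfplane_def H2_halfplane_norm_def m_def int_def)
  also have "\<dots> \<longleftrightarrow> (\<forall>\<sigma>>\<alpha>. int \<sigma>) \<and> (\<forall>\<sigma>\<in>{\<alpha><..}. m \<sigma> \<le> K)"
    by (auto simp: cSUP_le_iff intro: bdd_aboveI2 intro!: cSUP_least)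
  also have "\<dots> \<longleftrightarrow> ?R" using eq by auto
  finally show ?thesis .
qed

lemma H2_disc_norm_nonneg: "g \<in> H2_disc \<Longrightarrow> 0 \<le> H2_disc_norm g"
  unfolding H2_disc_norm_def H2_disc_def
  by (rule order_trans[OF real_sqrt_ge_zero cSUP_upper[of 0]])
     (auto intro!: mult_nonneg_nonneg Bochner_Integration.integral_nonneg simp: set_lebesgue_integral_def)

lemma H2_halfplane_norm_nonneg: "f \<in> H2_halfplane \<alpha> \<Longrightarrow> 0 \<le> H2_halfplane_norm \<alpha> f"
  unfolding H2_halfplane_norm_def H2_halfplane_def
  by (rule order_trans[OF real_sqrt_ge_zero cSUP_upper[of "\<alpha> + 1"]])
     (auto intro!: Bochner_Integration.integral_nonneg)

lemma H2_halfplaneD: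
  assumes "f \<in> H2_halfplane \<alpha>"
  shows "\<forall>s. s \<notin> halfplane \<alpha> \<longrightarrow> f s = 0" "vholomorphic_on f (halfplane \<alpha>)"
    "\<And>\<sigma>. \<sigma> > \<alpha> \<Longrightarrow> energy_on_line f \<sigma> \<le> ennreal ((H2_halfplane_norm \<alpha> f)\<^sup>2)"
proof -
  show 1: "\<forall>s. s \<notin> halfplane \<alpha> \<longrightarrow> f s = 0" and 2: "vholomorphic_on f (halfplane \<alpha>)"
    using assms by (auto simp: H2_halfplane_def)
  show "\<And>\<sigma>. \<sigma> > \<alpha> \<Longrightarrow> energy_on_line f \<sigma> \<le> ennreal ((H2_halfplane_norm \<alpha> f)\<^sup>2)"
    using H2_halfplane_norm_le_iff[OF 1 2 H2_halfplane_norm_nonneg[OF assms]] assms by auto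
qed

lemma H2_discD:
  assumes "g \<in> H2_disc"
  shows "\<forall>\<omega>. \<omega> \<notin> disc \<longrightarrow> g \<omega> = 0" "vholomorphic_on g disc"
  using assms by (auto simp: H2_disc_def)

lemma disc_transform_norm_le_iff:
  fixes f :: "complex \<Rightarrow> 'v::complex_hilbert_space"
  assumes b: "\<beta> > 0" and f0: "\<forall>s. s \<notin> halfplane \<alpha> \<longrightarrow> f s = 0"
    and hol: "vholomorphic_on f (halfplane \<alpha>)" and K: "K \<ge> 0"
  shows "(disc_transform \<alpha> \<beta> f \<in> H2_disc \<and> H2_disc_norm (disc_transform \<alpha> \<beta> f) \<le> K) \<longleftrightarrow>
    (f \<in> H2_halfplane \<alpha> \<and> H2_halfplane_norm \<alpha> f \<le> K)"
proof -
  define g where "g = disc_transform \<alpha> \<beta> f"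
  have g0: "\<forall>\<omega>. \<omega> \<notin> disc \<longrightarrow> g \<omega> = 0" by (simp add: g_def disc_transform_def)
  have gh: "vholomorphic_on g disc" unfolding g_def by (rule disc_transform_holomorphic[OF hol b])
  have fg: "halfplane_transform \<alpha> \<beta> g = f" unfolding g_def by (rule halfplane_disc_inverse[OF b f0])
  show ?thesis
    unfolding g_def[symmetric] H2_disc_norm_le_iff[OF g0 gh K] H2_halfplane_norm_le_iff[OF f0 hol K]
    using disc_energy_le[OF b _ hol, of "K\<^sup>2"] halfplane_energy_le[OF b _ gh, of "K\<^sup>2" \<alpha>]
    unfolding g_def[symmetric] fg by (meson zero_le_power2)
qed

lemma disc_transform_isometry:
  assumes b: "\<beta> > 0" and f: "f \<in> H2_halfplane \<alpha>"
  shows "disc_transform \<alpha> \<beta> f \<in> H2_disc" "H2_disc_norm (disc_transform \<alpha> \<beta> f) = H2_halfplane_norm \<alpha> f"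
proof -
  note iff = disc_transform_norm_le_iff[OF b H2_halfplaneD(1,2)[OF f]]
  have 1: "disc_transform \<alpha> \<beta> f \<in> H2_disc" "H2_disc_norm (disc_transform \<alpha> \<beta> f) \<le> H2_halfplane_norm \<alpha> f"
    using iff[OF H2_halfplane_norm_nonneg[OF f]] f by auto
  moreover have "H2_halfplane_norm \<alpha> f \<le> H2_disc_norm (disc_transform \<alpha> \<beta> f)"
    using iff[OF H2_disc_norm_nonneg[OF 1(1)]] 1 by auto
  ultimately show "disc_transform \<alpha> \<beta> f \<in> H2_disc"
    "H2_disc_norm (disc_transform \<alpha> \<beta> f) = H2_halfplane_norm \<alpha> f" by auto
qed

lemma bij_disc_transform:
  assumes b: "\<beta> > 0"
  shows "bij_betw (disc_transform \<alpha> \<beta>) (H2_halfplane \<alpha> :: (complex \<Rightarrow> 'v::complex_hilbert_space) set) H2_disc"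
proof (rule bij_betw_byWitness[where f' = "halfplane_transform \<alpha> \<beta>"])
  show "\<forall>f\<in>(H2_halfplane \<alpha> :: (complex \<Rightarrow> 'v) set). halfplane_transform \<alpha> \<beta> (disc_transform \<alpha> \<beta> f) = f"
    using halfplane_disc_inverse[OF b] H2_halfplaneD(1) by blast
  show "\<forall>g\<in>(H2_disc :: (complex \<Rightarrow> 'v) set). disc_transform \<alpha> \<beta> (halfplane_transform \<alpha> \<beta> g) = g"
    using disc_halfplane_inverse[OF b] H2_discD(1) by blast
  show "disc_transform \<alpha> \<beta> ` H2_halfplane \<alpha> \<subseteq> (H2_disc :: (complex \<Rightarrow> 'v) set)"
    using disc_transform_isometry(1)[OF b] by blast
  show "halfplane_transform \<alpha> \<beta> ` H2_disc \<subseteq> (H2_halfplane \<alpha> :: (complex \<Rightarrow> 'v) set)"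
  proof
    fix f :: "complex \<Rightarrow> 'v" assume "f \<in> halfplane_transform \<alpha> \<beta> ` H2_disc"
    then obtain g where g: "g \<in> H2_disc" "f = halfplane_transform \<alpha> \<beta> g" by blast
    have f0: "\<forall>s. s \<notin> halfplane \<alpha> \<longrightarrow> f s = 0" by (simp add: g(2) halfplane_transform_def)
    have fh: "vholomorphic_on f (halfplane \<alpha>)"
      unfolding g(2) by (rule halfplane_transform_holomorphic[OF H2_discD(2)[OF g(1)] b])
    have "disc_transform \<alpha> \<beta> f = g" unfolding g(2) by (rule disc_halfplane_inverse[OF b H2_discD(1)[OF g(1)]])
    then show "f \<in> H2_halfplane \<alpha>"
      using disc_transform_norm_le_iff[OF b f0 fh H2_disc_norm_nonneg[OF g(1)]] g(1) by auto
  qed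
qed

section \<open>Translates converge in mean\<close>

lemma vholomorphic_on_translate:
  assumes "vholomorphic_on f (halfplane \<alpha>)" "x \<ge> 0"
  shows "vholomorphic_on (\<lambda>s. f (s + of_real x)) (halfplane \<alpha>)"
proof -
  have "vholomorphic_on (\<lambda>s. 1 *\<^sub>C f (s + of_real x)) (halfplane \<alpha>)"
    by (rule vholomorphic_on_scaleC_compose[OF assms(1)])
       (use assms(2) in \<open>auto intro!: holomorphic_intros simp: halfplane_def\<close>)
  then show ?thesis by (simp add: scaleC_one)
qed

lemma vholomorphic_on_scaleC_const:
  assumes "vholomorphic_on f S"
  shows "vholomorphic_on (\<lambda>s. c *\<^sub>C f s) S"
  using vholomorphic_on_scaleC_compose[OF assms, of "\<lambda>_. c" S "\<lambda>s. s"] by simp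

lemma uminus_scaleC: "(- 1) *\<^sub>C x = - (x :: 'v::complex_hilbert_space)"
  using scaleR_scaleC[of "-1" x] by simp

lemma vholomorphic_on_diff:
  assumes "vholomorphic_on f S" "vholomorphic_on g S"
  shows "vholomorphic_on (\<lambda>s. f s - g s) S"
  using vholomorphic_on_add[OF assms(1) vholomorphic_on_scaleC_const[OF assms(2), of "-1"]]
  by (simp add: uminus_scaleC)

text \<open>The analytic content of membership in \<open>H2_halfplane \<alpha>\<close>, with a bound \<open>K\<close> of the square of the norm.\<close>

locale halfplane_energy =
  fixes f :: "complex \<Rightarrow> 'v::complex_hilbert_space" and \<alpha> K :: real
  assumes hol: "vholomorphic_on f (halfplane \<alpha>)" and K: "K \<ge> 0"
    and E: "\<And>\<sigma>. \<sigma> > \<alpha> \<Longrightarrow> energy_on_line f \<sigma> \<le> ennreal K"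
begin

lemma contf: "continuous_on (halfplane \<alpha>) f"
  using hol by (rule vholomorphic_on_imp_continuous_on)

lemma translate_continuous: "x > 0 \<Longrightarrow> continuous_on {s. Re s \<ge> \<alpha>} (\<lambda>s. f (s + of_real x))"
  by (rule continuous_on_compose2[OF contf]) (auto intro!: continuous_intros simp: halfplane_def)

lemma translate_bounded:
  "x > 0 \<Longrightarrow> Re s \<ge> \<alpha> \<Longrightarrow> norm (f (s + of_real x)) \<le> sqrt (K + 1) + (K + 1) / x"
  by (rule halfplane_energy_bounded[OF hol E K]) auto

lemma translate_Complex: "Complex \<sigma> t + of_real x = Complex (\<sigma> + x) t"
  by (simp add: complex_eq_iff)

lemma line_measurable: "\<sigma> > \<alpha> \<Longrightarrow> (\<lambda>t. (norm (f (Complex \<sigma> t)))\<^sup>2) \<in> borel_measurable borel"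
  by (rule line_energy_measurable[OF continuous_on_subset[OF contf]]) (auto simp: halfplane_def)

lemma line_continuous: "\<sigma> > \<alpha> \<Longrightarrow> continuous_on UNIV (\<lambda>t. f (Complex \<sigma> t))"
  by (rule continuous_on_compose2[OF contf continuous_on_Complex]) (auto simp: halfplane_def)

text \<open>Let \<open>k\<close> be the supremum of the energies. If two translates with arbitrarily small parameters stay \<open>\<epsilon>\<close> apart, then the parallelogram law bounds
the energy of their sum on the boundary line by \<open>4 k - \<epsilon>\<close>. By \<open>line_mean_mono\<close> the same bound
holds on every line inside, where the sums converge to \<open>2 f\<close>. Hence \<open>4 k \<le> 4 k - \<epsilon>\<close>, a contradiction.\<close>

lemma translates_Cauchy:
  assumes \<epsilon>: "\<epsilon> > 0"
  shows "\<exists>x0>0. \<forall>x x'. 0 < x \<and> x < x0 \<and> 0 < x' \<and> x' < x0 \<longrightarrow>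
    (\<integral>\<^sup>+t. ennreal ((norm (f (Complex (\<alpha> + x) t) - f (Complex (\<alpha> + x') t)))\<^sup>2) \<partial>lborel) \<le> ennreal \<epsilon>"
proof (rule ccontr)
  define N where "N \<sigma> = energy_on_line f \<sigma>" for \<sigma>
  define D where "D x x' = (\<integral>\<^sup>+t. ennreal ((norm (f (Complex (\<alpha> + x) t) - f (Complex (\<alpha> + x') t)))\<^sup>2) \<partial>lborel)" for x x'
  assume "\<not> ?thesis"
  then have neg: "\<not> (\<exists>x0>0. \<forall>x x'. 0 < x \<and> x < x0 \<and> 0 < x' \<and> x' < x0 \<longrightarrow> D x x' \<le> ennreal \<epsilon>)"
    unfolding D_def .
  have "\<forall>n::nat. \<exists>x x'. 0 < x \<and> x < 1 / (real n + 1) \<and> 0 < x' \<and> x' < 1 / (real n + 1) \<and> \<not> D x x' \<le> ennreal \<epsilon>"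
  proof
    fix n :: nat
    have "(0::real) < 1 / (real n + 1)" by simp
    then show "\<exists>x x'. 0 < x \<and> x < 1 / (real n + 1) \<and> 0 < x' \<and> x' < 1 / (real n + 1) \<and> \<not> D x x' \<le> ennreal \<epsilon>"
      using neg by blast
  qed
  then obtain x x' where xx: "\<And>n::nat. 0 < x n \<and> x n < 1 / (real n + 1) \<and> 0 < x' n \<and> x' n < 1 / (real n + 1)"
      and big: "\<And>n. \<not> D (x n) (x' n) \<le> ennreal \<epsilon>" by metis
  have small: "(\<lambda>n. 1 / (real n + 1)) \<longlonglongrightarrow> 0" by real_asymp
  have x: "x n > 0" "x' n > 0" for n using xx by auto
  have xl: "x \<longlonglongrightarrow> 0" "x' \<longlonglongrightarrow> 0"
    by (rule tendsto_sandwich[OF _ _ tendsto_const small]; use xx in \<open>auto intro!: always_eventually less_imp_le\<close>)+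
  define S where "S = (SUP \<sigma>\<in>{\<alpha><..}. N \<sigma>)"
  have "S \<le> ennreal K" unfolding S_def N_def by (intro SUP_least E) auto
  then obtain k where k: "S = ennreal k" "k \<ge> 0" by (cases S) (auto simp: top_unique)
  have NS: "N \<sigma> \<le> ennreal k" if "\<sigma> > \<alpha>" for \<sigma>
    unfolding k(1)[symmetric] S_def using that by (intro SUP_upper) auto
  define h where "h n s = f (s + of_real (x n)) + f (s + of_real (x' n))" for n s
  have hE: "energy_on_line (h n) \<alpha> + ennreal \<epsilon> \<le> ennreal (4 * k)" for n
  proof -
    have [measurable]: "(\<lambda>t. (norm (f (Complex (\<alpha> + x n) t)))\<^sup>2) \<in> borel_measurable borel"
      "(\<lambda>t. (norm (f (Complex (\<alpha> + x' n) t)))\<^sup>2) \<in> borel_measurable borel"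
      using x by (auto intro!: line_measurable)
    have [measurable]: "(\<lambda>t. (norm (f (Complex (\<alpha> + x n) t) + f (Complex (\<alpha> + x' n) t)))\<^sup>2) \<in> borel_measurable borel"
      "(\<lambda>t. (norm (f (Complex (\<alpha> + x n) t) - f (Complex (\<alpha> + x' n) t)))\<^sup>2) \<in> borel_measurable borel"
      using x[of n] by (intro borel_measurable_continuous_onI continuous_intros line_continuous; simp)+
    have "energy_on_line (h n) \<alpha> + ennreal \<epsilon>
        \<le> energy_on_line (h n) \<alpha> + D (x n) (x' n)"
      using big[of n] by (intro add_left_mono) auto
    also have "\<dots> = (\<integral>\<^sup>+t. ennreal ((norm (f (Complex (\<alpha> + x n) t) + f (Complex (\<alpha> + x' n) t)))\<^sup>2)
        + ennreal ((norm (f (Complex (\<alpha> + x n) t) - f (Complex (\<alpha> + x' n) t)))\<^sup>2) \<partial>lborel)"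
      unfolding D_def h_def translate_Complex by (rule nn_integral_add[symmetric]) measurable
    also have "\<dots> = (\<integral>\<^sup>+t. ennreal 2 * ennreal ((norm (f (Complex (\<alpha> + x n) t)))\<^sup>2)
        + ennreal 2 * ennreal ((norm (f (Complex (\<alpha> + x' n) t)))\<^sup>2) \<partial>lborel)"
      by (intro nn_integral_cong) (simp add: ennreal_plus[symmetric] ennreal_mult[symmetric] parallelogram_law
          del: ennreal_plus ennreal_numeral)
    also have "\<dots> = ennreal 2 * N (\<alpha> + x n) + ennreal 2 * N (\<alpha> + x' n)"
      unfolding N_def by (subst nn_integral_add) (auto simp: nn_integral_cmult)
    also have "\<dots> \<le> ennreal 2 * ennreal k + ennreal 2 * ennreal k"
      using x[of n] by (intro add_mono mult_left_mono NS) auto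
    also have "\<dots> = ennreal (4 * k)"
      using k(2) by (simp add: ennreal_plus[symmetric] ennreal_mult[symmetric] del: ennreal_plus ennreal_numeral)
    finally show ?thesis .
  qed
  have \<epsilon>k: "\<epsilon> \<le> 4 * k"
  proof -
    have "ennreal \<epsilon> \<le> ennreal (4 * k)" using hE[of 0] by (rule order_trans[rotated]) (simp add: add_increasing)
    then show ?thesis using k(2) by simp
  qed
  have hE': "energy_on_line (h n) \<alpha> \<le> ennreal (4 * k - \<epsilon>)" for n
  proof (cases "\<integral>\<^sup>+t. ennreal ((norm (h n (Complex \<alpha> t)))\<^sup>2) \<partial>lborel")
    case (real I)
    then show ?thesis
      using hE[of n] \<epsilon> k(2) by (simp flip: ennreal_plus)
  next
    case top
    then show ?thesis using hE[of n] by (simp add: top_unique)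
  qed
  have "N \<sigma> \<le> ennreal (k - \<epsilon> / 4)" if \<sigma>: "\<sigma> > \<alpha>" for \<sigma>
  proof -
    have hc: "continuous_on {s. Re s \<ge> \<alpha>} (h n)" for n
      unfolding h_def by (intro continuous_intros translate_continuous x)
    have hh: "vholomorphic_on (h n) (halfplane \<alpha>)" for n
      unfolding h_def by (intro vholomorphic_on_add vholomorphic_on_translate hol less_imp_le x)
    have hB: "norm (h n s) \<le> (sqrt (K + 1) + (K + 1) / x n) + (sqrt (K + 1) + (K + 1) / x' n)"
      if "Re s \<ge> \<alpha>" for n s
      unfolding h_def using that by (intro norm_triangle_mono translate_bounded x)
    have le: "energy_on_line (h n) \<sigma> \<le> ennreal (4 * k - \<epsilon>)" for n
      using line_mean_mono[OF hc hh hB \<sigma>, of n] hE'[of n] by (auto intro: order_trans)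
    have "(\<integral>\<^sup>+t. ennreal ((norm (2 *\<^sub>R f (Complex \<sigma> t)))\<^sup>2) \<partial>lborel) \<le> ennreal (4 * k - \<epsilon>)"
    proof (rule nn_integral_le_of_tendsto[OF _ _ le])
      fix n
      have [measurable]: "(\<lambda>t. (norm (h n (Complex \<sigma> t)))\<^sup>2) \<in> borel_measurable borel"
        using \<sigma> by (intro line_energy_measurable continuous_on_subset[OF hc]) auto
      show "(\<lambda>t. ennreal ((norm (h n (Complex \<sigma> t)))\<^sup>2)) \<in> borel_measurable lborel" by measurable
    next
      fix t
      have l: "(\<lambda>n. f (Complex \<sigma> t + of_real (y n))) \<longlonglongrightarrow> f (Complex \<sigma> t)" if "y \<longlonglongrightarrow> 0" "\<And>n. y n > 0" for y
      proof (rule continuous_on_tendsto_compose[OF contf])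
        show "(\<lambda>n. Complex \<sigma> t + of_real (y n)) \<longlonglongrightarrow> Complex \<sigma> t"
          using tendsto_add[OF tendsto_const tendsto_of_real[OF that(1)], of "Complex \<sigma> t"] by simp
      qed (use \<sigma> that in \<open>auto simp: halfplane_def intro!: always_eventually add_pos_pos less_trans[OF \<sigma>]\<close>)
      have "(\<lambda>n. h n (Complex \<sigma> t)) \<longlonglongrightarrow> f (Complex \<sigma> t) + f (Complex \<sigma> t)"
        unfolding h_def by (intro tendsto_add l xl x)
      then have "(\<lambda>n. h n (Complex \<sigma> t)) \<longlonglongrightarrow> 2 *\<^sub>R f (Complex \<sigma> t)" by (simp add: scaleR_2)
      then show "(\<lambda>n. ennreal ((norm (h n (Complex \<sigma> t)))\<^sup>2)) \<longlonglongrightarrow> ennreal ((norm (2 *\<^sub>R f (Complex \<sigma> t)))\<^sup>2)"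
        by (intro tendsto_ennrealI tendsto_intros)
    qed
    also have "(\<integral>\<^sup>+t. ennreal ((norm (2 *\<^sub>R f (Complex \<sigma> t)))\<^sup>2) \<partial>lborel) = ennreal 4 * N \<sigma>"
      unfolding N_def using \<sigma> line_measurable[OF \<sigma>]
      by (subst nn_integral_cmult[symmetric])
         (auto simp: power_mult_distrib ennreal_mult[symmetric] simp del: ennreal_numeral)
    also have "ennreal (4 * k - \<epsilon>) = ennreal 4 * ennreal (k - \<epsilon> / 4)"
      using \<epsilon>k by (simp add: ennreal_mult[symmetric] algebra_simps del: ennreal_numeral)
    finally show ?thesis by (subst (asm) ennreal_mult_le_mult_iff) auto
  qed
  then have "ennreal k \<le> ennreal (k - \<epsilon> / 4)"
    unfolding k(1)[symmetric] S_def by (intro SUP_least) auto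
  then show False using \<epsilon> \<epsilon>k by (subst (asm) ennreal_le_iff) auto
qed

end

section \<open>The maximal inequality\<close>

text \<open>The Hardy-Littlewood maximal inequality, stated with an exceptional set outside of which all averages
over intervals are at most \<open>l\<close>. The intervals with larger average have bounded length, so Vitali's covering lemma selects
disjoint ones whose fivefold enlargements still cover. The measure of a selected interval is at most the
integral over it divided by \<open>l\<close>.\<close>

lemma maximal_weak_type:
  fixes \<phi> :: "real \<Rightarrow> ennreal"
  assumes [measurable]: "\<phi> \<in> borel_measurable borel" and A: "(\<integral>\<^sup>+t. \<phi> t \<partial>lborel) \<le> ennreal A" "A \<ge> 0"
    and l: "l > 0"
  obtains B where "B \<in> sets lborel" "emeasure lborel B \<le> ennreal (5 * A / l)"
    "\<And>y u. y \<notin> B \<Longrightarrow> u > 0 \<Longrightarrow> (\<integral>\<^sup>+t\<in>ball y u. \<phi> t \<partial>lborel) \<le> ennreal (2 * l * u)"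
proof -
  define \<Phi> where "\<Phi> i = (\<integral>\<^sup>+t\<in>ball (fst i) (snd i). \<phi> t \<partial>lborel)" for i :: "real \<times> real"
  define I where "I = {i. snd i > 0 \<and> \<not> \<Phi> i \<le> ennreal (2 * l * snd i)}"
  have small: "0 < snd i \<and> snd i \<le> A / (2 * l)" if "i \<in> I" for i
  proof -
    have "\<Phi> i \<le> (\<integral>\<^sup>+t. \<phi> t \<partial>lborel)"
      unfolding \<Phi>_def by (intro nn_integral_mono) (auto split: split_indicator)
    also have "\<dots> \<le> ennreal A" by (rule A)
    finally have "ennreal (2 * l * snd i) < ennreal A" using that by (auto simp: I_def)
    then show ?thesis using that l by (simp add: I_def ennreal_less_iff field_simps)
  qed
  obtain C where C: "countable C" "C \<subseteq> I"
      and disj: "pairwise (\<lambda>i j. disjnt (ball (fst i) (snd i)) (ball (fst j) (snd j))) C"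
      and cov: "(\<Union>i\<in>I. ball (fst i) (snd i)) \<subseteq> (\<Union>i\<in>C. ball (fst i) (5 * snd i))"
    using Vitali_covering_lemma_balls[where S = "\<Union>i\<in>I. ball (fst i) (snd i)" and K = I and a = fst
      and r = snd and B = "A / (2 * l)"] small by blast
  define c where "c n = fst (from_nat_into C n)" for n
  \<comment> \<open>indices outside of the enumeration of \<open>C\<close> carry radius \<open>0\<close>, that is, empty intervals, which keeps the family disjoint\<close>
  define r where "r n = (if n \<in> to_nat_on C ` C then snd (from_nat_into C n) else 0)" for n
  have r: "r n = 0 \<or> (n \<in> to_nat_on C ` C \<and> from_nat_into C n \<in> C \<and> r n = snd (from_nat_into C n))" for n
    using C(1) by (auto simp: r_def)
  have r0: "r n \<ge> 0" for n using r[of n] small C(2) by fastforce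
  define B where "B = (\<Union>n. ball (c n) (5 * r n))"
  have df: "disjoint_family (\<lambda>n. ball (c n) (r n))"
    unfolding disjoint_family_on_def
  proof (intro ballI impI)
    fix m n :: nat assume "m \<noteq> n"
    show "ball (c m) (r m) \<inter> ball (c n) (r n) = {}"
    proof (cases "r m = 0 \<or> r n = 0")
      case False
      then have m: "m \<in> to_nat_on C ` C" "from_nat_into C m \<in> C" "r m = snd (from_nat_into C m)"
        and n: "n \<in> to_nat_on C ` C" "from_nat_into C n \<in> C" "r n = snd (from_nat_into C n)"
        using r[of m] r[of n] by auto
      have "from_nat_into C m \<noteq> from_nat_into C n"
        using m(1) n(1) \<open>m \<noteq> n\<close> C(1) by (metis to_nat_on_from_nat_into)
      then show ?thesis
        using disj m(2,3) n(2,3) by (auto simp: pairwise_def disjnt_def c_def)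
    qed auto
  qed
  have big: "ennreal (2 * l * r n) \<le> (\<integral>\<^sup>+t\<in>ball (c n) (r n). \<phi> t \<partial>lborel)" for n
  proof (cases "r n = 0")
    case False
    then have "from_nat_into C n \<in> I" "r n = snd (from_nat_into C n)" using r[of n] C(2) by auto
    then show ?thesis by (auto simp: I_def \<Phi>_def c_def)
  qed simp
  have "ennreal (l / 5) * emeasure lborel B \<le> ennreal (l / 5) * (\<Sum>n. emeasure lborel (ball (c n) (5 * r n)))"
    unfolding B_def by (intro mult_left_mono emeasure_subadditive_countably) auto
  also have "\<dots> = (\<Sum>n. ennreal (2 * l * r n))"
  proof (subst ennreal_suminf_cmult[symmetric], rule suminf_cong)
    fix n
    have "emeasure lborel (ball (c n) (5 * r n)) = ennreal (10 * r n)"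
      using r0[of n] by (simp add: ball_eq_greaterThanLessThan)
    then show "ennreal (l / 5) * emeasure lborel (ball (c n) (5 * r n)) = ennreal (2 * l * r n)"
      using l r0[of n] by (simp flip: ennreal_mult)
  qed
  also have "\<dots> \<le> (\<Sum>n. \<integral>\<^sup>+t\<in>ball (c n) (r n). \<phi> t \<partial>lborel)"
    using big by (intro suminf_le) auto
  also have "\<dots> = (\<integral>\<^sup>+t. (\<Sum>n. \<phi> t * indicator (ball (c n) (r n)) t) \<partial>lborel)"
    by (rule nn_integral_suminf[symmetric])
       (intro borel_measurable_times_ennreal borel_measurable_indicator, auto)
  also have "\<dots> = (\<integral>\<^sup>+t. \<phi> t * indicator (\<Union>n. ball (c n) (r n)) t \<partial>lborel)"
    by (simp add: suminf_indicator[OF df])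
  also have "\<dots> \<le> (\<integral>\<^sup>+t. \<phi> t \<partial>lborel)" by (intro nn_integral_mono) (auto split: split_indicator)
  also have "\<dots> \<le> ennreal A" by (rule A)
  also have "\<dots> = ennreal (l / 5) * ennreal (5 * A / l)" using l A(2) by (simp flip: ennreal_mult)
  finally have "emeasure lborel B \<le> ennreal (5 * A / l)"
    using l by (subst (asm) ennreal_mult_le_mult_iff) auto
  moreover have "B \<in> sets lborel" unfolding B_def by auto
  moreover have "(\<integral>\<^sup>+t\<in>ball y u. \<phi> t \<partial>lborel) \<le> ennreal (2 * l * u)" if y: "y \<notin> B" and u: "u > 0" for y u
  proof (rule ccontr)
    assume "\<not> ?thesis"
    then have "(y, u) \<in> I" using u by (simp add: I_def \<Phi>_def)
    then have "y \<in> (\<Union>i\<in>C. ball (fst i) (5 * snd i))" using cov u by force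
    then obtain i where i: "i \<in> C" "y \<in> ball (fst i) (5 * snd i)" by blast
    have "y \<in> ball (c (to_nat_on C i)) (5 * r (to_nat_on C i))"
      using i C(1) by (simp add: c_def r_def)
    then show False using y unfolding B_def by blast
  qed
  ultimately show ?thesis using that by blast
qed

text \<open>The kernel is dominated on the dyadic shell \<open>|t| \<approx> 2\<^sup>k x\<close> by a multiple of \<open>4\<^sup>-\<^sup>k / x\<close>; the interval of radius
\<open>2\<^sup>k x\<close> has length of order \<open>2\<^sup>k x\<close>, which leaves a convergent geometric series in \<open>poisson_average_le\<close>.\<close>

lemma line_kernel_le_dyadic:
  assumes x: "x > 0"
  shows "\<exists>k. \<bar>t\<bar> < 2 ^ k * x \<and> line_kernel x t \<le> 8 / x * (1 / 4) ^ k"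
proof -
  have "\<exists>k::nat. \<bar>t\<bar> / x < 2 ^ k" by (rule real_arch_pow) simp
  then have ex: "\<exists>k::nat. \<bar>t\<bar> < 2 ^ k * x" using x by (simp add: field_simps)
  define k where "k = (LEAST k::nat. \<bar>t\<bar> < 2 ^ k * x)"
  have k: "\<bar>t\<bar> < 2 ^ k * x" unfolding k_def by (rule LeastI_ex[OF ex])
  have "line_kernel x t \<le> 8 / x * (1 / 4) ^ k"
  proof (cases k)
    case 0
    have "line_kernel x t \<le> 2 / x" by (rule line_kernel_le[OF x])
    also have "\<dots> \<le> 8 / x" using x by (simp add: field_simps)
    finally show ?thesis by (simp add: 0)
  next
    case (Suc m)
    have "\<not> \<bar>t\<bar> < 2 ^ m * x" using Suc not_less_Least[of m "\<lambda>k. \<bar>t\<bar> < 2 ^ k * x"] by (simp add: k_def)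
    then have "(2 ^ m * x)\<^sup>2 \<le> \<bar>t\<bar>\<^sup>2" using x by (intro power_mono) auto
    then have t: "4 ^ m * x\<^sup>2 \<le> t\<^sup>2" by (simp add: power_mult_distrib power_mult[symmetric] mult.commute[of m])
       (simp add: power_mult)
    have "line_kernel x t \<le> 2 * x / (4 ^ m * x\<^sup>2)"
      unfolding line_kernel_def using x t
      by (intro divide_left_mono mult_pos_pos) (auto simp: add_pos_nonneg add_increasing)
    also have "\<dots> = 8 / x * (1 / 4) ^ k" using x by (simp add: Suc power2_eq_square field_simps)
    finally show ?thesis .
  qed
  then show ?thesis using k by blast
qed

lemma poisson_average_le:
  fixes \<phi> :: "real \<Rightarrow> ennreal"
  assumes [measurable]: "\<phi> \<in> borel_measurable borel"
    and avg: "\<And>u. u > 0 \<Longrightarrow> (\<integral>\<^sup>+t\<in>ball y u. \<phi> t \<partial>lborel) \<le> ennreal (2 * l * u)"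
    and l: "l \<ge> 0" and x: "x > 0"
  shows "(\<integral>\<^sup>+t. \<phi> (y + t) * ennreal (line_kernel x t) \<partial>lborel) \<le> ennreal (32 * l)"
proof -
  define a where "a k = 8 / x * (1 / 4) ^ k" for k
  have a: "a k \<ge> 0" for k using x by (simp add: a_def)
  define \<psi> where "\<psi> k t = \<phi> t * indicator (ball y (2 ^ k * x)) t" for k t
  have \<psi>m [measurable]: "\<psi> k \<in> borel_measurable borel" for k
    unfolding \<psi>_def by (intro borel_measurable_times_ennreal borel_measurable_indicator) auto
  define T where "T k t = ennreal (a k) * \<psi> k (y + t)" for k t
  have [measurable]: "T k \<in> borel_measurable borel" for k unfolding T_def by measurable
  have "\<phi> (y + t) * ennreal (line_kernel x t) \<le> (\<Sum>k. T k t)" for t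
  proof -
    obtain k where k: "\<bar>t\<bar> < 2 ^ k * x" "line_kernel x t \<le> a k"
      using line_kernel_le_dyadic[OF x, of t] by (auto simp: a_def)
    have "\<phi> (y + t) * ennreal (line_kernel x t) \<le> \<phi> (y + t) * ennreal (a k)"
      by (intro mult_left_mono ennreal_leI k) auto
    also have "\<dots> = T k t" using k(1) by (simp add: T_def \<psi>_def dist_norm mult.commute)
    also have "\<dots> = (\<Sum>j\<in>{k}. T j t)" by simp
    also have "\<dots> \<le> (\<Sum>k. T k t)" by (intro sum_le_suminf) auto
    finally show ?thesis .
  qed
  then have "(\<integral>\<^sup>+t. \<phi> (y + t) * ennreal (line_kernel x t) \<partial>lborel) \<le> (\<integral>\<^sup>+t. (\<Sum>k. T k t) \<partial>lborel)"
    by (rule nn_integral_mono)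
  also have "\<dots> = (\<Sum>k. \<integral>\<^sup>+t. T k t \<partial>lborel)" by (rule nn_integral_suminf) measurable
  also have "\<dots> \<le> (\<Sum>k. ennreal (16 * l * (1 / 2) ^ k))"
  proof (intro suminf_le)
    fix k
    have "(\<integral>\<^sup>+t. T k t \<partial>lborel) = ennreal (a k) * (\<integral>\<^sup>+t. \<psi> k (y + t) \<partial>lborel)"
      unfolding T_def by (rule nn_integral_cmult) measurable
    also have "(\<integral>\<^sup>+t. \<psi> k (y + t) \<partial>lborel) = (\<integral>\<^sup>+t\<in>ball y (2 ^ k * x). \<phi> t \<partial>lborel)"
      unfolding nn_integral_shift[OF \<psi>m] by (simp add: \<psi>_def[abs_def])
    also have "ennreal (a k) * \<dots> \<le> ennreal (a k) * ennreal (2 * l * (2 ^ k * x))"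
      using x by (intro mult_left_mono avg) auto
    also have "\<dots> = ennreal (a k * (2 * l * (2 ^ k * x)))"
      using a l x by (simp add: ennreal_mult)
    also have "a k * (2 * l * (2 ^ k * x)) = 16 * l * (1 / 2) ^ k"
    proof -
      have "(1 / 4) ^ k * 2 ^ k = (1 / 2 :: real) ^ k" by (simp flip: power_mult_distrib)
      moreover have "a k * (2 * l * (2 ^ k * x)) = 16 * l * ((1 / 4) ^ k * 2 ^ k)"
        using x by (simp add: a_def)
      ultimately show ?thesis by simp
    qed
    finally show "(\<integral>\<^sup>+t. T k t \<partial>lborel) \<le> ennreal (16 * l * (1 / 2) ^ k)" .
  qed auto
  also have "\<dots> = ennreal (32 * l)"
  proof (rule suminf_ennreal_eq)
    show "(\<lambda>k. 16 * l * (1 / 2) ^ k) sums (32 * l)"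
      using sums_mult[OF geometric_sums[of "1 / 2 :: real"], of "16 * l"] by simp
  qed (use l in auto)
  finally show ?thesis .
qed

section \<open>Existence of horizontal limits\<close>

lemma emeasure_liminf_sets_le:
  fixes B :: "nat \<Rightarrow> 'a set"
  assumes [measurable]: "\<And>k. B k \<in> sets M" and le: "\<And>k. emeasure M (B k) \<le> c"
  shows "emeasure M (\<Union>n. \<Inter>k\<in>{n..}. B k) \<le> (c::ennreal)"
proof -
  have "(SUP n. emeasure M (\<Inter>k\<in>{n..}. B k)) = emeasure M (\<Union>n. \<Inter>k\<in>{n..}. B k)"
    by (rule SUP_emeasure_incseq[of "\<lambda>n. \<Inter>k\<in>{n..}. B k"]) (auto simp: incseq_def)
  moreover have "emeasure M (\<Inter>k\<in>{n..}. B k) \<le> c" for n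
    using le[of n] by (rule order_trans[rotated]) (intro emeasure_mono, auto)
  ultimately show ?thesis by (metis SUP_least)
qed

text \<open>The Cauchy condition is stated for countably many tolerances, so that it can hold almost everywhere.\<close>

lemma at_right_limit_of_Cauchy:
  fixes g :: "real \<Rightarrow> 'a::banach"
  assumes C: "\<And>m::nat. \<exists>x0>0. \<forall>x x'. 0 < x \<and> x < x0 \<and> 0 < x' \<and> x' < x0 \<longrightarrow>
      norm (g (a + x) - g (a + x')) \<le> 1 / (real m + 1)"
  shows "\<exists>l. (g \<longlongrightarrow> l) (at_right a)"
proof -
  have C': "\<exists>x0>0. \<forall>x x'. 0 < x \<and> x < x0 \<and> 0 < x' \<and> x' < x0 \<longrightarrow> norm (g (a + x) - g (a + x')) < e"
    if e: "e > 0" for e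
  proof -
    obtain m :: nat where m: "1 / (real m + 1) < e"
      using reals_Archimedean[OF e] by (auto simp: inverse_eq_divide add.commute)
    then show ?thesis using C[of m] by (meson le_less_trans)
  qed
  define s where "s n = g (a + 1 / (real n + 1))" for n
  have small: "\<forall>\<^sub>F n in sequentially. 1 / (real n + 1) < x0" if "x0 > 0" for x0 :: real
    using that by real_asymp
  have "Cauchy s"
  proof (rule CauchyI)
    fix e :: real assume "e > 0"
    then obtain x0 where x0: "x0 > 0"
      "\<And>x x'. 0 < x \<and> x < x0 \<and> 0 < x' \<and> x' < x0 \<Longrightarrow> norm (g (a + x) - g (a + x')) < e"
      using C' by blast
    obtain N where "\<And>n. n \<ge> N \<Longrightarrow> 1 / (real n + 1) < x0"
      using small[OF x0(1)] by (auto simp: eventually_sequentially)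
    then have "\<forall>m\<ge>N. \<forall>n\<ge>N. norm (s m - s n) < e" unfolding s_def by (intro allI impI x0(2)) auto
    then show "\<exists>N. \<forall>m\<ge>N. \<forall>n\<ge>N. norm (s m - s n) < e" by blast
  qed
  then obtain l where l: "s \<longlonglongrightarrow> l" by (metis Cauchy_convergent_iff convergent_def)
  have "(g \<longlongrightarrow> l) (at_right a)"
  proof (rule tendstoI)
    fix e :: real assume e: "e > 0"
    then obtain x0 where x0: "x0 > 0"
      "\<And>x x'. 0 < x \<and> x < x0 \<and> 0 < x' \<and> x' < x0 \<Longrightarrow> norm (g (a + x) - g (a + x')) < e / 2"
      using C'[of "e / 2"] by auto
    have "dist (g y) l < e" if y: "a < y" "y < a + x0" for y
    proof -
      have "\<forall>\<^sub>F n in sequentially. norm (g y - s n) \<le> e / 2"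
        using small[OF x0(1)]
      proof eventually_elim
        case (elim n)
        have "norm (g (a + (y - a)) - g (a + 1 / (real n + 1))) < e / 2"
          using y elim by (intro x0(2)) auto
        then show ?case by (simp add: s_def)
      qed
      then have "norm (g y - l) \<le> e / 2"
        by (intro tendsto_upperbound[OF tendsto_norm[OF tendsto_diff[OF tendsto_const l]]]) auto
      then show ?thesis using e by (simp add: dist_norm)
    qed
    moreover have "\<forall>\<^sub>F y in at_right a. a < y \<and> y < a + x0"
      using x0(1) by (auto simp: eventually_at_right_field intro!: exI[of _ "a + x0"])
    ultimately show "\<forall>\<^sub>F y in at_right a. dist (g y) l < e" by (auto elim: eventually_mono)
  qed
  then show ?thesis ..
qed

context halfplane_energy
begin

definition oscillation_set :: "real \<Rightarrow> real set"
  where "oscillation_set \<delta> = {y. \<not> (\<exists>x0>0. \<forall>x x'. 0 < x \<and> x < x0 \<and> 0 < x' \<and> x' < x0 \<longrightarrow>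
      norm (f (Complex (\<alpha> + x) y) - f (Complex (\<alpha> + x') y)) \<le> \<delta>)}"

text \<open>Fix a small translation \<open>x1\<close> and let the parameters \<open>z k\<close> tend to \<open>0\<close>. The differences of the translates of \<open>f\<close> by \<open>x1\<close> and
\<open>z k\<close> have small energy on the boundary line. Outside of a small set \<open>B k\<close> the maximal inequality
and the Poisson inequality bound them on the whole horizontal line through \<open>y\<close>. A point \<open>y\<close> that lies
outside of infinitely many \<open>B k\<close> inherits the bound for \<open>f(s + x1) - f(s)\<close>. Since
\<open>f(s + x1)\<close> is continuous up to the boundary, the oscillation of \<open>f\<close> at \<open>y\<close> is small.\<close>

lemma oscillation_set_small:
  assumes \<delta>: "\<delta> > 0" and \<eta>: "\<eta> > 0"
  shows "\<exists>B\<in>sets lborel. oscillation_set \<delta> \<subseteq> B \<and> emeasure lborel B \<le> ennreal \<eta>"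
proof -
  \<comment> \<open>\<open>poisson_average_le\<close> costs the factor 32, the kernel has mass \<open>2 \<pi> \<ge> 4\<close>, and \<open>32 l = 4 (\<delta> / 4)\<^sup>2\<close>\<close>
  define l where "l = \<delta>\<^sup>2 / 128"
  have l: "l > 0" using \<delta> by (simp add: l_def)
  \<comment> \<open>compensates the factor \<open>5 / l\<close> of the maximal inequality\<close>
  define \<epsilon> where "\<epsilon> = \<eta> * l / 5"
  have \<epsilon>: "\<epsilon> > 0" using \<eta> l by (simp add: \<epsilon>_def)
  obtain x0 where x0: "x0 > 0" and small: "\<And>x x'. 0 < x \<and> x < x0 \<and> 0 < x' \<and> x' < x0 \<Longrightarrow>
      (\<integral>\<^sup>+t. ennreal ((norm (f (Complex (\<alpha> + x) t) - f (Complex (\<alpha> + x') t)))\<^sup>2) \<partial>lborel) \<le> ennreal \<epsilon>"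
    using translates_Cauchy[OF \<epsilon>] by blast
  define x1 where "x1 = x0 / 2"
  define z where "z k = x0 * (1 / (real k + 2))" for k
  have x1: "0 < x1" "x1 < x0" using x0 by (auto simp: x1_def)
  have z: "0 < z k" "z k < x0" for k
    using x0 mult_strict_left_mono[of "1 / (real k + 2)" 1 x0] by (auto simp: z_def)
  have zl: "(\<lambda>k. complex_of_real (z k)) \<longlonglongrightarrow> of_real 0"
    unfolding z_def by (intro tendsto_of_real) real_asymp
  define F where "F k s = f (s + of_real x1) - f (s + of_real (z k))" for k s
  define \<phi> where "\<phi> k t = ennreal ((norm (F k (Complex \<alpha> t)))\<^sup>2)" for k t
  have Fc: "continuous_on {s. Re s \<ge> \<alpha>} (F k)" for k
    unfolding F_def by (intro continuous_intros translate_continuous x1 z)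
  have Fh: "vholomorphic_on (F k) (halfplane \<alpha>)" for k
    unfolding F_def by (intro vholomorphic_on_diff vholomorphic_on_translate hol less_imp_le x1 z)
  have FB: "norm (F k s) \<le> (sqrt (K + 1) + (K + 1) / x1) + (sqrt (K + 1) + (K + 1) / z k)"
    if "Re s \<ge> \<alpha>" for k s
    unfolding F_def using that
    by (intro order_trans[OF norm_triangle_ineq4] add_mono translate_bounded x1 z)
  have \<phi>m[measurable]: "\<phi> k \<in> borel_measurable borel" for k
  proof -
    have [measurable]: "(\<lambda>t. (norm (F k (Complex \<alpha> t)))\<^sup>2) \<in> borel_measurable borel"
      by (intro line_energy_measurable continuous_on_subset[OF Fc]) auto
    show ?thesis unfolding \<phi>_def by measurable
  qed
  have \<phi>E: "(\<integral>\<^sup>+t. \<phi> k t \<partial>lborel) \<le> ennreal \<epsilon>" for k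
    unfolding \<phi>_def F_def translate_Complex using small x1 z by blast
  have "\<exists>B. B \<in> sets lborel \<and> emeasure lborel B \<le> ennreal (5 * \<epsilon> / l) \<and>
      (\<forall>y u. y \<notin> B \<longrightarrow> u > 0 \<longrightarrow> (\<integral>\<^sup>+t\<in>ball y u. \<phi> k t \<partial>lborel) \<le> ennreal (2 * l * u))" for k
    using maximal_weak_type[OF \<phi>m \<phi>E less_imp_le[OF \<epsilon>] l, of k] by metis
  then obtain B where B: "\<And>k. B k \<in> sets lborel" "\<And>k. emeasure lborel (B k) \<le> ennreal (5 * \<epsilon> / l)"
    "\<And>k y u. y \<notin> B k \<Longrightarrow> u > 0 \<Longrightarrow> (\<integral>\<^sup>+t\<in>ball y u. \<phi> k t \<partial>lborel) \<le> ennreal (2 * l * u)"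
    by metis
  have Fsmall: "norm (F k (Complex (\<alpha> + x) y)) \<le> \<delta> / 4" if y: "y \<notin> B k" and x: "x > 0" for k x y
  proof -
    have "ennreal (2 * pi * (norm (F k (Complex (\<alpha> + x) y)))\<^sup>2) \<le> (\<integral>\<^sup>+t. \<phi> k (y + t) * ennreal (line_kernel x t) \<partial>lborel)"
      unfolding \<phi>_def by (rule halfplane_poisson_inequality(2)[OF Fc Fh FB x])
    also have "\<dots> \<le> ennreal (32 * l)"
      by (rule poisson_average_le[OF \<phi>m B(3)[OF y] less_imp_le[OF l] x])
    finally have "2 * pi * (norm (F k (Complex (\<alpha> + x) y)))\<^sup>2 \<le> 32 * l"
      using l by (simp add: ennreal_le_iff)
    moreover have "4 * (norm (F k (Complex (\<alpha> + x) y)))\<^sup>2 \<le> 2 * pi * (norm (F k (Complex (\<alpha> + x) y)))\<^sup>2"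
      using pi_ge_two by (intro mult_right_mono) auto
    ultimately have "(norm (F k (Complex (\<alpha> + x) y)))\<^sup>2 \<le> (\<delta> / 4)\<^sup>2"
      by (simp add: l_def power_divide)
    then show ?thesis using \<delta> by (simp add: power2_le_iff_abs_le)
  qed
  define Z where "Z = (\<Union>n. \<Inter>k\<in>{n..}. B k)"
  have "oscillation_set \<delta> \<subseteq> Z"
  proof (rule subsetI, rule ccontr)
    fix y assume yo: "y \<in> oscillation_set \<delta>" and yZ: "y \<notin> Z"
    have close: "norm (f (Complex (\<alpha> + x + x1) y) - f (Complex (\<alpha> + x) y)) \<le> \<delta> / 4" if x: "x > 0" for x
    proof (rule ccontr)
      let ?s = "Complex (\<alpha> + x) y"
      assume "\<not> ?thesis"
      then have "\<delta> / 4 < norm (f (?s + of_real x1) - f ?s)" by (simp add: translate_Complex)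
      moreover have "(\<lambda>k. norm (F k ?s)) \<longlonglongrightarrow> norm (f (?s + of_real x1) - f (?s + of_real 0))"
        unfolding F_def
        by (intro tendsto_intros zl continuous_on_tendsto_compose[OF contf])
           (use x z in \<open>auto simp: halfplane_def intro!: always_eventually add_pos_pos\<close>)
      ultimately have "\<forall>\<^sub>F k in sequentially. \<delta> / 4 < norm (F k ?s)"
        by (intro order_tendstoD) auto
      then obtain n where n: "\<And>k. k \<ge> n \<Longrightarrow> \<delta> / 4 < norm (F k ?s)"
        by (auto simp: eventually_sequentially)
      obtain k where "k \<ge> n" "y \<notin> B k" using yZ by (auto simp: Z_def)
      then show False using n[of k] Fsmall[of y k x] x by auto
    qed
    have "((\<lambda>x. f (Complex (\<alpha> + x1) y + of_real x)) \<longlongrightarrow> f (Complex (\<alpha> + x1) y + of_real 0)) (at_right 0)"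
    proof (rule continuous_on_tendsto_compose[OF contf])
      show "((\<lambda>x. Complex (\<alpha> + x1) y + of_real x) \<longlongrightarrow> Complex (\<alpha> + x1) y + of_real 0) (at_right 0)"
        by (intro tendsto_intros)
      show "\<forall>\<^sub>F x in at_right 0. Complex (\<alpha> + x1) y + of_real x \<in> halfplane \<alpha>"
        using x1 by (auto simp: eventually_at_right_field halfplane_def intro!: exI[of _ 1])
    qed (use x1 in \<open>auto simp: halfplane_def\<close>)
    then have "\<forall>\<^sub>F x in at_right 0. dist (f (Complex (\<alpha> + x1) y + of_real x)) (f (Complex (\<alpha> + x1) y + of_real 0)) < \<delta> / 4"
      using \<delta> by (intro tendstoD) auto
    then obtain x2 where x2: "x2 > 0" "\<And>x. 0 < x \<Longrightarrow> x < x2 \<Longrightarrow>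
        norm (f (Complex (\<alpha> + x1 + x) y) - f (Complex (\<alpha> + x1) y)) < \<delta> / 4"
      by (auto simp: eventually_at_right_field translate_Complex dist_norm)
    have half: "norm (f (Complex (\<alpha> + x) y) - f (Complex (\<alpha> + x1) y)) \<le> \<delta> / 2" if "0 < x" "x < x2" for x
    proof -
      have "norm (f (Complex (\<alpha> + x) y) - f (Complex (\<alpha> + x1) y))
          \<le> norm (f (Complex (\<alpha> + x) y) - f (Complex (\<alpha> + x + x1) y))
            + norm (f (Complex (\<alpha> + x1 + x) y) - f (Complex (\<alpha> + x1) y))"
        using norm_triangle_ineq[of "f (Complex (\<alpha> + x) y) - f (Complex (\<alpha> + x + x1) y)"
          "f (Complex (\<alpha> + x1 + x) y) - f (Complex (\<alpha> + x1) y)"] by (simp add: add_ac)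
      also have "\<dots> \<le> \<delta> / 4 + \<delta> / 4"
        using close[of x] x2(2)[of x] that by (intro add_mono) (auto simp: norm_minus_commute)
      finally show ?thesis by simp
    qed
    have "norm (f (Complex (\<alpha> + x) y) - f (Complex (\<alpha> + x') y)) \<le> \<delta>" if "0 < x" "x < x2" "0 < x'" "x' < x2" for x x'
      using norm_triangle_ineq4[of "f (Complex (\<alpha> + x) y) - f (Complex (\<alpha> + x1) y)"
        "f (Complex (\<alpha> + x') y) - f (Complex (\<alpha> + x1) y)"] half[of x] half[of x'] that by simp
    then show False using yo x2(1) unfolding oscillation_set_def by blast
  qed
  moreover have "emeasure lborel Z \<le> ennreal (5 * \<epsilon> / l)"
    unfolding Z_def by (rule emeasure_liminf_sets_le[OF B(1,2)])
  moreover have "5 * \<epsilon> / l = \<eta>" using l by (simp add: \<epsilon>_def)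
  moreover have "Z \<in> sets lborel" unfolding Z_def using B(1) by auto
  ultimately show ?thesis by auto
qed

lemma AE_oscillation:
  assumes \<delta>: "\<delta> > 0"
  shows "AE y in lborel. y \<notin> oscillation_set \<delta>"
proof -
  have "\<forall>n::nat. \<exists>B\<in>sets lborel. oscillation_set \<delta> \<subseteq> B \<and> emeasure lborel B \<le> ennreal (1 / (real n + 1))"
    by (intro allI oscillation_set_small \<delta>) simp
  then obtain B where B: "\<And>n::nat. B n \<in> sets lborel" "\<And>n. oscillation_set \<delta> \<subseteq> B n"
      "\<And>n. emeasure lborel (B n) \<le> ennreal (1 / (real n + 1))" by metis
  have "emeasure lborel (\<Inter>n. B n) \<le> 0"
  proof (rule LIMSEQ_le_const)
    show "(\<lambda>n. ennreal (1 / (real n + 1))) \<longlonglongrightarrow> 0"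
      unfolding ennreal_0[symmetric] by (intro tendsto_ennrealI) real_asymp
    have "emeasure lborel (\<Inter>n. B n) \<le> ennreal (1 / (real n + 1))" for n
      using B(3)[of n] by (rule order_trans[rotated]) (intro emeasure_mono, use B(1) in auto)
    then show "\<exists>N. \<forall>n\<ge>N. emeasure lborel (\<Inter>n. B n) \<le> ennreal (1 / (real n + 1))" by blast
  qed
  then have "(\<Inter>n. B n) \<in> null_sets lborel" using B(1) by (intro null_setsI) auto
  moreover have "{y \<in> space lborel. \<not> y \<notin> oscillation_set \<delta>} \<subseteq> (\<Inter>n. B n)" using B(2) by auto
  ultimately show ?thesis by (rule AE_I')
qed

text \<open>Fatou's theorem for functions with values in a Hilbert space.\<close>

lemma AE_horizontal_limit:
  "AE y in lborel. \<exists>l. ((\<lambda>\<sigma>. f (Complex \<sigma> y)) \<longlongrightarrow> l) (at_right \<alpha>)"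
proof -
  have "AE y in lborel. \<forall>m::nat. y \<notin> oscillation_set (1 / (real m + 1))"
    unfolding AE_all_countable by (intro allI AE_oscillation) simp
  then show ?thesis
  proof eventually_elim
    case (elim y)
    then have "\<exists>x0>0. \<forall>x x'. 0 < x \<and> x < x0 \<and> 0 < x' \<and> x' < x0 \<longrightarrow>
        norm (f (Complex (\<alpha> + x) y) - f (Complex (\<alpha> + x') y)) \<le> 1 / (real m + 1)" for m :: nat
      unfolding oscillation_set_def by blast
    then show ?case by (rule at_right_limit_of_Cauchy)
  qed
qed

end

section \<open>Radial limits and uniqueness\<close>

text \<open>The converse of \<open>AE_circle_of_AE_line\<close>; it uses that the Jacobian is positive.\<close>

lemma AE_line_of_AE_circle:
  assumes b: "b > 0" and Q: "AE \<theta> in lborel. \<theta> \<in> {0<..<2*pi} \<longrightarrow> Q \<theta>"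
  shows "AE t in lborel. Q (pi - 2 * arctan (t / b))"
proof -
  obtain N where N: "{\<theta>. \<not> (\<theta> \<in> {0<..<2*pi} \<longrightarrow> Q \<theta>)} \<subseteq> N" "N \<in> null_sets lborel"
    using Q unfolding eventually_ae_filter by auto
  then have [measurable]: "N \<in> sets borel" by auto
  have [measurable]: "(\<lambda>t. pi - 2 * arctan (t / b)) \<in> borel_measurable borel"
    by (intro borel_measurable_continuous_onI continuous_intros) (use b in auto)
  have "(\<integral>\<^sup>+t. indicator N (pi - 2 * arctan (t / b)) * ennreal (line_kernel b t) \<partial>lborel)
      = (\<integral>\<^sup>+\<theta>\<in>{0<..<2*pi}. indicator N \<theta> \<partial>lborel)"
    unfolding line_kernel_def by (rule nn_integral_circle_eq_line[OF _ b, symmetric]) measurable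
  also have "\<dots> = (\<integral>\<^sup>+\<theta>. 0 \<partial>(lborel :: real measure))"
  proof (rule nn_integral_cong_AE)
    show "AE \<theta> in lborel. indicator N \<theta> * indicator {0<..<2*pi} \<theta> = (0 :: ennreal)"
      using AE_not_in[OF N(2)] by eventually_elim simp
  qed
  also have "\<dots> = 0" by simp
  finally have "AE t in lborel. indicator N (pi - 2 * arctan (t / b)) * ennreal (line_kernel b t) = 0"
    by (subst (asm) nn_integral_0_iff_AE) auto
  then show ?thesis
  proof eventually_elim
    case (elim t)
    have "line_kernel b t > 0" using b by (simp add: line_kernel_def add_pos_nonneg)
    then have "pi - 2 * arctan (t / b) \<notin> N" using elim by (auto simp: indicator_def)
    then show ?case using N(1) circle_angle_range[of t b] by blast
  qed
qed

text \<open>The image in the half-plane of the radius that ends at \<open>e\<^sup>i\<^sup>\<theta>\<close>. Its distance to the boundary line is of order \<open>1 - r\<close>, but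
its deviation from the horizontal line through the end point is only of order \<open>(1 - r)\<^sup>2\<close>, because
the Moebius transformation is conformal and both curves meet the boundary at a right angle.\<close>

lemma radial_path:
  fixes \<alpha> \<beta> \<theta> r :: real
  assumes b: "\<beta> > 0" and t: "\<theta> \<in> {0<..<2*pi}" and r: "0 \<le> r" "r < 1"
  defines "N \<equiv> (cmod (1 - of_real r * cis \<theta>))\<^sup>2"
    and "y0 \<equiv> Im (mobius_inv \<alpha> \<beta> (cis \<theta>))"
    and "s \<equiv> mobius_inv \<alpha> \<beta> (of_real r * cis \<theta>)"
  shows "0 < N" "N \<le> 4" "Re s - \<alpha> = \<beta> * (1 - r\<^sup>2) / N"
    "Im s - y0 = - y0 * (1 - r)\<^sup>2 / N"
proof -
  have nr: "cmod (of_real r * cis \<theta>) = r" using r by (simp add: norm_mult)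
  have nz: "of_real r * cis \<theta> \<noteq> 1" using nr r by auto
  show N0: "0 < N" unfolding N_def using nz by simp
  have "cmod (1 - of_real r * cis \<theta>) \<le> 2"
    using norm_triangle_ineq4[of 1 "of_real r * cis \<theta>"] nr r by simp
  then have "N \<le> 2\<^sup>2" unfolding N_def by (rule power_mono) simp
  then show "N \<le> 4" by simp
  show "Re s - \<alpha> = \<beta> * (1 - r\<^sup>2) / N"
    unfolding s_def N_def Re_mobius_inv[OF nz] nr by simp
  define N1 where "N1 = 2 - 2 * cos \<theta>"
  have Neq: "N = 1 - 2 * r * cos \<theta> + r\<^sup>2"
  proof -
    have "N = (1 - r * cos \<theta>)\<^sup>2 + (r * sin \<theta>)\<^sup>2" unfolding N_def cmod_power2 by simp
    also have "\<dots> = 1 - 2 * r * cos \<theta> + r\<^sup>2 * ((sin \<theta>)\<^sup>2 + (cos \<theta>)\<^sup>2)"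
      by (simp add: power2_eq_square algebra_simps del: sin_cos_squared_add sin_cos_squared_add2 sin_cos_squared_add3)
    finally show ?thesis by simp
  qed
  have N1eq: "(cmod (1 - cis \<theta>))\<^sup>2 = N1"
  proof -
    have "(cmod (1 - cis \<theta>))\<^sup>2 = (1 - cos \<theta>)\<^sup>2 + (sin \<theta>)\<^sup>2" unfolding cmod_power2 by simp
    also have "\<dots> = 1 - 2 * cos \<theta> + ((sin \<theta>)\<^sup>2 + (cos \<theta>)\<^sup>2)"
      by (simp add: power2_eq_square algebra_simps del: sin_cos_squared_add sin_cos_squared_add2 sin_cos_squared_add3)
    finally show ?thesis by (simp add: N1_def)
  qed
  then have N1: "N1 \<noteq> 0" using cis_neq_1[OF t] by auto
  have Ims: "Im s = 2 * \<beta> * r * sin \<theta> / N"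
    unfolding s_def mobius_inv_def N_def by (simp add: Im_divide cmod_power2)
  have y0: "y0 = 2 * \<beta> * sin \<theta> / N1"
    unfolding y0_def mobius_inv_def N1eq[symmetric] by (simp add: Im_divide cmod_power2)
  have key: "r * N1 = N - (1 - r)\<^sup>2"
    unfolding Neq N1_def by (simp add: power2_eq_square algebra_simps)
  have "2 * \<beta> * r * sin \<theta> / N - 2 * \<beta> * sin \<theta> / N1 = 2 * \<beta> * sin \<theta> * (r * N1 - N) / (N * N1)"
  proof -
    have "a * r / N - a / N1 = a * (r * N1 - N) / (N * N1)" for a
      using N0 N1 by (simp add: diff_frac_eq algebra_simps)
    from this[of "2 * \<beta> * sin \<theta>"] show ?thesis by (simp add: mult_ac)
  qed
  then show "Im s - y0 = - y0 * (1 - r)\<^sup>2 / N"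
    unfolding Ims y0 key by simp
qed

context halfplane_energy
begin

text \<open>The Poisson inequality for the translate of \<open>f\<close> by half the distance to the boundary, with the kernel replaced by its maximum.\<close>

lemma norm_le_growth:
  assumes s: "Re s \<ge> \<alpha> + x" and x: "x > 0"
  shows "norm (f s) \<le> sqrt (K / x)"
proof -
  \<comment> \<open>half of the distance is used for the translation, half for the Poisson kernel\<close>
  define x' where "x' = (Re s - \<alpha>) / 2"
  have x': "x' > 0" "x \<le> 2 * x'" using s x by (auto simp: x'_def)
  define F where "F w = f (w + of_real x')" for w
  have Fc: "continuous_on {s. Re s \<ge> \<alpha>} F" unfolding F_def by (rule translate_continuous[OF x'(1)])
  have Fh: "vholomorphic_on F (halfplane \<alpha>)" unfolding F_def
    using x' by (intro vholomorphic_on_translate hol) simp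
  have FB: "norm (F w) \<le> sqrt (K + 1) + (K + 1) / x'" if "Re w \<ge> \<alpha>" for w
    unfolding F_def by (rule translate_bounded[OF x'(1) that])
  have Fs: "F (Complex (\<alpha> + x') (Im s)) = f s"
    unfolding F_def translate_Complex by (rule arg_cong[of _ _ f]) (simp add: complex_eq_iff x'_def)
  define u where "u t = ennreal ((norm (F (Complex \<alpha> t)))\<^sup>2)" for t
  have um [measurable]: "u \<in> borel_measurable borel"
  proof -
    have [measurable]: "(\<lambda>t. (norm (F (Complex \<alpha> t)))\<^sup>2) \<in> borel_measurable borel"
      by (intro line_energy_measurable continuous_on_subset[OF Fc]) auto
    show ?thesis unfolding u_def by measurable
  qed
  have "ennreal (2 * pi * (norm (f s))\<^sup>2) \<le> (\<integral>\<^sup>+t. u (Im s + t) * ennreal (line_kernel x' t) \<partial>lborel)"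
    using halfplane_poisson_inequality(2)[OF Fc Fh FB x'(1), of "Im s"] unfolding Fs u_def .
  also have "\<dots> \<le> (\<integral>\<^sup>+t. u (Im s + t) * ennreal (2 / x') \<partial>lborel)"
    by (intro nn_integral_mono mult_left_mono ennreal_leI line_kernel_le x') auto
  also have "\<dots> = (\<integral>\<^sup>+t. u t \<partial>lborel) * ennreal (2 / x')"
    using nn_integral_shift[OF um, of "Im s"] by (simp add: nn_integral_multc)
  also have "\<dots> \<le> ennreal K * ennreal (2 / x')"
    unfolding u_def F_def translate_Complex using x' by (intro mult_right_mono E) auto
  also have "\<dots> = ennreal (K * (2 / x'))" using K x' by (simp flip: ennreal_mult)
  finally have "2 * pi * (norm (f s))\<^sup>2 \<le> K * (2 / x')"
    using K x' by (subst (asm) ennreal_le_iff) auto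
  moreover have "4 * (norm (f s))\<^sup>2 \<le> 2 * pi * (norm (f s))\<^sup>2"
    using pi_ge_two by (intro mult_right_mono) auto
  moreover have "K * (2 / x') \<le> 4 * (K / x)"
  proof -
    have "K / (2 * x') \<le> K / x" using K x x' by (intro divide_left_mono) auto
    moreover have "K * (2 / x') = 4 * (K / (2 * x'))" by (simp add: field_simps)
    ultimately show ?thesis by linarith
  qed
  ultimately have "(norm (f s))\<^sup>2 \<le> K / x" by linarith
  then show ?thesis by (rule real_le_rsqrt)
qed

text \<open>Cauchy's estimate applied to \<open>norm_le_growth\<close>: on the disc of radius \<open>x / 4\<close> about \<open>s\<close> the derivatives are at most
\<open>4 / x\<close> times the bound of \<open>f\<close> at distance \<open>x / 2\<close> from the boundary.\<close>

lemma local_Lipschitz: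
  assumes s: "Re s = \<alpha> + x" and x: "x > 0" and s': "cmod (s' - s) < x / 4"
  shows "norm (f s' - f s) \<le> (4 / x * sqrt (2 * K / x)) * cmod (s' - s)"
proof -
  define v where "v = f s' - f s"
  define h where "h w = cinner (f w) v" for w
  define M where "M = sqrt (2 * K / x) * norm v"
  have holh: "h holomorphic_on halfplane \<alpha>" unfolding h_def by (rule vholomorphic_on_cinner[OF hol])
  have near: "Re w \<ge> \<alpha> + x / 2" if "cmod (w - s) \<le> x / 2" for w
    using abs_Re_le_cmod[of "w - s"] that s by simp
  have hM: "cmod (h w) \<le> M" if "cmod (w - s) \<le> x / 2" for w
  proof -
    have "norm (f w) \<le> sqrt (K / (x / 2))" using near[OF that] x by (intro norm_le_growth) auto
    then have "norm (f w) * norm v \<le> sqrt (2 * K / x) * norm v" by (intro mult_right_mono) (simp_all add: mult.commute)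
    then show ?thesis unfolding h_def M_def using cinner_Cauchy_Schwarz order_trans by blast
  qed
  have sub: "w \<in> halfplane \<alpha>" if "cmod (w - s) \<le> x / 2" for w
    using near[OF that] x by (simp add: halfplane_def)
  have dh: "cmod (deriv h w) \<le> 4 / x * M" if w: "w \<in> ball s (x / 4)" for w
  proof -
    have b: "cmod (z - s) \<le> x / 2" if "cmod (w - z) \<le> x / 4" for z
      using norm_triangle_ineq[of "z - w" "w - s"] that w by (simp add: dist_norm norm_minus_commute)
    have "cball w (x / 4) \<subseteq> halfplane \<alpha>" using b sub by (auto simp: dist_norm)
    then have hc: "h holomorphic_on cball w (x / 4)" by (rule holomorphic_on_subset[OF holh])
    have "cmod ((deriv ^^ 1) h w) \<le> fact 1 * M / (x / 4) ^ 1"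
    proof (rule Cauchy_inequality)
      show "h holomorphic_on ball w (x / 4)" using ball_subset_cball by (rule holomorphic_on_subset[OF hc])
      show "continuous_on (cball w (x / 4)) h" using hc by (rule holomorphic_on_imp_continuous_on)
      show "cmod (h z) \<le> M" if "cmod (w - z) = x / 4" for z using that by (intro hM b) simp
    qed (use x in simp)
    then show ?thesis by (simp add: mult.commute)
  qed
  have "cmod (h s' - h s) \<le> (4 / x * M) * cmod (s' - s)"
  proof (rule field_differentiable_bound[where S = "ball s (x / 4)" and f' = "deriv h"])
    fix w assume w: "w \<in> ball s (x / 4)"
    then have "w \<in> halfplane \<alpha>" using x by (intro sub) (auto simp: dist_norm norm_minus_commute)
    then show "(h has_field_derivative deriv h w) (at w within ball s (x / 4))"
      using holh open_halfplane holomorphic_derivI has_field_derivative_at_within by blast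
    show "cmod (deriv h w) \<le> 4 / x * M" by (rule dh[OF w])
  qed (use x s' in \<open>auto simp: dist_norm norm_minus_commute\<close>)
  moreover have "h s' - h s = cinner v v" by (simp add: h_def v_def cinner_diff_left)
  ultimately have "cmod (cinner v v) \<le> ((4 / x * sqrt (2 * K / x)) * cmod (s' - s)) * norm v"
    by (simp add: M_def mult_ac)
  then show ?thesis
    unfolding v_def[symmetric] by (rule norm_le_cinnerI) (use x K in auto)
qed

text \<open>Let \<open>s r\<close> run on the image of the radius and let \<open>p r\<close> be the point of the horizontal line with the same real part.
With \<open>x r\<close> of order \<open>1 - r\<close> and \<open>|s r - p r|\<close> of order \<open>(1 - r)\<^sup>2\<close>, \<open>local_Lipschitz\<close> bounds \<open>f(s r) - f(p r)\<close> by a multiple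
of \<open>(1 - r)\<^sup>2 (1 - r)\<^sup>-\<^sup>3\<^sup>/\<^sup>2\<close>, which tends to zero.\<close>

lemma radial_limit_of_horizontal_limit:
  assumes b: "\<beta> > 0" and t: "\<theta> \<in> {0<..<2*pi}"
    and l: "halfplane_boundary_value \<alpha> f (mobius_inv \<alpha> \<beta> (cis \<theta>)) l"
  shows "disc_boundary_value (disc_transform \<alpha> \<beta> f) (cis \<theta>)
     ((of_real (2 * sqrt (\<beta> * pi)) / (1 - cis \<theta>)) *\<^sub>C l)"
proof -
  define y0 where "y0 = Im (mobius_inv \<alpha> \<beta> (cis \<theta>))"
  define s where "s r = mobius_inv \<alpha> \<beta> (of_real r * cis \<theta>)" for r
  define x where "x r = Re (s r) - \<alpha>" for r
  define p where "p r = Complex (\<alpha> + x r) y0" for r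
  define N where "N r = (cmod (1 - of_real r * cis \<theta>))\<^sup>2" for r
  have near1: "\<forall>\<^sub>F r in at_left 1. r \<in> {a<..<1}" if "a < 1" for a :: real
    using that by (rule eventually_at_left_real)
  note rp = radial_path(1,2)[OF b t, folded N_def] radial_path(3,4)[OF b t, where \<alpha> = \<alpha>, folded y0_def s_def N_def x_def]
  have x0: "x r > 0" if "0 \<le> r" "r < 1" for r
    using rp(1,3)[of r] that b by (simp add: power_less_one_iff abs_square_less_1)
  have cmodsp: "cmod (s r - p r) = \<bar>y0\<bar> * (1 - r)\<^sup>2 / N r" if "0 \<le> r" "r < 1" for r
  proof -
    have "s r - p r = \<i> * of_real (Im (s r) - y0)" by (simp add: complex_eq_iff p_def x_def)
    then have "cmod (s r - p r) = \<bar>Im (s r) - y0\<bar>" by (simp only: norm_mult norm_ii norm_of_real mult_1)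
    then show ?thesis using rp(1)[OF that] unfolding rp(4)[OF that] by (simp add: abs_mult)
  qed
  have ratio: "cmod (s r - p r) \<le> x r * (\<bar>y0\<bar> / \<beta> * (1 - r))" if r: "0 \<le> r" "r < 1" for r
  proof -
    have "x r * (\<bar>y0\<bar> / \<beta> * (1 - r)) - cmod (s r - p r) = \<bar>y0\<bar> * (1 - r)\<^sup>2 * r / N r"
      unfolding cmodsp[OF r] rp(3)[OF r] using rp(1)[OF r] b
      by (simp add: field_simps power2_eq_square)
    also have "\<dots> \<ge> 0" using rp(1)[OF r] r by simp
    finally show ?thesis by simp
  qed
  have xlim: "filterlim (\<lambda>r. \<alpha> + x r) (at_right \<alpha>) (at_left 1)"
  proof (rule tendsto_imp_filterlim_at_right)
    have "((\<lambda>r. \<alpha> + \<beta> * (1 - r\<^sup>2) / N r) \<longlongrightarrow> \<alpha> + \<beta> * (1 - 1\<^sup>2) / (cmod (1 - of_real 1 * cis \<theta>))\<^sup>2) (at_left 1)"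
      unfolding N_def using cis_neq_1[OF t] by (intro tendsto_intros) auto
    moreover have "\<forall>\<^sub>F r in at_left 1. \<alpha> + \<beta> * (1 - r\<^sup>2) / N r = \<alpha> + x r"
      using near1[OF zero_less_one] by eventually_elim (auto simp: rp(3))
    ultimately show "((\<lambda>r. \<alpha> + x r) \<longlongrightarrow> \<alpha>) (at_left 1)"
      by (auto intro: Lim_transform_eventually)
    show "\<forall>\<^sub>F r in at_left 1. \<alpha> + x r > \<alpha>"
      using near1[OF zero_less_one] by eventually_elim (auto intro: x0)
  qed
  have hor: "((\<lambda>r. f (p r)) \<longlongrightarrow> l) (at_left 1)"
    unfolding p_def
    using filterlim_compose[OF l[unfolded halfplane_boundary_value_def y0_def[symmetric]] xlim] .
  have "((\<lambda>r. f (s r) - f (p r)) \<longlongrightarrow> 0) (at_left 1)"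
  proof (rule Lim_null_comparison)
    define C where "C = 4 * sqrt (8 * K / \<beta>) * (\<bar>y0\<bar> / \<beta>)"
    \<comment> \<open>for \<open>r > a\<close> the point \<open>s r\<close> lies in the disc about \<open>p r\<close> where \<open>local_Lipschitz\<close> applies\<close>
    define a where "a = 1 - 1 / (4 * (\<bar>y0\<bar> / \<beta>) + 1)"
    have a: "a < 1" using b by (simp add: a_def add_nonneg_pos)
    have "\<forall>\<^sub>F r in at_left 1. r \<in> {max 0 a<..<1}" by (rule near1) (use a in auto)
    then show "\<forall>\<^sub>F r in at_left 1. norm (f (s r) - f (p r)) \<le> C * sqrt (1 - r)"
    proof eventually_elim
      case (elim r)
      then have r: "0 \<le> r" "r < 1" "a < r" by auto
      have xr: "x r > 0" by (rule x0[OF r(1,2)])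
      have "\<bar>y0\<bar> / \<beta> * (1 - r) < 1 / 4"
      proof -
        have "1 - r < 1 / (4 * (\<bar>y0\<bar> / \<beta>) + 1)" using r by (simp add: a_def)
        then have "(4 * (\<bar>y0\<bar> / \<beta>) + 1) * (1 - r) < 1"
          using b by (simp add: pos_less_divide_eq add_nonneg_pos mult.commute)
        then show ?thesis using r by (simp add: algebra_simps)
      qed
      then have "x r * (\<bar>y0\<bar> / \<beta> * (1 - r)) < x r * (1 / 4)" using xr by (rule mult_strict_left_mono)
      then have close: "cmod (s r - p r) < x r / 4" using ratio[OF r(1,2)] by linarith
      have "norm (f (s r) - f (p r)) \<le> (4 / x r * sqrt (2 * K / x r)) * cmod (s r - p r)"
        by (rule local_Lipschitz[OF _ xr close]) (simp add: p_def)
      also have "\<dots> \<le> (4 / x r * sqrt (2 * K / x r)) * (x r * (\<bar>y0\<bar> / \<beta> * (1 - r)))"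
        using xr K by (intro mult_left_mono ratio r) auto
      also have "\<dots> = 4 * sqrt (2 * K / x r) * (\<bar>y0\<bar> / \<beta> * (1 - r))" using xr by simp
      also have "\<dots> \<le> 4 * sqrt (8 * K / \<beta> / (1 - r)) * (\<bar>y0\<bar> / \<beta> * (1 - r))"
      proof (intro mult_right_mono mult_left_mono real_sqrt_le_mono)
        have "\<beta> * (1 - r) \<le> x r * 4"
        proof -
          have "\<beta> * (1 - r) * N r \<le> \<beta> * (1 - r) * 4"
            using rp(2)[OF r(1,2)] b r by (intro mult_left_mono) auto
          also have "\<dots> \<le> \<beta> * (1 - r\<^sup>2) * 4"
            using b r by (simp add: power2_eq_square mult_left_le)
          also have "\<dots> = x r * 4 * N r" using rp(1,3)[OF r(1,2)] by simp
          finally show ?thesis using rp(1)[OF r(1,2)] by simp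
        qed
        then have "1 / x r \<le> 4 / (\<beta> * (1 - r))" using xr b r by (simp add: field_simps)
        then have "2 * K * (1 / x r) \<le> 2 * K * (4 / (\<beta> * (1 - r)))" using K by (intro mult_left_mono) auto
        then show "2 * K / x r \<le> 8 * K / \<beta> / (1 - r)" by simp
      qed (use b r in auto)
      also have "\<dots> = C * sqrt (1 - r)"
      proof -
        have "sqrt (8 * K / \<beta> / (1 - r)) * (1 - r) = sqrt (8 * K / \<beta>) * ((1 - r) / sqrt (1 - r))"
          unfolding real_sqrt_divide[of "8 * K / \<beta>"] by simp
        also have "(1 - r) / sqrt (1 - r) = sqrt (1 - r)" using r by (intro real_div_sqrt) simp
        finally have "sqrt (8 * K / \<beta> / (1 - r)) * (1 - r) = sqrt (8 * K / \<beta>) * sqrt (1 - r)" .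
        then show ?thesis by (simp add: C_def mult_ac)
      qed
      finally show ?case .
    qed
    have "((\<lambda>r. C * sqrt (1 - r)) \<longlongrightarrow> C * sqrt (1 - 1)) (at_left 1)" by (intro tendsto_intros)
    then show "((\<lambda>r. C * sqrt (1 - r)) \<longlongrightarrow> 0) (at_left 1)" by simp
  qed
  then have "((\<lambda>r. f (s r)) \<longlongrightarrow> l) (at_left 1)"
    using tendsto_add[OF _ hor, of "\<lambda>r. f (s r) - f (p r)" 0] by simp
  moreover have "((\<lambda>r. of_real (2 * sqrt (\<beta> * pi)) / (1 - of_real r * cis \<theta>)) \<longlongrightarrow>
      of_real (2 * sqrt (\<beta> * pi)) / (1 - of_real 1 * cis \<theta>)) (at_left 1)"
    using cis_neq_1[OF t] by (intro tendsto_intros) auto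
  ultimately have "((\<lambda>r. (of_real (2 * sqrt (\<beta> * pi)) / (1 - of_real r * cis \<theta>)) *\<^sub>C f (s r)) \<longlongrightarrow>
      (of_real (2 * sqrt (\<beta> * pi)) / (1 - of_real 1 * cis \<theta>)) *\<^sub>C l) (at_left 1)"
    by (intro tendsto_scaleC)
  moreover have "\<forall>\<^sub>F r in at_left 1. (of_real (2 * sqrt (\<beta> * pi)) / (1 - of_real r * cis \<theta>)) *\<^sub>C f (s r)
      = disc_transform \<alpha> \<beta> f (of_real r * cis \<theta>)"
    using near1[OF zero_less_one] by eventually_elim (auto simp: disc_transform_def disc_def s_def norm_mult)
  ultimately show ?thesis
    unfolding disc_boundary_value_def by (auto intro: Lim_transform_eventually)
qed

text \<open>By the \<open>L\<^sup>1\<close> form of the Poisson inequality, \<open>|f(s + z)|\<close> is bounded by a Poisson integral of \<open>u = |f(\<alpha> + z + i t)|\<close>. The functions \<open>u\<close> tend to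
zero almost everywhere as \<open>z \<rightarrow> 0\<close>, and the energy bound makes them uniformly integrable: \<open>u \<le> min u M + u\<^sup>2 / M\<close>, where the first term
tends to zero by dominated convergence and the second contributes at most a constant over \<open>M\<close>.\<close>

lemma zero_of_zero_boundary_values:
  assumes lim: "AE y in lborel. ((\<lambda>\<sigma>. f (Complex \<sigma> y)) \<longlongrightarrow> 0) (at_right \<alpha>)" and s: "s \<in> halfplane \<alpha>"
  shows "f s = 0"
proof -
  define x where "x = Re s - \<alpha>"
  have x: "x > 0" "s = Complex (\<alpha> + x) (Im s)" using s by (auto simp: x_def halfplane_def)
  define z where "z n = 1 / (real n + 1)" for n
  have z: "z n > 0" for n by (simp add: z_def)
  have zl: "z \<longlonglongrightarrow> 0" unfolding z_def by real_asymp
  define F where "F n w = f (w + of_real (z n))" for n w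
  define k where "k t = line_kernel x (t - Im s)" for t
  have k0: "k t \<ge> 0" for t unfolding k_def using x(1) by (rule line_kernel_nonneg)
  have [measurable]: "k \<in> borel_measurable borel" unfolding k_def by measurable
  have kint: "(\<integral>\<^sup>+t. ennreal (k t) \<partial>lborel) = ennreal (2 * pi)"
    using nn_integral_shift[of "\<lambda>t. ennreal (k t)" "Im s"] nn_integral_line_kernel[OF x(1)] by (simp add: k_def)
  define u where "u n t = norm (F n (Complex \<alpha> t))" for n t
  have u0: "u n t \<ge> 0" for n t by (simp add: u_def)
  have ueq: "u n t = norm (f (Complex (\<alpha> + z n) t))" for n t by (simp add: u_def F_def translate_Complex)
  have um [measurable]: "u n \<in> borel_measurable borel" for n
    unfolding ueq using z[of n] by (intro borel_measurable_continuous_onI continuous_intros line_continuous) simp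
  have P: "ennreal (2 * pi * norm (f (s + of_real (z n)))) \<le> (\<integral>\<^sup>+t. ennreal (u n t * k t) \<partial>lborel)" for n
  proof -
    have "ennreal (2 * pi * norm (F n (Complex (\<alpha> + x) (Im s)))) \<le>
        (\<integral>\<^sup>+t. ennreal (norm (F n (Complex \<alpha> (Im s + t)))) * ennreal (line_kernel x t) \<partial>lborel)"
    proof (rule halfplane_poisson_inequality(1)[OF _ _ _ x(1)])
      show "continuous_on {s. \<alpha> \<le> Re s} (F n)" unfolding F_def by (rule translate_continuous[OF z])
      show "vholomorphic_on (F n) (halfplane \<alpha>)" unfolding F_def
        using z[of n] by (intro vholomorphic_on_translate hol) simp
      show "norm (F n w) \<le> sqrt (K + 1) + (K + 1) / z n" if "\<alpha> \<le> Re w" for w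
        unfolding F_def by (rule translate_bounded[OF z that])
    qed
    also have "\<dots> = (\<integral>\<^sup>+t. ennreal (u n (Im s + t) * k (Im s + t)) \<partial>lborel)"
      using x(1) by (intro nn_integral_cong) (simp add: u_def k_def ennreal_mult line_kernel_nonneg)
    also have "\<dots> = (\<integral>\<^sup>+t. ennreal (u n t * k t) \<partial>lborel)"
      by (rule nn_integral_shift[where u = "\<lambda>t. ennreal (u n t * k t)"]) measurable
    finally show ?thesis unfolding x(2)[symmetric] F_def .
  qed
  have bound: "2 * pi * norm (f s) \<le> K * (2 / x) / M" if M: "M > 0" for M
  proof -
    define c where "c = K * (2 / x) / M"
    have c0: "c \<ge> 0" using K x(1) M by (simp add: c_def)
    define J where "J n = (\<integral>\<^sup>+t. ennreal (min (u n t) M * k t) \<partial>lborel)" for n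
    have "J \<longlonglongrightarrow> (\<integral>\<^sup>+t. 0 \<partial>(lborel :: real measure))"
      unfolding J_def
    proof (rule nn_integral_dominated_convergence[where w = "\<lambda>t. ennreal M * ennreal (k t)"])
      show "AE t in lborel. ennreal (min (u j t) M * k t) \<le> ennreal M * ennreal (k t)" for j
        using k0 M by (auto simp: ennreal_mult[symmetric] intro!: AE_I2 ennreal_leI mult_right_mono)
      have "(\<integral>\<^sup>+t. ennreal M * ennreal (k t) \<partial>lborel) = ennreal M * ennreal (2 * pi)"
        unfolding kint[symmetric] by (rule nn_integral_cmult) measurable
      then show "(\<integral>\<^sup>+t. ennreal M * ennreal (k t) \<partial>lborel) < \<infinity>" by (simp add: ennreal_mult_less_top)
      show "AE t in lborel. (\<lambda>j. ennreal (min (u j t) M * k t)) \<longlonglongrightarrow> 0"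
        using lim
      proof eventually_elim
        case (elim t)
        have "filterlim (\<lambda>j. \<alpha> + z j) (at_right \<alpha>) sequentially"
          using z tendsto_add[OF tendsto_const zl, of \<alpha>] by (intro tendsto_imp_filterlim_at_right) auto
        from filterlim_compose[OF elim this] have "(\<lambda>j. u j t) \<longlonglongrightarrow> 0"
          unfolding ueq by (rule tendsto_norm_zero)
        then have "(\<lambda>j. min (u j t) M * k t) \<longlonglongrightarrow> min 0 M * k t" by (intro tendsto_intros)
        then show ?case using M tendsto_ennrealI by force
      qed
    qed measurable
    then have J0: "J \<longlonglongrightarrow> 0" by simp
    have le: "ennreal (2 * pi * norm (f (s + of_real (z n)))) \<le> J n + ennreal c" for n
    proof -
      have "(\<integral>\<^sup>+t. ennreal (u n t * k t) \<partial>lborel) \<le>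
          (\<integral>\<^sup>+t. ennreal (min (u n t) M * k t) + ennreal (2 / x / M) * ennreal ((u n t)\<^sup>2) \<partial>lborel)"
      proof (rule nn_integral_mono)
        fix t
        have "u n t \<le> min (u n t) M + (u n t)\<^sup>2 / M"
        proof (cases "u n t \<le> M")
          case False
          then have "u n t * M \<le> u n t * u n t" using u0[of n t] by (intro mult_left_mono) auto
          then have "u n t \<le> (u n t)\<^sup>2 / M" using M by (simp add: pos_le_divide_eq power2_eq_square)
          then show ?thesis using M False by (simp add: min_def)
        qed (use M in \<open>simp add: min_def\<close>)
        then have "u n t * k t \<le> (min (u n t) M + (u n t)\<^sup>2 / M) * k t" by (rule mult_right_mono) (rule k0)
        also have "\<dots> = min (u n t) M * k t + (u n t)\<^sup>2 / M * k t" by (simp add: distrib_right)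
        also have "\<dots> \<le> min (u n t) M * k t + (u n t)\<^sup>2 / M * (2 / x)"
          unfolding k_def using M x(1) by (intro add_left_mono mult_left_mono line_kernel_le) auto
        finally have "u n t * k t \<le> min (u n t) M * k t + 2 / x / M * (u n t)\<^sup>2" by (simp add: mult_ac)
        then show "ennreal (u n t * k t) \<le> ennreal (min (u n t) M * k t) + ennreal (2 / x / M) * ennreal ((u n t)\<^sup>2)"
          using M x(1) u0[of n t] k0[of t]
          by (simp add: ennreal_mult[symmetric] ennreal_plus[symmetric] del: ennreal_plus)
      qed
      also have "\<dots> = J n + ennreal (2 / x / M) * (\<integral>\<^sup>+t. ennreal ((u n t)\<^sup>2) \<partial>lborel)"
        unfolding J_def by (subst nn_integral_add) (auto simp: nn_integral_cmult)
      also have "\<dots> \<le> J n + ennreal (2 / x / M) * ennreal K"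
        unfolding ueq using z[of n] by (intro add_left_mono mult_left_mono E) auto
      also have "ennreal (2 / x / M) * ennreal K = ennreal c"
        using K x(1) M by (simp add: c_def ennreal_mult[symmetric] mult_ac)
      finally show ?thesis using P[of n] by (rule order_trans[rotated])
    qed
    have "(\<lambda>n. ennreal (2 * pi * norm (f (s + of_real (z n))))) \<longlonglongrightarrow> ennreal (2 * pi * norm (f s))"
    proof (intro tendsto_ennrealI tendsto_intros continuous_on_tendsto_compose[OF contf])
      show "(\<lambda>n. s + of_real (z n)) \<longlonglongrightarrow> s"
        using tendsto_add[OF tendsto_const tendsto_of_real[OF zl], of s] by simp
      have "s + of_real (z n) \<in> halfplane \<alpha>" for n
        using s z[of n] by (simp add: halfplane_def)
      then show "\<forall>\<^sub>F n in sequentially. s + of_real (z n) \<in> halfplane \<alpha>"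
        by (rule always_eventually[OF allI])
    qed (rule s)
    moreover have "(\<lambda>n. J n + ennreal c) \<longlonglongrightarrow> 0 + ennreal c"
      by (intro tendsto_add J0 tendsto_const)
    ultimately have "ennreal (2 * pi * norm (f s)) \<le> 0 + ennreal c"
      by (rule LIMSEQ_le) (intro exI[of _ 0] allI impI le)
    then show ?thesis using c0 unfolding c_def by (simp add: ennreal_le_iff)
  qed
  have "2 * pi * norm (f s) \<le> 0"
  proof (rule field_le_epsilon)
    fix e :: real assume e: "e > 0"
    have "K * (2 / x) / (K * (2 / x) / e + 1) \<le> e"
      using e K x(1) by (simp add: pos_divide_le_eq add_nonneg_pos distrib_left)
    then show "2 * pi * norm (f s) \<le> 0 + e"
      using bound[of "K * (2 / x) / e + 1"] e K x(1) by (simp add: add_nonneg_pos)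
  qed
  then show ?thesis using pi_gt_zero by (auto simp: mult_le_0_iff)
qed

end

section \<open>The map defined by boundary values\<close>

lemma H2_halfplane_energy:
  "f \<in> H2_halfplane \<alpha> \<Longrightarrow> halfplane_energy f \<alpha> ((H2_halfplane_norm \<alpha> f)\<^sup>2)"
  using H2_halfplaneD[of f \<alpha>] by unfold_locales auto

lemma H2_halfplane_scaleC:
  fixes f :: "complex \<Rightarrow> 'v::complex_hilbert_space"
  assumes f: "f \<in> H2_halfplane \<alpha>"
  shows "(\<lambda>s. c *\<^sub>C f s) \<in> H2_halfplane \<alpha>"
proof -
  interpret halfplane_energy f \<alpha> "(H2_halfplane_norm \<alpha> f)\<^sup>2" by (rule H2_halfplane_energy[OF f])
  have "(\<integral>\<^sup>+t. ennreal ((norm (c *\<^sub>C f (Complex \<sigma> t)))\<^sup>2) \<partial>lborel) \<le> ennreal ((cmod c * H2_halfplane_norm \<alpha> f)\<^sup>2)"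
    if \<sigma>: "\<sigma> > \<alpha>" for \<sigma>
  proof -
    have "(\<integral>\<^sup>+t. ennreal ((norm (c *\<^sub>C f (Complex \<sigma> t)))\<^sup>2) \<partial>lborel)
        = ennreal ((cmod c)\<^sup>2) * energy_on_line f \<sigma>"
      using line_measurable[OF \<sigma>]
      by (subst nn_integral_cmult[symmetric]) (auto simp: norm_scaleC power_mult_distrib ennreal_mult)
    also have "\<dots> \<le> ennreal ((cmod c)\<^sup>2) * ennreal ((H2_halfplane_norm \<alpha> f)\<^sup>2)"
      by (intro mult_left_mono E \<sigma>) auto
    finally show ?thesis by (simp add: power_mult_distrib ennreal_mult)
  qed
  moreover have "vholomorphic_on (\<lambda>s. c *\<^sub>C f s) (halfplane \<alpha>)" by (rule vholomorphic_on_scaleC_const[OF hol])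
  moreover have "\<forall>s. s \<notin> halfplane \<alpha> \<longrightarrow> c *\<^sub>C f s = 0" using H2_halfplaneD(1)[OF f] by simp
  ultimately show ?thesis
    using H2_halfplane_norm_le_iff[of \<alpha> "\<lambda>s. c *\<^sub>C f s" "cmod c * H2_halfplane_norm \<alpha> f"]
      H2_halfplane_norm_nonneg[OF f] by simp
qed

lemma H2_halfplane_add:
  fixes f g :: "complex \<Rightarrow> 'v::complex_hilbert_space"
  assumes f: "f \<in> H2_halfplane \<alpha>" and g: "g \<in> H2_halfplane \<alpha>"
  shows "(\<lambda>s. f s + g s) \<in> H2_halfplane \<alpha>"
proof -
  define A where "A = H2_halfplane_norm \<alpha> f"
  define B where "B = H2_halfplane_norm \<alpha> g"
  interpret f: halfplane_energy f \<alpha> "A\<^sup>2" unfolding A_def by (rule H2_halfplane_energy[OF f])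
  interpret g: halfplane_energy g \<alpha> "B\<^sup>2" unfolding B_def by (rule H2_halfplane_energy[OF g])
  have "(\<integral>\<^sup>+t. ennreal ((norm (f (Complex \<sigma> t) + g (Complex \<sigma> t)))\<^sup>2) \<partial>lborel) \<le> ennreal ((sqrt (2 * A\<^sup>2 + 2 * B\<^sup>2))\<^sup>2)"
    if \<sigma>: "\<sigma> > \<alpha>" for \<sigma>
  proof -
    have [measurable]: "(\<lambda>t. (norm (f (Complex \<sigma> t)))\<^sup>2) \<in> borel_measurable borel"
      "(\<lambda>t. (norm (g (Complex \<sigma> t)))\<^sup>2) \<in> borel_measurable borel"
      by (rule f.line_measurable[OF \<sigma>], rule g.line_measurable[OF \<sigma>])
    have "(\<integral>\<^sup>+t. ennreal ((norm (f (Complex \<sigma> t) + g (Complex \<sigma> t)))\<^sup>2) \<partial>lborel)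
        \<le> (\<integral>\<^sup>+t. ennreal 2 * ennreal ((norm (f (Complex \<sigma> t)))\<^sup>2) + ennreal 2 * ennreal ((norm (g (Complex \<sigma> t)))\<^sup>2) \<partial>lborel)"
    proof (rule nn_integral_mono)
      fix t
      have "(norm (f (Complex \<sigma> t) + g (Complex \<sigma> t)))\<^sup>2 \<le> 2 * (norm (f (Complex \<sigma> t)))\<^sup>2 + 2 * (norm (g (Complex \<sigma> t)))\<^sup>2"
        using parallelogram_law[of "f (Complex \<sigma> t)" "g (Complex \<sigma> t)"] zero_le_power2 by (smt (verit))
      then show "ennreal ((norm (f (Complex \<sigma> t) + g (Complex \<sigma> t)))\<^sup>2)
          \<le> ennreal 2 * ennreal ((norm (f (Complex \<sigma> t)))\<^sup>2) + ennreal 2 * ennreal ((norm (g (Complex \<sigma> t)))\<^sup>2)"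
        by (simp add: ennreal_mult[symmetric] ennreal_plus[symmetric] ennreal_leI del: ennreal_plus ennreal_numeral)
    qed
    also have "\<dots> = ennreal 2 * energy_on_line f \<sigma>
        + ennreal 2 * energy_on_line g \<sigma>"
      by (subst nn_integral_add) (auto simp: nn_integral_cmult)
    also have "\<dots> \<le> ennreal 2 * ennreal (A\<^sup>2) + ennreal 2 * ennreal (B\<^sup>2)"
      by (intro add_mono mult_left_mono f.E g.E \<sigma>) auto
    also have "\<dots> = ennreal ((sqrt (2 * A\<^sup>2 + 2 * B\<^sup>2))\<^sup>2)"
      by (simp add: ennreal_mult[symmetric] ennreal_plus[symmetric] del: ennreal_plus ennreal_numeral)
    finally show ?thesis .
  qed
  moreover have "vholomorphic_on (\<lambda>s. f s + g s) (halfplane \<alpha>)" by (rule vholomorphic_on_add[OF f.hol g.hol])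
  moreover have "\<forall>s. s \<notin> halfplane \<alpha> \<longrightarrow> f s + g s = 0"
    using H2_halfplaneD(1)[OF f] H2_halfplaneD(1)[OF g] by simp
  ultimately show ?thesis
    using H2_halfplane_norm_le_iff[of \<alpha> "\<lambda>s. f s + g s" "sqrt (2 * A\<^sup>2 + 2 * B\<^sup>2)"] by simp
qed

lemma AE_boundary_values:
  assumes b: "\<beta> > 0" and f: "f \<in> H2_halfplane \<alpha>"
  shows "AE \<theta> in lborel. \<theta> \<in> {0<..<2*pi} \<longrightarrow>
      (\<exists>l. halfplane_boundary_value \<alpha> f (mobius_inv \<alpha> \<beta> (cis \<theta>)) l)"
  using AE_circle_of_AE_line[OF b halfplane_energy.AE_horizontal_limit[OF H2_halfplane_energy[OF f]], of \<alpha>]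
  unfolding halfplane_boundary_value_def .

lemma D_boundary_relation_disc_transform:
  assumes b: "\<beta> > 0" and f: "f \<in> H2_halfplane \<alpha>"
  shows "D_boundary_relation \<alpha> \<beta> f (disc_transform \<alpha> \<beta> f)"
  unfolding D_boundary_relation_def
  using AE_boundary_values[OF b f]
proof eventually_elim
  case (elim \<theta>)
  then show ?case
    using halfplane_energy.radial_limit_of_horizontal_limit[OF H2_halfplane_energy[OF f] b] by blast
qed

text \<open>Any competitor is the transform of some \<open>h\<close> in \<open>H\<^sup>2\<close> of the half-plane. The radial limits of \<open>g\<close> determine the
horizontal limits of \<open>h\<close>, so \<open>f - h\<close> has boundary values zero.\<close>

lemma D_boundary_relation_unique:
  assumes b: "\<beta> > 0" and f: "f \<in> H2_halfplane \<alpha>" and g: "g \<in> H2_disc"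
    and rel: "D_boundary_relation \<alpha> \<beta> f g"
  shows "g = disc_transform \<alpha> \<beta> f"
proof -
  define C where "C \<theta> = of_real (2 * sqrt (\<beta> * pi)) / (1 - cis \<theta>)" for \<theta>
  obtain h where h: "h \<in> H2_halfplane \<alpha>" "g = disc_transform \<alpha> \<beta> h"
    using bij_disc_transform[OF b, of \<alpha>] g unfolding bij_betw_def by blast
  define d where "d s = f s + (- 1) *\<^sub>C h s" for s
  have d: "d \<in> H2_halfplane \<alpha>"
    unfolding d_def by (intro H2_halfplane_add f H2_halfplane_scaleC h(1))
  have "AE \<theta> in lborel. \<theta> \<in> {0<..<2*pi} \<longrightarrow> halfplane_boundary_value \<alpha> d (mobius_inv \<alpha> \<beta> (cis \<theta>)) 0"
    using rel[unfolded D_boundary_relation_def] AE_boundary_values[OF b h(1)]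
  proof eventually_elim
    case (elim \<theta>)
    show ?case
    proof
      assume t: "\<theta> \<in> {0<..<2*pi}"
      obtain l l' where l: "halfplane_boundary_value \<alpha> f (mobius_inv \<alpha> \<beta> (cis \<theta>)) l"
          "disc_boundary_value g (cis \<theta>) (C \<theta> *\<^sub>C l)"
        and l': "halfplane_boundary_value \<alpha> h (mobius_inv \<alpha> \<beta> (cis \<theta>)) l'"
        using elim t unfolding C_def by blast
      have "disc_boundary_value g (cis \<theta>) (C \<theta> *\<^sub>C l')"
        unfolding h(2) C_def
        by (rule halfplane_energy.radial_limit_of_horizontal_limit[OF H2_halfplane_energy[OF h(1)] b t l'])
      then have "C \<theta> *\<^sub>C l = C \<theta> *\<^sub>C l'"
        using l(2) unfolding disc_boundary_value_def
        by (intro tendsto_unique[OF trivial_limit_at_left_real])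
      then have "inverse (C \<theta>) *\<^sub>C C \<theta> *\<^sub>C l = inverse (C \<theta>) *\<^sub>C C \<theta> *\<^sub>C l'" by simp
      moreover have "C \<theta> \<noteq> 0" using b cis_neq_1[OF t] by (simp add: C_def)
      ultimately have "l = l'" by (simp add: scaleC_scaleC scaleC_one)
      then show "halfplane_boundary_value \<alpha> d (mobius_inv \<alpha> \<beta> (cis \<theta>)) 0"
        using tendsto_diff[OF l(1)[unfolded halfplane_boundary_value_def] l'[unfolded halfplane_boundary_value_def]]
        by (simp add: halfplane_boundary_value_def d_def uminus_scaleC)
    qed
  qed
  from AE_line_of_AE_circle[OF b this]
  have lim: "AE y in lborel. ((\<lambda>\<sigma>. d (Complex \<sigma> y)) \<longlongrightarrow> 0) (at_right \<alpha>)"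
    by (simp add: halfplane_boundary_value_def mobius_inv_cis[OF b])
  have "d s = 0" for s
    using halfplane_energy.zero_of_zero_boundary_values[OF H2_halfplane_energy[OF d] lim] H2_halfplaneD(1)[OF d]
    by blast
  then have "f = h" by (auto simp: d_def uminus_scaleC fun_eq_iff)
  then show ?thesis using h(2) by simp
qed

lemma D_boundary_relation_iff:
  assumes b: "\<beta> > 0" and f: "f \<in> H2_halfplane \<alpha>"
  shows "g \<in> H2_disc \<and> D_boundary_relation \<alpha> \<beta> f g \<longleftrightarrow> g = disc_transform \<alpha> \<beta> f"
  using D_boundary_relation_unique[OF b f] D_boundary_relation_disc_transform[OF b f]
    disc_transform_isometry(1)[OF b f] by blast

theorem corollary2:
  fixes \<alpha> \<beta> :: real
  assumes "\<alpha> > 0" and "\<beta> > 0"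
  shows "(\<forall>f \<in> (H2_halfplane \<alpha> :: (complex \<Rightarrow> 'v::complex_hilbert_space) set).
            (\<exists>!g. g \<in> H2_disc \<and> D_boundary_relation \<alpha> \<beta> f g) \<and>
            (\<forall>\<omega>\<in>disc. D_map \<alpha> \<beta> f \<omega> =
               (of_real (2 * sqrt (\<beta> * pi)) / (1 - \<omega>)) *\<^sub>C f (mobius_inv \<alpha> \<beta> \<omega>))) \<and>
         isometric_isomorphism
           (H2_halfplane \<alpha> :: (complex \<Rightarrow> 'v) set) (H2_halfplane_norm \<alpha>)
           H2_disc H2_disc_norm (D_map \<alpha> \<beta>)"
proof -
  have D: "D_map \<alpha> \<beta> f = disc_transform \<alpha> \<beta> f" if "f \<in> H2_halfplane \<alpha>" for f :: "complex \<Rightarrow> 'v"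
    unfolding D_map_def D_boundary_relation_iff[OF \<open>\<beta> > 0\<close> that] by simp
  have "bij_betw (D_map \<alpha> \<beta>) (H2_halfplane \<alpha> :: (complex \<Rightarrow> 'v) set) H2_disc"
    using bij_disc_transform[OF \<open>\<beta> > 0\<close>] by (rule bij_betw_cong[THEN iffD2, rotated]) (rule D)
  moreover have "D_map \<alpha> \<beta> (\<lambda>s. f s + g s) = (\<lambda>\<omega>. D_map \<alpha> \<beta> f \<omega> + D_map \<alpha> \<beta> g \<omega>)"
    if "f \<in> H2_halfplane \<alpha>" "g \<in> H2_halfplane \<alpha>" for f g :: "complex \<Rightarrow> 'v"
    using that by (auto simp: D H2_halfplane_add disc_transform_def scaleC_add_right)
  moreover have "D_map \<alpha> \<beta> (\<lambda>s. c *\<^sub>C f s) = (\<lambda>\<omega>. c *\<^sub>C D_map \<alpha> \<beta> f \<omega>)"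
    if "f \<in> H2_halfplane \<alpha>" for c and f :: "complex \<Rightarrow> 'v"
    using that by (auto simp: D H2_halfplane_scaleC disc_transform_def scaleC_scaleC mult.commute)
  moreover have "H2_disc_norm (D_map \<alpha> \<beta> f) = H2_halfplane_norm \<alpha> f"
    if "f \<in> H2_halfplane \<alpha>" for f :: "complex \<Rightarrow> 'v"
    using disc_transform_isometry(2)[OF \<open>\<beta> > 0\<close> that] that by (simp add: D)
  ultimately have "isometric_isomorphism (H2_halfplane \<alpha> :: (complex \<Rightarrow> 'v) set) (H2_halfplane_norm \<alpha>)
      H2_disc H2_disc_norm (D_map \<alpha> \<beta>)"
    unfolding isometric_isomorphism_def by blast
  then show ?thesis
    by (auto simp: D D_boundary_relation_iff[OF \<open>\<beta> > 0\<close>] disc_transform_def)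
qed

end
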